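(* Work in ZFC. For any inaccessible cardinal $\kappa$ the following are equivalent: (1) the Grothendieck universe axiom holds and $\mathrm{Val}_{\mathcal{Z}}(V_\kappa,\mathcal{L}_{\in,V_\kappa})=\mathrm{S5}$; (2) $\kappa$ is a $\Sigma_3$-reflecting cardinal.
   Context: The Grothendieck universe axiom asserts that the inaccessible cardinals are unbounded in the ordinals. $\mathcal{Z}=\{V_\lambda\mid\lambda\text{ inaccessible}\}$ is Grothendieck–Zermelo potentialism: $V_\lambda$ accesses $V_\mu$ iff $\lambda\le\mu$; $\Diamond\varphi$ at $V_\lambda$ means $\varphi$ holds at some $V_\mu$, $\mu\ge\lambda$ inaccessible, $\Box\varphi$ at all such; quantifiers range over the current world. $\mathcal{L}_{\in,V_\kappa}$ is the language of set theory with parameters from $V_\kappa$; $\mathrm{Val}_{\mathcal{Z}}(W,\mathcal{L}')$ is the set of propositional modal formulas all of whose substitution instances by $\mathcal{L}'$-assertions are true at $W$. A cardinal $\kappa$ is $\Sigma_3$-reflecting if it is inaccessible and $V_\kappa\prec_{\Sigma_3}V$. *)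

theory Defs
  imports Main
begin

text \<open>
  ZFC is rendered by its arbitrary first-order models: a type \<open>'v\<close> with a binary relation
  satisfying the axioms, where Separation and Replacement are schemes over first-order formulas.
  Neither well-foundedness of the model nor standardness of its natural numbers is assumed.
  Set-theoretic notions (ordinal, inaccessible, \<open>V\<^sub>\<alpha>\<close>, \<dots>) are evaluated inside the model, all
  quantifiers ranging over \<open>'v\<close>; functions, for instance, are elements of the model.
\<close>

section \<open>The language of set theory\<close>

text \<open>Variables are de Bruijn indices.\<close>

datatype fm =
    Member nat nat
  | Equal nat nat
  | Neg fm
  | Conj fm fm
  | Exists fm

abbreviation Forall :: "fm \<Rightarrow> fm" where
  "Forall \<phi> \<equiv> Neg (Exists (Neg \<phi>))"

primrec sat :: "('v \<Rightarrow> 'v \<Rightarrow> bool) \<Rightarrow> 'v set \<Rightarrow> (nat \<Rightarrow> 'v) \<Rightarrow> fm \<Rightarrow> bool" where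
  "sat E U e (Member i j) \<longleftrightarrow> E (e i) (e j)"
| "sat E U e (Equal i j) \<longleftrightarrow> e i = e j"
| "sat E U e (Neg \<phi>) \<longleftrightarrow> \<not> sat E U e \<phi>"
| "sat E U e (Conj \<phi> \<psi>) \<longleftrightarrow> sat E U e \<phi> \<and> sat E U e \<psi>"
| "sat E U e (Exists \<phi>) \<longleftrightarrow> (\<exists>x\<in>U. sat E U (case_nat x e) \<phi>)"

text \<open>The L\'evy hierarchy. In the bounded quantifier, \<open>Member 0 (Suc i)\<close> says that the newly
  bound variable is an element of the outer variable \<open>i\<close>.\<close>

inductive is_Delta0 :: "fm \<Rightarrow> bool" where
  "is_Delta0 (Member i j)"
| "is_Delta0 (Equal i j)"
| "is_Delta0 \<phi> \<Longrightarrow> is_Delta0 (Neg \<phi>)"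
| "is_Delta0 \<phi> \<Longrightarrow> is_Delta0 \<psi> \<Longrightarrow> is_Delta0 (Conj \<phi> \<psi>)"
| "is_Delta0 \<phi> \<Longrightarrow> is_Delta0 (Exists (Conj (Member 0 (Suc i)) \<phi>))"

inductive is_Sigma :: "nat \<Rightarrow> fm \<Rightarrow> bool" and is_Pi :: "nat \<Rightarrow> fm \<Rightarrow> bool" where
  "is_Delta0 \<phi> \<Longrightarrow> is_Sigma 0 \<phi>"
| "is_Delta0 \<phi> \<Longrightarrow> is_Pi 0 \<phi>"
| "is_Pi n \<phi> \<Longrightarrow> is_Sigma (Suc n) \<phi>"
| "is_Sigma (Suc n) \<phi> \<Longrightarrow> is_Sigma (Suc n) (Exists \<phi>)"
| "is_Sigma n \<phi> \<Longrightarrow> is_Pi (Suc n) \<phi>"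
| "is_Pi (Suc n) \<phi> \<Longrightarrow> is_Pi (Suc n) (Forall \<phi>)"

text \<open>An assertion with parameters is a formula together with the values of its free variables.\<close>

type_synonym 'v assertion = "fm \<times> (nat \<Rightarrow> 'v)"

section \<open>Propositional modal logic\<close>

text \<open>Propositional modal formulas have type \<open>nat modal\<close>. Substitution instances by assertions
  have type \<open>'v assertion modal\<close>; substitution is \<open>map_modal\<close>.\<close>

datatype 'a modal =
    Atom 'a
  | Falsum
  | Imp "'a modal" "'a modal"
  | Box "'a modal"

abbreviation Dia :: "'a modal \<Rightarrow> 'a modal" where
  "Dia p \<equiv> Imp (Box (Imp p Falsum)) Falsum"

text \<open>Boolean evaluation in which atoms and boxed formulas count as propositional variables.\<close>

primrec bool_eval :: "('a modal \<Rightarrow> bool) \<Rightarrow> 'a modal \<Rightarrow> bool" where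
  "bool_eval v (Atom a) \<longleftrightarrow> v (Atom a)"
| "bool_eval v Falsum \<longleftrightarrow> False"
| "bool_eval v (Imp p q) \<longleftrightarrow> (bool_eval v p \<longrightarrow> bool_eval v q)"
| "bool_eval v (Box p) \<longleftrightarrow> v (Box p)"

inductive_set S5 :: "nat modal set" where
  tautology: "(\<And>v. bool_eval v p) \<Longrightarrow> p \<in> S5"
| K: "Imp (Box (Imp p q)) (Imp (Box p) (Box q)) \<in> S5"
| T: "Imp (Box p) p \<in> S5"
| four: "Imp (Box p) (Box (Box p)) \<in> S5"
| five: "Imp (Dia p) (Box (Dia p)) \<in> S5"
| modus_ponens: "Imp p q \<in> S5 \<Longrightarrow> p \<in> S5 \<Longrightarrow> q \<in> S5"
| necessitation: "p \<in> S5 \<Longrightarrow> Box p \<in> S5"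

section \<open>Set-theoretic notions inside a structure\<close>

locale set_structure =
  fixes mem :: "'v \<Rightarrow> 'v \<Rightarrow> bool"  (infix "\<^bold>\<in>" 50)
begin

definition subset :: "'v \<Rightarrow> 'v \<Rightarrow> bool"  (infix "\<^bold>\<subseteq>" 50) where
  "x \<^bold>\<subseteq> y \<longleftrightarrow> (\<forall>z. z \<^bold>\<in> x \<longrightarrow> z \<^bold>\<in> y)"

definition is_power :: "'v \<Rightarrow> 'v \<Rightarrow> bool" where
  "is_power p x \<longleftrightarrow> (\<forall>z. z \<^bold>\<in> p \<longleftrightarrow> z \<^bold>\<subseteq> x)"

definition is_upair :: "'v \<Rightarrow> 'v \<Rightarrow> 'v \<Rightarrow> bool" where
  "is_upair p x y \<longleftrightarrow> (\<forall>z. z \<^bold>\<in> p \<longleftrightarrow> z = x \<or> z = y)"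

text \<open>Kuratowski pairs.\<close>

definition is_pair :: "'v \<Rightarrow> 'v \<Rightarrow> 'v \<Rightarrow> bool" where
  "is_pair p x y \<longleftrightarrow> (\<exists>a b. is_upair a x x \<and> is_upair b x y \<and> is_upair p a b)"

text \<open>\<open>maps f x y\<close>: the ordered pair of \<open>x\<close> and \<open>y\<close> belongs to \<open>f\<close>.\<close>

definition maps :: "'v \<Rightarrow> 'v \<Rightarrow> 'v \<Rightarrow> bool" where
  "maps f x y \<longleftrightarrow> (\<exists>p. p \<^bold>\<in> f \<and> is_pair p x y)"

definition function_on :: "'v \<Rightarrow> 'v \<Rightarrow> bool" where
  "function_on f d \<longleftrightarrow>
     (\<forall>p. p \<^bold>\<in> f \<longrightarrow> (\<exists>x y. x \<^bold>\<in> d \<and> is_pair p x y)) \<and>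
     (\<forall>x. x \<^bold>\<in> d \<longrightarrow> (\<exists>!y. maps f x y))"

definition function_into :: "'v \<Rightarrow> 'v \<Rightarrow> 'v \<Rightarrow> bool" where
  "function_into f d c \<longleftrightarrow> function_on f d \<and> (\<forall>x y. maps f x y \<longrightarrow> y \<^bold>\<in> c)"

definition bijection :: "'v \<Rightarrow> 'v \<Rightarrow> 'v \<Rightarrow> bool" where
  "bijection f d c \<longleftrightarrow> function_into f d c \<and> (\<forall>y. y \<^bold>\<in> c \<longrightarrow> (\<exists>!x. maps f x y))"

definition equinumerous :: "'v \<Rightarrow> 'v \<Rightarrow> bool" where
  "equinumerous x y \<longleftrightarrow> (\<exists>f. bijection f x y)"

definition transitive_set :: "'v \<Rightarrow> bool" where
  "transitive_set x \<longleftrightarrow> (\<forall>y. y \<^bold>\<in> x \<longrightarrow> y \<^bold>\<subseteq> x)"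

text \<open>By Foundation, the ordinals are the transitive sets of transitive sets.\<close>

definition ordinal :: "'v \<Rightarrow> bool" where
  "ordinal x \<longleftrightarrow> transitive_set x \<and> (\<forall>y. y \<^bold>\<in> x \<longrightarrow> transitive_set y)"

definition limit_ordinal :: "'v \<Rightarrow> bool" where
  "limit_ordinal x \<longleftrightarrow>
     ordinal x \<and> (\<exists>y. y \<^bold>\<in> x) \<and> (\<forall>y. y \<^bold>\<in> x \<longrightarrow> (\<exists>z. z \<^bold>\<in> x \<and> y \<^bold>\<in> z))"

definition is_omega :: "'v \<Rightarrow> bool" where
  "is_omega w \<longleftrightarrow> limit_ordinal w \<and> (\<forall>x. x \<^bold>\<in> w \<longrightarrow> \<not> limit_ordinal x)"

definition cardinal :: "'v \<Rightarrow> bool" where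
  "cardinal k \<longleftrightarrow> ordinal k \<and> (\<forall>a. a \<^bold>\<in> k \<longrightarrow> \<not> equinumerous a k)"

definition uncountable_cardinal :: "'v \<Rightarrow> bool" where
  "uncountable_cardinal k \<longleftrightarrow> cardinal k \<and> (\<exists>w. is_omega w \<and> w \<^bold>\<in> k)"

text \<open>No function from a smaller ordinal has range unbounded in \<open>k\<close>.\<close>

definition regular :: "'v \<Rightarrow> bool" where
  "regular k \<longleftrightarrow>
     (\<forall>a f. a \<^bold>\<in> k \<and> function_into f a k \<longrightarrow>
        (\<exists>b. b \<^bold>\<in> k \<and> (\<forall>x y. maps f x y \<longrightarrow> y \<^bold>\<in> b)))"

text \<open>The power set of each \<open>a < k\<close> has size less than \<open>k\<close>.\<close>

definition strong_limit :: "'v \<Rightarrow> bool" where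
  "strong_limit k \<longleftrightarrow>
     (\<forall>a p. a \<^bold>\<in> k \<and> is_power p a \<longrightarrow> (\<exists>b. b \<^bold>\<in> k \<and> equinumerous p b))"

definition inaccessible :: "'v \<Rightarrow> bool" where
  "inaccessible k \<longleftrightarrow> uncountable_cardinal k \<and> regular k \<and> strong_limit k"

text \<open>\<open>f\<close> is the sequence of the \<open>V\<^sub>\<beta>\<close> with \<open>\<beta> < \<alpha>\<close>, defined by the recursion
  \<open>V\<^sub>\<beta> = \<Union>\<gamma><\<beta>. Pow V\<^sub>\<gamma>\<close>, which subsumes the usual zero, successor and limit clauses.\<close>

definition cumulative_hierarchy :: "'v \<Rightarrow> 'v \<Rightarrow> bool" where
  "cumulative_hierarchy f \<alpha> \<longleftrightarrow>
     function_on f \<alpha> \<and>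
     (\<forall>\<beta> y. maps f \<beta> y \<longrightarrow>
        (\<forall>x. x \<^bold>\<in> y \<longleftrightarrow> (\<exists>\<gamma> z. \<gamma> \<^bold>\<in> \<beta> \<and> maps f \<gamma> z \<and> x \<^bold>\<subseteq> z)))"

text \<open>The extension of the \<open>V\<^sub>\<alpha>\<close> of the model, again as \<open>\<Union>\<gamma><\<alpha>. Pow V\<^sub>\<gamma>\<close>.\<close>

definition Vset :: "'v \<Rightarrow> 'v set" where
  "Vset \<alpha> = {x. \<exists>f \<gamma> z. cumulative_hierarchy f \<alpha> \<and> maps f \<gamma> z \<and> x \<^bold>\<subseteq> z}"

definition universe_axiom :: bool where
  "universe_axiom \<longleftrightarrow> (\<forall>\<alpha>. ordinal \<alpha> \<longrightarrow> (\<exists>k. inaccessible k \<and> \<alpha> \<^bold>\<in> k))"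

definition Sigma_elementary :: "nat \<Rightarrow> 'v set \<Rightarrow> 'v set \<Rightarrow> bool" where
  "Sigma_elementary n A B \<longleftrightarrow>
     A \<subseteq> B \<and> (\<forall>\<phi> e. is_Sigma n \<phi> \<and> range e \<subseteq> A \<longrightarrow> (sat mem A e \<phi> \<longleftrightarrow> sat mem B e \<phi>))"

definition Sigma_reflecting :: "nat \<Rightarrow> 'v \<Rightarrow> bool" where
  "Sigma_reflecting n k \<longleftrightarrow> inaccessible k \<and> Sigma_elementary n (Vset k) UNIV"

section \<open>Grothendieck--Zermelo potentialism\<close>

text \<open>The world \<open>V\<^sub>\<lambda>\<close> is represented by the inaccessible cardinal \<open>\<lambda>\<close>.\<close>

definition accesses :: "'v \<Rightarrow> 'v \<Rightarrow> bool" where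
  "accesses l m \<longleftrightarrow> inaccessible l \<and> inaccessible m \<and> (l = m \<or> l \<^bold>\<in> m)"

primrec true_at :: "'v \<Rightarrow> 'v assertion modal \<Rightarrow> bool" where
  "true_at l (Atom a) \<longleftrightarrow> sat mem (Vset l) (snd a) (fst a)"
| "true_at l Falsum \<longleftrightarrow> False"
| "true_at l (Imp p q) \<longleftrightarrow> (true_at l p \<longrightarrow> true_at l q)"
| "true_at l (Box p) \<longleftrightarrow> (\<forall>m. accesses l m \<longrightarrow> true_at m p)"

lemma true_at_Dia: "true_at l (Dia p) \<longleftrightarrow> (\<exists>m. accesses l m \<and> true_at m p)"
  by simp

text \<open>Assertions of set theory with parameters from \<open>A\<close>.\<close>

definition assertions :: "'v set \<Rightarrow> 'v assertion set" where
  "assertions A = {(\<phi>, e). range e \<subseteq> A}"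

definition Val :: "'v \<Rightarrow> 'v assertion set \<Rightarrow> nat modal set" where
  "Val l L = {p. \<forall>\<sigma>. range \<sigma> \<subseteq> L \<longrightarrow> true_at l (map_modal \<sigma> p)}"

end

section \<open>Models of ZFC\<close>

locale ZFC_model = set_structure mem
  for mem :: "'v \<Rightarrow> 'v \<Rightarrow> bool"  (infix "\<^bold>\<in>" 50) +
  assumes extensionality: "\<forall>x y. (\<forall>z. z \<^bold>\<in> x \<longleftrightarrow> z \<^bold>\<in> y) \<longrightarrow> x = y"
    and foundation: "\<forall>x. (\<exists>y. y \<^bold>\<in> x) \<longrightarrow> (\<exists>y. y \<^bold>\<in> x \<and> \<not> (\<exists>z. z \<^bold>\<in> x \<and> z \<^bold>\<in> y))"
    and pairing: "\<forall>x y. \<exists>p. is_upair p x y"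
    and union: "\<forall>x. \<exists>u. \<forall>z. z \<^bold>\<in> u \<longleftrightarrow> (\<exists>y. y \<^bold>\<in> x \<and> z \<^bold>\<in> y)"
    and power_set: "\<forall>x. \<exists>p. is_power p x"
    and infinity: "\<exists>w. (\<exists>z. z \<^bold>\<in> w \<and> (\<forall>x. \<not> x \<^bold>\<in> z)) \<and>
      (\<forall>x. x \<^bold>\<in> w \<longrightarrow> (\<exists>y. y \<^bold>\<in> w \<and> (\<forall>z. z \<^bold>\<in> y \<longleftrightarrow> z \<^bold>\<in> x \<or> z = x)))"
    and separation: "\<forall>\<phi> e a. \<exists>b. \<forall>x. x \<^bold>\<in> b \<longleftrightarrow> x \<^bold>\<in> a \<and> sat mem UNIV (case_nat x e) \<phi>"
    and replacement: "\<forall>\<phi> e a.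
      (\<forall>x y y'. x \<^bold>\<in> a \<and> sat mem UNIV (case_nat x (case_nat y e)) \<phi> \<and>
         sat mem UNIV (case_nat x (case_nat y' e)) \<phi> \<longrightarrow> y = y') \<longrightarrow>
      (\<exists>b. \<forall>y. y \<^bold>\<in> b \<longleftrightarrow> (\<exists>x. x \<^bold>\<in> a \<and> sat mem UNIV (case_nat x (case_nat y e)) \<phi>))"
    and choice: "\<forall>x. (\<forall>y. y \<^bold>\<in> x \<longrightarrow> (\<exists>z. z \<^bold>\<in> y)) \<and>
      (\<forall>y y' z. y \<^bold>\<in> x \<and> y' \<^bold>\<in> x \<and> z \<^bold>\<in> y \<and> z \<^bold>\<in> y' \<longrightarrow> y = y') \<longrightarrow>
      (\<exists>c. \<forall>y. y \<^bold>\<in> x \<longrightarrow> (\<exists>!z. z \<^bold>\<in> y \<and> z \<^bold>\<in> c))"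

end

theory Submission
  imports Defs
begin

text \<open>
  S5 at \<open>V\<^sub>\<kappa>\<close> yields the maximality principle \<open>\<diamond>\<box>p \<longrightarrow> p\<close>. Every inaccessible rank is
  $\Sigma_1$-elementary in the universe (Skolem hull and Mostowski collapse), so a true $\Sigma_3$
  statement holds, with its witness, at all sufficiently high worlds; by maximality it then holds at
  \<open>V\<^sub>\<kappa>\<close>. This gives $\Sigma_3$-reflection.

  Conversely, ``every set lies in a world satisfying \<open>\<phi>(a)\<close>'' is a $\Pi_3$ statement, because being
  an inaccessible rank is $\Pi_1$. If \<open>\<kappa>\<close> is $\Sigma_3$-reflecting and some world above \<open>V\<^sub>\<kappa>\<close>
  satisfies \<open>\<phi>(a)\<close>, then \<open>V\<^sub>\<kappa>\<close> satisfies this statement, hence so does the universe. So boxed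
  assertions with parameters in \<open>V\<^sub>\<kappa>\<close> have constant truth values on the worlds above \<open>V\<^sub>\<kappa>\<close>, which
  validates S5. Nothing more is valid: every non-theorem of S5 fails in a finite cluster, and the
  points of the cluster are simulated by the worlds whose distance to the last inaccessible limit
  of inaccessibles is \<open>0, 1, 2, \<dots>\<close>.
\<close>

section \<open>The modal logic S5\<close>

text \<open>The model may be ill-founded and its natural numbers nonstandard, so no induction or
  recursion of the metatheory can run along its ordinals. Every induction, recursion and choice is
  carried out inside the model, for predicates and operations that are first-order definable with
  parameters; this is why a definability condition accompanies nearly every set-theoretic lemma.
  Formulas, by contrast, are objects of the metatheory and truly finite. A hull therefore needs
  closing only under the finitely many subformulas of one formula, and no satisfaction predicate has
  to be built inside the model. The level three arises as follows. Sigma_1-elementarity of a world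
  makes Sigma_2 statements persist from it to the universe, so a Pi_2 statement true in the universe
  holds in every world containing its parameters. Hence a Sigma_3 statement becomes permanent once a
  world contains witnesses for its leading existential block. For the converse, the difficulty is
  that assertions substituted into a modal formula may sit under nested boxes, whereas reflection
  speaks of first-order formulas only; constancy of boxes is used to eliminate them one at a
  time.\<close>

lemma S5_consequence:
  assumes "p \<in> S5" "\<And>v. bool_eval v p \<Longrightarrow> bool_eval v q"
  shows "q \<in> S5"
  using assms by (intro S5.modus_ponens[OF S5.tautology[of "Imp p q"]]) auto

lemma S5_consequence2:
  assumes "p \<in> S5" "q \<in> S5" "\<And>v. bool_eval v p \<Longrightarrow> bool_eval v q \<Longrightarrow> bool_eval v r"
  shows "r \<in> S5"
  using assms
  by (intro S5.modus_ponens[OF S5.modus_ponens[OF S5.tautology[of "Imp p (Imp q r)"]]]) auto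

lemma S5_Box_mono:
  assumes "Imp p q \<in> S5"
  shows "Imp (Box p) (Box q) \<in> S5"
  using S5.modus_ponens[OF S5.K S5.necessitation[OF assms]] .

text \<open>Axiom \<open>five\<close> for the negation of \<open>p\<close> is this statement with a
  double negation under two of its boxes; monotonicity of \<open>Box\<close> removes both.\<close>

lemma S5_not_Box: "Imp (Imp (Box p) Falsum) (Box (Imp (Box p) Falsum)) \<in> S5"
proof -
  let ?n = "\<lambda>p. Imp p Falsum"
  have 1: "Imp (Box (?n (?n p))) (Box p) \<in> S5" "Imp (Box p) (Box (?n (?n p))) \<in> S5"
    by (intro S5_Box_mono S5.tautology; simp)+
  have "Imp (?n (Box (?n (?n p)))) (?n (Box p)) \<in> S5"
    by (rule S5_consequence[OF 1(2)]) auto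
  then have 2: "Imp (Box (?n (Box (?n (?n p))))) (Box (?n (Box p))) \<in> S5"
    by (rule S5_Box_mono)
  have "Imp (?n (Box p)) (Box (?n (Box (?n (?n p))))) \<in> S5"
    by (rule S5_consequence2[OF 1(1) S5.five[of "?n p"]]) auto
  then show ?thesis by (rule S5_consequence2[OF 2]) auto
qed

text \<open>Negative introspection, read contrapositively, turns a possible box into a box, and T
  opens it. This theorem is all that the derivation of reflection takes from S5.\<close>

lemma S5_Dia_Box: "Imp (Dia (Box p)) p \<in> S5"
  by (rule S5_consequence2[OF S5_not_Box[of p] S5.T[of p]]) auto

section \<open>Completeness of S5 for finite clusters\<close>

primrec cluster_eval :: "'w set \<Rightarrow> ('w \<Rightarrow> nat \<Rightarrow> bool) \<Rightarrow> 'w \<Rightarrow> nat modal \<Rightarrow> bool" where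
  "cluster_eval W V w (Atom i) \<longleftrightarrow> V w i"
| "cluster_eval W V w Falsum \<longleftrightarrow> False"
| "cluster_eval W V w (Imp p q) \<longleftrightarrow> (cluster_eval W V w p \<longrightarrow> cluster_eval W V w q)"
| "cluster_eval W V w (Box p) \<longleftrightarrow> (\<forall>u\<in>W. cluster_eval W V u p)"

text \<open>Between clusters, a surjection respecting the valuations is a bounded morphism. It
  serves to number the points of the canonical cluster.\<close>

lemma cluster_eval_reindex:
  assumes "f ` I = W"
  shows "i \<in> I \<Longrightarrow> cluster_eval I (\<lambda>i. V (f i)) i p \<longleftrightarrow> cluster_eval W V (f i) p"
  using assms by (induction p arbitrary: i) auto

text \<open>Subformulas inside a box are searched as well, although \<open>bool_eval\<close> does
  not reach them: the truth lemma descends into boxes and needs their atoms decided too.\<close>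

primrec basics :: "nat modal \<Rightarrow> nat modal list" where
  "basics (Atom i) = [Atom i]"
| "basics Falsum = []"
| "basics (Imp p q) = basics p @ basics q"
| "basics (Box p) = Box p # basics p"

lemma basics_basic: "b \<in> set (basics p) \<Longrightarrow> (\<exists>i. b = Atom i) \<or> (\<exists>q. b = Box q)"
  by (induction p) auto

lemma bool_eval_basic: "b \<in> set (basics p) \<Longrightarrow> bool_eval v b = v b"
  by (drule basics_basic) auto

lemma bool_eval_cong:
  "(\<And>b. b \<in> set (basics p) \<Longrightarrow> v b = w b) \<Longrightarrow> bool_eval v p = bool_eval w p"
  by (induction p) auto

definition literal :: "nat modal set \<Rightarrow> nat modal \<Rightarrow> nat modal" where
  "literal s b = (if b \<in> s then b else Imp b Falsum)"

text \<open>The curried implication from the state description of \<open>s\<close> over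
  \<open>bs\<close> to \<open>q\<close>. Thus derivability of \<open>chain bs s Falsum\<close> means
  that the description is inconsistent, which avoids finite conjunctions.\<close>

definition chain :: "nat modal list \<Rightarrow> nat modal set \<Rightarrow> nat modal \<Rightarrow> nat modal" where
  "chain bs s q = foldr (\<lambda>b. Imp (literal s b)) bs q"

lemma chain_simps [simp]:
  "chain [] s q = q"
  "chain (b # bs) s q = Imp (literal s b) (chain bs s q)"
  by (simp_all add: chain_def)

lemma bool_eval_chain:
  "bool_eval w (chain bs s q) \<longleftrightarrow>
     ((\<forall>b\<in>set bs. bool_eval w b \<longleftrightarrow> b \<in> s) \<longrightarrow> bool_eval w q)"
  by (induction bs) (auto simp: literal_def)

lemma chain_cong: "(\<And>b. b \<in> set bs \<Longrightarrow> b \<in> s \<longleftrightarrow> b \<in> t) \<Longrightarrow> chain bs s q = chain bs t q"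
  by (induction bs) (auto simp: literal_def)

text \<open>Excluded middle merges the two descriptions that differ only at the head of the list.
  Contrapositively this is a finite Lindenbaum lemma: an underivable \<open>q\<close> remains
  underivable from some state description.\<close>

lemma S5_case_split:
  assumes "distinct bs" "\<And>s. s \<subseteq> set bs \<Longrightarrow> chain bs s q \<in> S5"
  shows "q \<in> S5"
  using assms
proof (induction bs)
  case (Cons b bs)
  have "chain bs s q \<in> S5" if s: "s \<subseteq> set bs" for s
  proof -
    have "chain bs (insert b s) q = chain bs s q"
      using Cons.prems(1) by (intro chain_cong) auto
    then have "Imp b (chain bs s q) \<in> S5"
      using Cons.prems(2)[of "insert b s"] s by (auto simp: literal_def)
    moreover have "Imp (Imp b Falsum) (chain bs s q) \<in> S5"
    proof -
      have "s \<subseteq> set (b # bs)" "b \<notin> s" using Cons.prems(1) s by auto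
      from Cons.prems(2)[OF this(1)] this(2) show ?thesis by (simp add: literal_def)
    qed
    ultimately show ?thesis by (rule S5_consequence2) auto
  qed
  then show ?case using Cons by auto
qed auto

text \<open>In S5 both a boxed formula and its negation imply their own necessity, so hypotheses
  that are literals of boxed formulas can be pulled out of a box.\<close>

lemma S5_chain_Box:
  assumes "\<And>b. b \<in> set bs \<Longrightarrow> \<exists>q. b = Box q"
  shows "Imp (Box (chain bs s q)) (chain bs s (Box q)) \<in> S5"
  using assms
proof (induction bs)
  case (Cons b bs)
  obtain p where b: "b = Box p" using Cons.prems by auto
  have 1: "Imp (literal s b) (Box (literal s b)) \<in> S5"
    using S5.four S5_not_Box by (auto simp: literal_def b)
  have 2: "Imp (Box (chain bs s q)) (chain bs s (Box q)) \<in> S5" using Cons by auto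
  have "Imp (Box (Imp (literal s b) (chain bs s q)))
     (Imp (literal s b) (Box (chain bs s q))) \<in> S5"
    by (rule S5_consequence2[OF S5.K 1]) auto
  then show ?case by (rule S5_consequence2[OF 2]) auto
qed (auto intro: S5.tautology)

text \<open>A finite canonical model. Its points are the consistent state descriptions over the
  atoms and boxed subformulas of \<open>p\<close> that share the boxed literals of one description
  refuting \<open>p\<close>. Fixing the boxed part is what makes the model a single cluster.\<close>

theorem S5_cluster_complete:
  assumes "p \<notin> S5"
  obtains N V where "0 < N" "\<not> cluster_eval {..<N} V (0::nat) p"
proof -
  define bs where "bs = remdups (basics p)"
  define bx where "bx = filter (\<lambda>b. \<exists>q. b = Box q) bs"
  have ev: "bool_eval v b = v b" if "b \<in> set bs" for v b
    using that bool_eval_basic by (simp add: bs_def)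
  have sub: "set bx \<subseteq> set bs" by (auto simp: bx_def)
  define val where "val s q = bool_eval (\<lambda>b. b \<in> s) q" for s :: "nat modal set" and q
  have val: "bool_eval w q = val s q"
    if "set (basics q) \<subseteq> set bs" "\<forall>b\<in>set bs. bool_eval w b \<longleftrightarrow> b \<in> s" for w s q
    unfolding val_def using that ev by (intro bool_eval_cong) blast
  have "\<exists>s. s \<subseteq> set bs \<and> chain bs s p \<notin> S5"
    using S5_case_split[of bs p] assms bs_def by auto
  then obtain s0 where s0: "s0 \<subseteq> set bs" "chain bs s0 p \<notin> S5" by auto
  define W where
    "W = {s. s \<subseteq> set bs \<and> chain bs s Falsum \<notin> S5 \<and> (\<forall>b\<in>set bx. b \<in> s \<longleftrightarrow> b \<in> s0)}"
  have finW: "finite W" by (rule finite_subset[of _ "Pow (set bs)"]) (auto simp: W_def)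
  have con0: "chain bs s0 Falsum \<notin> S5"
    using s0(2) S5_consequence[of "chain bs s0 Falsum" "chain bs s0 p"]
    by (auto simp: bool_eval_chain)
  have s0W: "s0 \<in> W" using s0(1) con0 by (simp add: W_def)
  have not_p: "\<not> val s0 p"
  proof
    assume "val s0 p"
    then have "chain bs s0 p \<in> S5"
      using val[of p] by (intro S5.tautology) (auto simp: bool_eval_chain bs_def)
    with s0(2) show False ..
  qed
  have truth: "cluster_eval W (\<lambda>s i. Atom i \<in> s) s q \<longleftrightarrow> val s q"
    if "set (basics q) \<subseteq> set bs" "s \<in> W" for s q
    using that
  proof (induction q arbitrary: s)
    case (Box q)
    have IH: "cluster_eval W (\<lambda>s i. Atom i \<in> s) s q \<longleftrightarrow> val s q" if "s \<in> W" for s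
      using Box.IH Box.prems(1) that by auto
    have bq: "Box q \<in> set bx" "Box q \<in> set bs" "set (basics q) \<subseteq> set bs"
      using Box.prems(1) by (auto simp: bx_def)
    have eq: "val s (Box q) \<longleftrightarrow> Box q \<in> s0"
      using Box.prems(2) bq(1) by (auto simp: W_def val_def)
    \<comment> \<open>A point that contains \<open>Box q\<close> but falsifies \<open>q\<close>
      would be inconsistent by axiom T alone.\<close>
    have "val s' q" if "Box q \<in> s0" "s' \<in> W" for s'
    proof (rule ccontr)
      assume n: "\<not> val s' q"
      have "Box q \<in> s'" using that bq by (auto simp: W_def)
      have "chain bs s' Falsum \<in> S5"
      proof (rule S5_consequence[OF S5.T[of q]])
        fix v assume v: "bool_eval v (Imp (Box q) q)"
        show "bool_eval v (chain bs s' Falsum)"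
          unfolding bool_eval_chain
        proof
          assume lits: "\<forall>b\<in>set bs. bool_eval v b \<longleftrightarrow> b \<in> s'"
          have "bool_eval v (Box q)" using bspec[OF lits bq(2)] \<open>Box q \<in> s'\<close> by simp
          then have "bool_eval v q" using v by simp
          with n val[OF bq(3) lits] show "bool_eval v Falsum" by simp
        qed
      qed
      then show False using that by (simp add: W_def)
    qed
    \<comment> \<open>If \<open>q\<close> holds at all points, it follows from the shared boxed
      literals alone: descriptions that are inconsistent or have other boxed literals refute the
      premises. These literals pass through a box, so \<open>s0\<close> would derive
      \<open>Box q\<close>, contrary to its own literal.\<close>
    moreover have "Box q \<in> s0" if all: "\<And>s'. s' \<in> W \<Longrightarrow> val s' q"
    proof (rule ccontr)
      assume n: "Box q \<notin> s0"
      have "chain bs s' (chain bx s0 q) \<in> S5" if s': "s' \<subseteq> set bs" for s'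
      proof (cases "\<forall>b\<in>set bx. b \<in> s' \<longleftrightarrow> b \<in> s0")
        case True
        show ?thesis
        proof (cases "chain bs s' Falsum \<in> S5")
          case True
          then show ?thesis by (rule S5_consequence) (auto simp: bool_eval_chain)
        next
          case False
          then have "val s' q" using all True s' by (auto simp: W_def)
          then show ?thesis
            by (intro S5.tautology) (simp only: bool_eval_chain, metis val[OF bq(3)])
        qed
      next
        case False
        then obtain b where "b \<in> set bx" "b \<in> set bs" "b \<in> s' \<longleftrightarrow> b \<notin> s0" using sub by blast
        then show ?thesis
          by (intro S5.tautology) (simp only: bool_eval_chain, metis)
      qed
      then have "chain bx s0 q \<in> S5"
        using S5_case_split[of bs] by (simp add: bs_def)
      then have "Box (chain bx s0 q) \<in> S5" by (rule S5.necessitation)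
      moreover have "Imp (Box (chain bx s0 q)) (chain bx s0 (Box q)) \<in> S5"
        by (rule S5_chain_Box) (auto simp: bx_def)
      ultimately have "chain bx s0 (Box q) \<in> S5" by (rule S5.modus_ponens[rotated])
      have "chain bs s0 Falsum \<in> S5"
      proof (rule S5_consequence[OF \<open>chain bx s0 (Box q) \<in> S5\<close>])
        fix v assume v: "bool_eval v (chain bx s0 (Box q))"
        show "bool_eval v (chain bs s0 Falsum)"
          unfolding bool_eval_chain
        proof
          assume lits: "\<forall>b\<in>set bs. bool_eval v b \<longleftrightarrow> b \<in> s0"
          then have "bool_eval v (Box q)" using v sub unfolding bool_eval_chain by blast
          with n bspec[OF lits bq(2)] show "bool_eval v Falsum" by simp
        qed
      qed
      with con0 show False ..
    qed
    ultimately show ?case using IH eq by auto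
  qed (auto simp: val_def)
  obtain f and n :: nat where f: "W - {s0} = f ` {..<n}"
    using finite_imp_nat_seg_image_inj_on[of "W - {s0}"] finW by (auto simp: lessThan_def)
  \<comment> \<open>The refuting point \<open>s0\<close> receives number 0; the other points, if
    any, are numbered from 1.\<close>
  define g where "g i = (case i of 0 \<Rightarrow> s0 | Suc j \<Rightarrow> f j)" for i
  have "g ` {..<Suc n} = W"
    using f s0W by (auto simp: g_def lessThan_Suc_eq_insert_0 image_image)
  from cluster_eval_reindex[OF this, of 0 "\<lambda>s i. Atom i \<in> s" p]
  have "\<not> cluster_eval {..<Suc n} (\<lambda>i j. Atom j \<in> g i) 0 p"
    using truth[of p s0] not_p s0W by (simp add: bs_def g_def)
  then show ?thesis by (intro that[of "Suc n"]) auto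
qed

section \<open>Formulas\<close>

primrec rename :: "(nat \<Rightarrow> nat) \<Rightarrow> fm \<Rightarrow> fm" where
  "rename r (Member i j) = Member (r i) (r j)"
| "rename r (Equal i j) = Equal (r i) (r j)"
| "rename r (Neg \<phi>) = Neg (rename r \<phi>)"
| "rename r (Conj \<phi> \<psi>) = Conj (rename r \<phi>) (rename r \<psi>)"
| "rename r (Exists \<phi>) = Exists (rename (case_nat 0 (\<lambda>n. Suc (r n))) \<phi>)"

lemma case_nat_rename:
  "(\<lambda>n. case_nat x e (case_nat 0 (\<lambda>n. Suc (r n)) n)) = case_nat x (\<lambda>n. e (r n))"
  by (auto split: nat.split)

lemma sat_rename: "sat E U e (rename r \<phi>) \<longleftrightarrow> sat E U (\<lambda>n. e (r n)) \<phi>"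
  by (induction \<phi> arbitrary: r e) (simp_all add: case_nat_rename)

lemma is_Delta0_rename: "is_Delta0 \<phi> \<Longrightarrow> is_Delta0 (rename r \<phi>)"
proof (induction \<phi> arbitrary: r rule: is_Delta0.induct)
  case (5 \<phi> i)
  then show ?case using is_Delta0.intros(5)[of _ "r i"] by simp
qed (auto intro: is_Delta0.intros)

text \<open>The index is deliberately not lowered under \<open>Exists\<close>: one number then also
  bounds the variables in the bodies of all quantified subformulas.\<close>

primrec bound :: "fm \<Rightarrow> nat" where
  "bound (Member i j) = Suc (max i j)"
| "bound (Equal i j) = Suc (max i j)"
| "bound (Neg \<phi>) = bound \<phi>"
| "bound (Conj \<phi> \<psi>) = max (bound \<phi>) (bound \<psi>)"
| "bound (Exists \<phi>) = bound \<phi>"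

lemma sat_cong:
  assumes "\<And>n. n < bound \<phi> \<Longrightarrow> e n = e' n"
  shows "sat E U e \<phi> \<longleftrightarrow> sat E U e' \<phi>"
  using assms
proof (induction \<phi> arbitrary: e e')
  case (Exists \<phi>)
  have "sat E U (case_nat x e) \<phi> = sat E U (case_nat x e') \<phi>" for x
  proof (rule Exists.IH)
    fix n assume "n < bound \<phi>"
    then show "case_nat x e n = case_nat x e' n" using Exists.prems by (cases n) simp_all
  qed
  then show ?case by simp
next
  case (Conj \<phi> \<psi>)
  have "sat E U e \<phi> = sat E U e' \<phi>" by (rule Conj.IH(1)) (use Conj.prems in simp)
  moreover have "sat E U e \<psi> = sat E U e' \<psi>" by (rule Conj.IH(2)) (use Conj.prems in simp)
  ultimately show ?case by simp
next
  case (Neg \<phi>)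
  have "sat E U e \<phi> = sat E U e' \<phi>" by (rule Neg.IH) (use Neg.prems in simp)
  then show ?case by simp
next
  case (Member i j)
  have "e i = e' i" "e j = e' j" by (rule Member; simp)+
  then show ?case by simp
next
  case (Equal i j)
  have "e i = e' i" "e j = e' j" by (rule Equal; simp)+
  then show ?case by simp
qed

definition Top :: fm where "Top = Equal 0 0"

lemma sat_Top [simp]: "sat E U e Top" by (simp add: Top_def)

lemma range_case_nat [simp]: "range (case_nat x e) \<subseteq> U \<longleftrightarrow> x \<in> U \<and> range e \<subseteq> U"
  by (auto simp: image_subset_iff split: nat.splits)

lemma Delta0_absolute:
  assumes "\<And>x y. x \<in> U \<Longrightarrow> E y x \<Longrightarrow> y \<in> U" "is_Delta0 \<phi>" "range e \<subseteq> U"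
  shows "sat E U e \<phi> \<longleftrightarrow> sat E UNIV e \<phi>"
  using assms(2,3)
proof (induction \<phi> arbitrary: e rule: is_Delta0.induct)
  case (5 \<phi> i)
  then have "e i \<in> U" by blast
  with 5 show ?case using assms(1) by auto
qed auto

text \<open>The result is bounded whatever the complexity of the formula. Truth of an arbitrary
  formula in a set-sized world thus costs no unbounded quantifier beyond the one naming the
  world.\<close>

primrec relativize :: "nat \<Rightarrow> fm \<Rightarrow> fm" where
  "relativize k (Member i j) = Member i j"
| "relativize k (Equal i j) = Equal i j"
| "relativize k (Neg \<phi>) = Neg (relativize k \<phi>)"
| "relativize k (Conj \<phi> \<psi>) = Conj (relativize k \<phi>) (relativize k \<psi>)"
| "relativize k (Exists \<phi>) = Exists (Conj (Member 0 (Suc k)) (relativize (Suc k) \<phi>))"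

lemma is_Delta0_relativize: "is_Delta0 (relativize k \<phi>)"
  by (induction \<phi> arbitrary: k) (auto intro: is_Delta0.intros)

lemma sat_relativize: "sat E UNIV e (relativize k \<phi>) \<longleftrightarrow> sat E {x. E x (e k)} e \<phi>"
  by (induction \<phi> arbitrary: e k) simp_all

section \<open>The Levy hierarchy: duality and quantifier blocks\<close>

lemma is_Sigma_0 [simp]: "is_Sigma 0 \<phi> \<longleftrightarrow> is_Delta0 \<phi>"
  and is_Pi_0 [simp]: "is_Pi 0 \<phi> \<longleftrightarrow> is_Delta0 \<phi>"
  by (auto elim: is_Sigma.cases is_Pi.cases intro: is_Sigma_is_Pi.intros)

text \<open>The hierarchy is syntactic, and the negation of a Sigma formula is in general not
  literally a Pi formula; the dual is rebuilt along the quantifier prefix.\<close>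

lemma Sigma_dual: "is_Sigma n \<phi> \<Longrightarrow> \<exists>\<psi>. is_Pi n \<psi> \<and> (\<forall>U e. sat E U e \<psi> \<longleftrightarrow> \<not> sat E U e \<phi>)"
  and Pi_dual: "is_Pi n \<phi> \<Longrightarrow> \<exists>\<psi>. is_Sigma n \<psi> \<and> (\<forall>U e. sat E U e \<psi> \<longleftrightarrow> \<not> sat E U e \<phi>)"
proof (induction rule: is_Sigma_is_Pi.inducts)
  case (1 \<phi>)
  then show ?case by (intro exI[of _ "Neg \<phi>"]) (simp add: is_Delta0.intros(3))
next
  case (2 \<phi>)
  then show ?case by (intro exI[of _ "Neg \<phi>"]) (simp add: is_Delta0.intros(3))
next
  case (3 n \<phi>)
  then obtain \<psi> where "is_Sigma n \<psi>" "\<forall>U e. sat E U e \<psi> \<longleftrightarrow> \<not> sat E U e \<phi>" by blast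
  then show ?case by (intro exI[of _ \<psi>]) (simp add: is_Sigma_is_Pi.intros(5))
next
  case (4 n \<phi>)
  then obtain \<psi> where "is_Pi (Suc n) \<psi>" "\<forall>U e. sat E U e \<psi> \<longleftrightarrow> \<not> sat E U e \<phi>" by blast
  then show ?case by (intro exI[of _ "Forall \<psi>"]) (simp add: is_Sigma_is_Pi.intros(6))
next
  case (5 n \<phi>)
  then obtain \<psi> where "is_Pi n \<psi>" "\<forall>U e. sat E U e \<psi> \<longleftrightarrow> \<not> sat E U e \<phi>" by blast
  then show ?case by (intro exI[of _ \<psi>]) (simp add: is_Sigma_is_Pi.intros(3))
next
  case (6 n \<phi>)
  then obtain \<psi> where "is_Sigma (Suc n) \<psi>" "\<forall>U e. sat E U e \<psi> \<longleftrightarrow> \<not> sat E U e \<phi>" by blast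
  then show ?case by (intro exI[of _ "Exists \<psi>"]) (simp add: is_Sigma_is_Pi.intros(4))
qed

lemma Sigma_mono: "is_Sigma n \<phi> \<Longrightarrow> is_Sigma (Suc n) \<phi>"
  and Pi_mono: "is_Pi n \<phi> \<Longrightarrow> is_Pi (Suc n) \<phi>"
proof (induction rule: is_Sigma_is_Pi.inducts)
  case (1 \<phi>)
  then show ?case by (simp add: is_Sigma_is_Pi.intros(3))
next
  case (2 \<phi>)
  then show ?case by (simp add: is_Sigma_is_Pi.intros(5))
qed (simp_all only: is_Sigma_is_Pi.intros(3-6))

text \<open>\<open>prepend zs e\<close> interprets a block of quantifiers whose innermost variable is the head
  of \<open>zs\<close>.\<close>

primrec prepend :: "'a list \<Rightarrow> (nat \<Rightarrow> 'a) \<Rightarrow> nat \<Rightarrow> 'a" where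
  "prepend [] e = e"
| "prepend (z # zs) e = case_nat z (prepend zs e)"

lemma prepend_snoc: "prepend (zs @ [z]) e = prepend zs (case_nat z e)"
  by (induction zs) auto

lemma prepend_ge: "prepend zs e (length zs + n) = e n"
  by (induction zs) auto

lemma prepend_less: "n < length zs \<Longrightarrow> prepend zs e n = zs ! n"
  by (induction zs arbitrary: n) (auto simp: less_Suc_eq_0_disj)

lemma range_prepend [simp]: "range (prepend zs e) \<subseteq> U \<longleftrightarrow> set zs \<subseteq> U \<and> range e \<subseteq> U"
  by (induction zs) auto

text \<open>Strips the whole leading existential block at once, so that later arguments can treat
  its witnesses as one list. The length and the matrix depend on the formula only and serve every
  domain \<open>U\<close>.\<close>

lemma Sigma_block:
  assumes "is_Sigma (Suc n) \<phi>"
  shows "\<exists>m \<psi>. is_Pi n \<psi> \<and> (\<forall>U e. sat E U e \<phi> \<longleftrightarrow>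
    (\<exists>zs. length zs = m \<and> set zs \<subseteq> U \<and> sat E U (prepend zs e) \<psi>))"
proof -
  \<comment> \<open>The two hierarchies are defined by mutual induction; the Pi half gets a trivial
    conclusion, and the level is made a variable for the induction.\<close>
  have "is_Sigma k \<phi> \<Longrightarrow> k = Suc n \<Longrightarrow> ?thesis" and "is_Pi k \<phi>' \<Longrightarrow> True" for k \<phi>'
  proof (induction rule: is_Sigma_is_Pi.inducts)
    case (3 k \<phi>)
    then show ?case by (intro exI[of _ 0] exI[of _ \<phi>]) simp
  next
    case (4 k \<phi>)
    then obtain m \<psi> where \<psi>: "is_Pi n \<psi>" "\<And>U e. sat E U e \<phi> \<longleftrightarrow>
      (\<exists>zs. length zs = m \<and> set zs \<subseteq> U \<and> sat E U (prepend zs e) \<psi>)" by blast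
    have "sat E U e (Exists \<phi>) \<longleftrightarrow>
      (\<exists>zs. length zs = Suc m \<and> set zs \<subseteq> U \<and> sat E U (prepend zs e) \<psi>)" for U e
    proof
      assume "sat E U e (Exists \<phi>)"
      then obtain z zs where "z \<in> U" "length zs = m" "set zs \<subseteq> U"
        "sat E U (prepend zs (case_nat z e)) \<psi>"
        unfolding sat.simps \<psi>(2) by blast
      then show "\<exists>zs. length zs = Suc m \<and> set zs \<subseteq> U \<and> sat E U (prepend zs e) \<psi>"
        by (intro exI[of _ "zs @ [z]"]) (simp add: prepend_snoc)
    next
      assume "\<exists>zs. length zs = Suc m \<and> set zs \<subseteq> U \<and> sat E U (prepend zs e) \<psi>"
      then obtain ws where ws: "length ws = Suc m" "set ws \<subseteq> U" "sat E U (prepend ws e) \<psi>"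
        by blast
      then obtain zs z where "ws = zs @ [z]" by (metis length_Suc_conv_rev)
      with ws show "sat E U e (Exists \<phi>)"
        unfolding sat.simps \<psi>(2) by (intro bexI[of _ z] exI[of _ zs]) (simp_all add: prepend_snoc)
    qed
    with \<psi>(1) show ?case by blast
  qed simp_all
  with assms show ?thesis by blast
qed

section \<open>Definability with parameters\<close>

text \<open>Parameters are interleaved with the variables: they occupy the odd indices.\<close>

definition merge :: "(nat \<Rightarrow> 'a) \<Rightarrow> (nat \<Rightarrow> 'a) \<Rightarrow> nat \<Rightarrow> 'a" where
  "merge e c n = (if even n then e (n div 2) else c (n div 2))"

lemma merge_simps [simp]: "merge e c (2 * n) = e n" "merge e c (Suc (2 * n)) = c n"
  by (simp_all add: merge_def)

lemma merge_rename:
  "(\<lambda>n. E (merge f g n)) = merge (\<lambda>n. E (f n)) (\<lambda>n. E (g n))"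
  by (auto simp: merge_def)

context set_structure begin

text \<open>A semantic notion on predicates of valuations instead of formulas: closure rules then
  match the predicates as they are written, and no formula need be exhibited.\<close>

definition definable :: "((nat \<Rightarrow> 'v) \<Rightarrow> bool) \<Rightarrow> bool" where
  "definable P \<longleftrightarrow> (\<exists>\<phi> c. \<forall>e. P e \<longleftrightarrow> sat mem UNIV (merge e c) \<phi>)"

text \<open>Definability of the graph, with the value in slot 0 and the arguments moved up by one;
  substituting \<open>t\<close> then amounts to an existential quantifier.\<close>

definition definable_term :: "((nat \<Rightarrow> 'v) \<Rightarrow> 'v) \<Rightarrow> bool" where
  "definable_term t \<longleftrightarrow> definable (\<lambda>e. e 0 = t (\<lambda>n. e (Suc n)))"

lemma definable_not: "definable P \<Longrightarrow> definable (\<lambda>e. \<not> P e)"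
  unfolding definable_def by (metis sat.simps(3))

text \<open>The two parameter sequences are interleaved once more, as \<open>merge c d\<close>, and
  the odd indices of each formula are redirected to its own half.\<close>

lemma definable_conj:
  assumes "definable P" "definable Q" shows "definable (\<lambda>e. P e \<and> Q e)"
proof -
  obtain \<phi> c \<psi> d where "P = (\<lambda>e. sat mem UNIV (merge e c) \<phi>)"
    "Q = (\<lambda>e. sat mem UNIV (merge e d) \<psi>)"
    using assms unfolding definable_def by fast
  then show ?thesis unfolding definable_def
    by (intro exI[of _ "Conj (rename (merge (\<lambda>n. 2 * n) (\<lambda>n. Suc (2 * (2 * n)))) \<phi>)
        (rename (merge (\<lambda>n. 2 * n) (\<lambda>n. Suc (2 * Suc (2 * n)))) \<psi>)"] exI[of _ "merge c d"])
      (simp only: sat.simps sat_rename merge_rename merge_simps, simp)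
qed

lemma definable_disj:
  assumes "definable P" "definable Q" shows "definable (\<lambda>e. P e \<or> Q e)"
proof -
  have "definable (\<lambda>e. \<not> (\<not> P e \<and> \<not> Q e))"
    by (intro definable_not definable_conj assms)
  then show ?thesis by simp
qed

lemma definable_imp:
  assumes "definable P" "definable Q" shows "definable (\<lambda>e. P e \<longrightarrow> Q e)"
  unfolding imp_conv_disj by (intro definable_disj definable_not assms)

lemma definable_iff:
  assumes "definable P" "definable Q" shows "definable (\<lambda>e. P e \<longleftrightarrow> Q e)"
  unfolding iff_conv_conj_imp by (intro definable_conj definable_imp assms)

text \<open>Quantification shifts every index of the merged valuation by one, whereas putting a new
  variable in front of \<open>e\<close> before merging moves only the even indices. The renaming
  reconciles the two numberings.\<close>

lemma definable_ex:
  assumes "definable (\<lambda>e. P (e 0) (\<lambda>n. e (Suc n)))"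
  shows "definable (\<lambda>e. \<exists>x. P x e)"
proof -
  obtain \<phi> c where \<phi>: "\<And>e. P (e 0) (\<lambda>n. e (Suc n)) \<longleftrightarrow> sat mem UNIV (merge e c) \<phi>"
    using assms unfolding definable_def by fast
  have "merge (case_nat x e) c = (\<lambda>n. case_nat x (merge e c)
      (merge (case_nat 0 (\<lambda>n. Suc (2 * n))) (\<lambda>n. Suc (Suc (2 * n))) n))" for x e
    by (auto simp: merge_rename intro!: arg_cong2[of _ _ _ _ merge] split: nat.split)
  moreover have "P x e \<longleftrightarrow> sat mem UNIV (merge (case_nat x e) c) \<phi>" for x e
    using \<phi>[of "case_nat x e"] by simp
  ultimately show ?thesis unfolding definable_def
    by (intro exI[of _ "Exists (rename (merge (case_nat 0 (\<lambda>n. Suc (2 * n)))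
      (\<lambda>n. Suc (Suc (2 * n)))) \<phi>)"] exI[of _ c]) (simp add: sat_rename)
qed

lemma definable_all:
  assumes "definable (\<lambda>e. P (e 0) (\<lambda>n. e (Suc n)))"
  shows "definable (\<lambda>e. \<forall>x. P x e)"
proof -
  have "definable (\<lambda>e. \<not> (\<exists>x. \<not> P x e))"
    by (intro definable_not definable_ex assms)
  then show ?thesis by simp
qed

lemma definable_rename:
  assumes "definable P" shows "definable (\<lambda>e. P (\<lambda>n. e (r n)))"
proof -
  obtain \<phi> c where "P = (\<lambda>e. sat mem UNIV (merge e c) \<phi>)"
    using assms unfolding definable_def by fast
  then show ?thesis unfolding definable_def
    by (intro exI[of _ "rename (merge (\<lambda>n. 2 * r n) (\<lambda>n. Suc (2 * n))) \<phi>"] exI[of _ c])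
      (simp add: sat_rename merge_rename)
qed

lemma definable_term_rename:
  "definable_term t \<Longrightarrow> definable_term (\<lambda>e. t (\<lambda>n. e (r n)))"
  using definable_rename[of "\<lambda>e. e 0 = t (\<lambda>n. e (Suc n))" "case_nat 0 (\<lambda>n. Suc (r n))"]
  by (simp add: definable_term_def)

lemma definable_eq_vars: "definable (\<lambda>e. e i = e j)"
  unfolding definable_def by (intro exI[of _ "Equal (2 * i) (2 * j)"]) simp

lemma definable_mem_vars: "definable (\<lambda>e. mem (e i) (e j))"
  unfolding definable_def by (intro exI[of _ "Member (2 * i) (2 * j)"]) simp

lemma term_var: "definable_term (\<lambda>e. e n)"
  unfolding definable_term_def by (rule definable_eq_vars)

lemma term_const: "definable_term (\<lambda>e. c)"
  unfolding definable_term_def definable_def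
  by (intro exI[of _ "Equal 0 1"] exI[of _ "\<lambda>_. c"]) (simp add: merge_def)

lemma definable_bind:
  assumes "definable (\<lambda>e. P (e 0) (\<lambda>n. e (Suc n)))" "definable_term t"
  shows "definable (\<lambda>e. P (t e) e)"
proof -
  have "definable (\<lambda>e. \<exists>x. x = t e \<and> P x e)"
    by (rule definable_ex) (intro definable_conj assms[unfolded definable_term_def])
  then show ?thesis by simp
qed

lemma definable_bind2:
  assumes "definable (\<lambda>e. P (e 0) (e 1))" "definable_term s" "definable_term t"
  shows "definable (\<lambda>e. P (s e) (t e))"
proof -
  have "definable (\<lambda>e. P (e 0) (t (\<lambda>n. e (Suc n))))"
  proof (rule definable_bind[of "\<lambda>y e. P (e 0) y"])
    show "definable (\<lambda>e. P (e (Suc 0)) (e 0))"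
      using definable_rename[OF assms(1), of "\<lambda>n. if n = 0 then 1 else 0"] by simp
    show "definable_term (\<lambda>e. t (\<lambda>n. e (Suc n)))"
      using assms(3) by (rule definable_term_rename)
  qed
  then show ?thesis by (rule definable_bind[OF _ assms(2)])
qed

lemma definable_eq: "definable_term s \<Longrightarrow> definable_term t \<Longrightarrow> definable (\<lambda>e. s e = t e)"
  by (rule definable_bind2[of "\<lambda>x y. x = y"]) (rule definable_eq_vars)

lemma definable_mem: "definable_term s \<Longrightarrow> definable_term t \<Longrightarrow> definable (\<lambda>e. mem (s e) (t e))"
  by (rule definable_bind2[of "\<lambda>x y. mem x y"]) (rule definable_mem_vars)

text \<open>Definable terms have no syntax, so substitution cannot be performed on the formula
  itself; induction on the formula replaces it.\<close>

lemma definable_sat: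
  "(\<And>n. definable_term (s n)) \<Longrightarrow> definable (\<lambda>e. sat mem UNIV (\<lambda>n. s n e) \<phi>)"
proof (induction \<phi> arbitrary: s)
  case (Exists \<phi>)
  let ?s = "case_nat (\<lambda>e. e 0) (\<lambda>n e. s n (\<lambda>n. e (Suc n)))"
  have "definable_term (?s n)" for n
    using Exists.prems by (auto intro: term_var definable_term_rename split: nat.split)
  then have "definable (\<lambda>e. sat mem UNIV (\<lambda>n. ?s n e) \<phi>)" by (rule Exists.IH)
  moreover have "(\<lambda>n. ?s n e) = case_nat (e 0) (\<lambda>n. s n (\<lambda>n. e (Suc n)))" for e
    by (auto split: nat.split)
  ultimately have "definable (\<lambda>e. sat mem UNIV (case_nat (e 0) (\<lambda>n. s n (\<lambda>n. e (Suc n)))) \<phi>)"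
    by simp
  then show ?case by (simp add: definable_ex[of "\<lambda>x e. sat mem UNIV (case_nat x (\<lambda>n. s n e)) \<phi>"])
qed (simp_all add: definable_eq definable_mem definable_not definable_conj)

lemma definable_subst:
  assumes "definable P" "\<And>n. definable_term (s n)"
  shows "definable (\<lambda>e. P (\<lambda>n. s n e))"
proof -
  obtain \<phi> c where \<phi>: "P = (\<lambda>e. sat mem UNIV (merge e c) \<phi>)"
    using assms(1) unfolding definable_def by fast
  have "definable (\<lambda>e. sat mem UNIV (\<lambda>n. merge s (\<lambda>n e. c n) n e) \<phi>)"
    by (rule definable_sat) (simp add: merge_def assms(2) term_const)
  moreover have "(\<lambda>n. merge s (\<lambda>n e. c n) n e) = merge (\<lambda>n. s n e) c" for e
    by (auto simp: merge_def)
  ultimately show ?thesis by (simp add: \<phi>)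
qed

lemma definable_term_subst:
  assumes "definable_term t" "\<And>n. definable_term (s n)"
  shows "definable_term (\<lambda>e. t (\<lambda>n. s n e))"
proof -
  let ?s = "case_nat (\<lambda>e. e 0) (\<lambda>n e. s n (\<lambda>n. e (Suc n)))"
  have "definable (\<lambda>e. (\<lambda>n. ?s n e) 0 = t (\<lambda>n. (\<lambda>n. ?s n e) (Suc n)))"
    by (rule definable_subst[OF assms(1)[unfolded definable_term_def]])
      (auto intro: term_var definable_term_rename assms(2) split: nat.split)
  then show ?thesis by (simp add: definable_term_def)
qed

lemma definable_term_bind:
  assumes "definable_term (\<lambda>e. f (e 0) (\<lambda>n. e (Suc n)))" "definable_term t"
  shows "definable_term (\<lambda>e. f (t e) e)"
  using definable_term_subst[OF assms(1), of "case_nat t (\<lambda>n e. e n)"] assms(2)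
  by (simp add: term_var split: nat.split)

lemma definable_term_bind1:
  "definable_term (\<lambda>e. f (e 0)) \<Longrightarrow> definable_term t \<Longrightarrow> definable_term (\<lambda>e. f (t e))"
  by (rule definable_term_bind)

lemma definable_bind1:
  "definable (\<lambda>e. P (e 0)) \<Longrightarrow> definable_term t \<Longrightarrow> definable (\<lambda>e. P (t e))"
  by (rule definable_bind)

lemma definable_term_bind2:
  assumes "definable_term (\<lambda>e. f (e 0) (e 1))" "definable_term s" "definable_term t"
  shows "definable_term (\<lambda>e. f (s e) (t e))"
  using definable_term_subst[OF assms(1), of "\<lambda>n. if n = 0 then s else t"] assms(2,3) by simp

lemma definable_const: "definable (\<lambda>e. P)"
proof -
  have "definable (\<lambda>e. e 0 = e 0)" by (rule definable_eq_vars)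
  then show ?thesis using definable_not[of "\<lambda>e. e 0 = e 0"] by (cases P) auto
qed

lemmas definable_intros = definable_const definable_not definable_conj definable_disj
  definable_imp definable_iff definable_all definable_ex definable_eq definable_mem
  term_const term_var

end

section \<open>Set theory inside a model of ZFC\<close>

named_theorems definability

context set_structure begin

declare definable_intros [definability]

lemma definable_ex1 [definability]:
  assumes H: "definable (\<lambda>e. P (e 0) (\<lambda>n. e (Suc n)))"
  shows "definable (\<lambda>e. \<exists>!x. P x e)"
proof -
  have 1: "definable (\<lambda>e. P (e 0) (\<lambda>n. e (Suc (Suc n))))"
    using definable_rename[OF H, of "case_nat 0 (\<lambda>n. Suc (Suc n))"] by simp
  show ?thesis
    unfolding Ex1_def by (intro definability H 1)
qed

end

context ZFC_model begin

section \<open>Descriptions, comprehension and the schemes for definable predicates\<close>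

lemma set_ext: "(\<And>z. z \<^bold>\<in> x \<longleftrightarrow> z \<^bold>\<in> y) \<Longrightarrow> x = y"
  using extensionality by blast

lemma subsetI [intro?]: "(\<And>z. z \<^bold>\<in> x \<Longrightarrow> z \<^bold>\<in> y) \<Longrightarrow> x \<^bold>\<subseteq> y"
  by (simp add: subset_def)

lemma subsetD: "x \<^bold>\<subseteq> y \<Longrightarrow> z \<^bold>\<in> x \<Longrightarrow> z \<^bold>\<in> y"
  by (simp add: subset_def)

lemma subset_refl [simp]: "x \<^bold>\<subseteq> x"
  by (simp add: subset_def)

lemma subset_trans: "x \<^bold>\<subseteq> y \<Longrightarrow> y \<^bold>\<subseteq> z \<Longrightarrow> x \<^bold>\<subseteq> z"
  by (simp add: subset_def)

lemma definable_subset [definability]: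
  "definable_term s \<Longrightarrow> definable_term t \<Longrightarrow> definable (\<lambda>e. s e \<^bold>\<subseteq> t e)"
  by (rule definable_bind2) (unfold subset_def, intro definability)

definition emp :: 'v where "emp = (THE b. \<forall>x. \<not> x \<^bold>\<in> b)"

lemma mem_emp [simp]: "\<not> x \<^bold>\<in> emp"
proof -
  obtain b where "\<forall>x. \<not> x \<^bold>\<in> b"
    using separation[rule_format, of undefined "\<lambda>_. undefined" "Neg Top"] by auto
  then have "\<exists>!b. \<forall>x. \<not> x \<^bold>\<in> b" by (auto intro: set_ext)
  from theI'[OF this] show ?thesis by (simp add: emp_def)
qed

text \<open>The default \<open>emp\<close> makes description total, so operations built from it are
  definable terms without existence conditions.\<close>

definition descr :: "('v \<Rightarrow> bool) \<Rightarrow> 'v" where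
  "descr P = (if \<exists>!y. P y then THE y. P y else emp)"

lemma descr_eq:
  assumes "P y" "\<And>z. P z \<Longrightarrow> z = y"
  shows "descr P = y"
proof -
  have "\<exists>!y. P y" using assms by (rule ex1I)
  moreover have "(THE y. P y) = y" using assms by (rule the_equality)
  ultimately show ?thesis by (simp add: descr_def)
qed

lemma term_descr [definability]:
  assumes H: "definable (\<lambda>e. P (e 0) (\<lambda>n. e (Suc n)))"
  shows "definable_term (\<lambda>e. descr (\<lambda>y. P y e))"
proof -
  have 1: "definable (\<lambda>e. P (e 0) (\<lambda>n. e (Suc (Suc n))))"
    using definable_rename[OF H, of "case_nat 0 (\<lambda>n. Suc (Suc n))"] by simp
  have 2: "y = descr Q \<longleftrightarrow> (\<exists>!z. Q z) \<and> Q y \<or> \<not> (\<exists>!z. Q z) \<and> y = emp" for Q y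
  proof (cases "\<exists>!z. Q z")
    case True
    then obtain z where "Q z" "\<And>u. Q u \<Longrightarrow> u = z" by blast
    then have "descr Q = z" by (rule descr_eq)
    with True \<open>Q z\<close> \<open>\<And>u. Q u \<Longrightarrow> u = z\<close> show ?thesis by blast
  next
    case False
    then show ?thesis by (simp add: descr_def)
  qed
  show ?thesis
    unfolding definable_term_def 2 by (intro definability H 1)
qed

text \<open>For a proper class this is the default \<open>emp\<close>. Definability is therefore
  unconditional, and only the membership rule has to exhibit a set.\<close>

definition Coll :: "('v \<Rightarrow> bool) \<Rightarrow> 'v" where
  "Coll P = descr (\<lambda>b. \<forall>x. x \<^bold>\<in> b \<longleftrightarrow> P x)"

lemma term_Coll [definability]:
  assumes H: "definable (\<lambda>e. P (e 0) (\<lambda>n. e (Suc n)))"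
  shows "definable_term (\<lambda>e. Coll (\<lambda>x. P x e))"
proof -
  have 1: "definable (\<lambda>e. P (e 0) (\<lambda>n. e (Suc (Suc n))))"
    using definable_rename[OF H, of "case_nat 0 (\<lambda>n. Suc (Suc n))"] by simp
  show ?thesis unfolding Coll_def by (intro definability 1)
qed

lemma mem_Coll:
  assumes "\<forall>x. x \<^bold>\<in> b \<longleftrightarrow> P x"
  shows "y \<^bold>\<in> Coll P \<longleftrightarrow> P y"
proof -
  have "Coll P = b"
    unfolding Coll_def by (rule descr_eq) (auto intro: set_ext simp: assms)
  with assms show ?thesis by simp
qed

lemma separation':
  assumes "definable (\<lambda>e. P (e 0))"
  shows "\<exists>b. \<forall>x. x \<^bold>\<in> b \<longleftrightarrow> x \<^bold>\<in> a \<and> P x"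
proof -
  obtain \<phi> c where "\<forall>e. P (e 0) \<longleftrightarrow> sat mem UNIV (merge e c) \<phi>"
    using assms unfolding definable_def by fast
  then have "P x \<longleftrightarrow> sat mem UNIV (merge (\<lambda>_. x) c) \<phi>" for x
    by (metis (no_types))
  \<comment> \<open>\<open>P\<close> reads slot 0 only, so the valuation may be taken constant; the
    renaming then collapses all even indices to 0.\<close>
  moreover have "merge (\<lambda>_. x) c = (\<lambda>n. case_nat x c (merge (\<lambda>_. 0) Suc n))" for x
    by (simp add: merge_rename)
  ultimately have *: "P x \<longleftrightarrow> sat mem UNIV (case_nat x c) (rename (merge (\<lambda>_. 0) Suc) \<phi>)" for x
    by (simp add: sat_rename)
  show ?thesis unfolding * by (rule separation[rule_format])
qed

lemma replacement':
  assumes "definable_term (\<lambda>e. f (e 0))"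
  shows "\<exists>b. \<forall>y. y \<^bold>\<in> b \<longleftrightarrow> (\<exists>x. x \<^bold>\<in> a \<and> y = f x)"
proof -
  have "definable (\<lambda>e. e 0 = f (e (Suc 0)))"
    using assms unfolding definable_term_def by simp
  then obtain \<phi> c where \<phi>: "\<And>e. e 0 = f (e (Suc 0)) \<longleftrightarrow> sat mem UNIV (merge e c) \<phi>"
    unfolding definable_def by fast
  let ?r = "merge (case_nat 1 (\<lambda>_. 0)) (\<lambda>n. Suc (Suc n))"
  have "y = f x \<longleftrightarrow> sat mem UNIV (merge (case_nat y (\<lambda>_. x)) c) \<phi>" for x y
    using \<phi>[of "case_nat y (\<lambda>_. x)"] by simp
  moreover have "merge (case_nat y (\<lambda>_. x)) c = (\<lambda>n. case_nat x (case_nat y c) (?r n))" for x y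
    by (auto simp: merge_rename intro!: arg_cong2[of _ _ _ _ merge] split: nat.split)
  ultimately have *: "sat mem UNIV (case_nat x (case_nat y c)) (rename ?r \<phi>) \<longleftrightarrow> y = f x" for x y
    by (simp add: sat_rename)
  show ?thesis
    using replacement[rule_format, of a c "rename ?r \<phi>"] unfolding * by blast
qed

subsection \<open>Basic operations\<close>

definition upair :: "'v \<Rightarrow> 'v \<Rightarrow> 'v" where "upair a b = Coll (\<lambda>x. x = a \<or> x = b)"
definition Union :: "'v \<Rightarrow> 'v" where "Union a = Coll (\<lambda>x. \<exists>y. y \<^bold>\<in> a \<and> x \<^bold>\<in> y)"
definition Pow :: "'v \<Rightarrow> 'v" where "Pow a = Coll (\<lambda>x. x \<^bold>\<subseteq> a)"
definition join :: "'v \<Rightarrow> 'v \<Rightarrow> 'v" where "join a b = Coll (\<lambda>x. x \<^bold>\<in> a \<or> x \<^bold>\<in> b)"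
definition Sep :: "'v \<Rightarrow> ('v \<Rightarrow> bool) \<Rightarrow> 'v" where "Sep a P = Coll (\<lambda>x. x \<^bold>\<in> a \<and> P x)"
definition img :: "('v \<Rightarrow> 'v) \<Rightarrow> 'v \<Rightarrow> 'v" where "img f a = Coll (\<lambda>y. \<exists>x. x \<^bold>\<in> a \<and> y = f x)"
definition pair :: "'v \<Rightarrow> 'v \<Rightarrow> 'v" where "pair a b = upair (upair a a) (upair a b)"
definition fst' :: "'v \<Rightarrow> 'v" where "fst' p = descr (\<lambda>x. \<exists>y. p = pair x y)"
definition snd' :: "'v \<Rightarrow> 'v" where "snd' p = descr (\<lambda>y. \<exists>x. p = pair x y)"
definition app :: "'v \<Rightarrow> 'v \<Rightarrow> 'v" where "app f x = descr (\<lambda>y. pair x y \<^bold>\<in> f)"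
definition Lam :: "'v \<Rightarrow> ('v \<Rightarrow> 'v) \<Rightarrow> 'v" where "Lam a f = img (\<lambda>x. pair x (f x)) a"
definition cart :: "'v \<Rightarrow> 'v \<Rightarrow> 'v" where
  "cart a b = Coll (\<lambda>p. \<exists>x y. x \<^bold>\<in> a \<and> y \<^bold>\<in> b \<and> p = pair x y)"
definition succ :: "'v \<Rightarrow> 'v" where "succ a = join a (upair a a)"

lemma mem_upair [simp]: "x \<^bold>\<in> upair a b \<longleftrightarrow> x = a \<or> x = b"
proof -
  obtain p where "is_upair p a b" using pairing by blast
  then show ?thesis unfolding upair_def is_upair_def by (rule mem_Coll)
qed

lemma mem_Union [simp]: "x \<^bold>\<in> Union a \<longleftrightarrow> (\<exists>y. y \<^bold>\<in> a \<and> x \<^bold>\<in> y)"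
proof -
  obtain u where "\<forall>z. z \<^bold>\<in> u \<longleftrightarrow> (\<exists>y. y \<^bold>\<in> a \<and> z \<^bold>\<in> y)" using union by blast
  then show ?thesis unfolding Union_def by (rule mem_Coll)
qed

lemma mem_Pow [simp]: "x \<^bold>\<in> Pow a \<longleftrightarrow> x \<^bold>\<subseteq> a"
proof -
  obtain p where "is_power p a" using power_set by blast
  then show ?thesis unfolding Pow_def is_power_def by (rule mem_Coll)
qed

lemma mem_join [simp]: "x \<^bold>\<in> join a b \<longleftrightarrow> x \<^bold>\<in> a \<or> x \<^bold>\<in> b"
proof -
  have "\<forall>z. z \<^bold>\<in> Union (upair a b) \<longleftrightarrow> z \<^bold>\<in> a \<or> z \<^bold>\<in> b" by auto
  then show ?thesis unfolding join_def by (rule mem_Coll)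
qed

lemma mem_Sep:
  assumes "definable (\<lambda>e. P (e 0))"
  shows "x \<^bold>\<in> Sep a P \<longleftrightarrow> x \<^bold>\<in> a \<and> P x"
proof -
  obtain b where "\<forall>x. x \<^bold>\<in> b \<longleftrightarrow> x \<^bold>\<in> a \<and> P x" using separation'[OF assms] by blast
  then show ?thesis unfolding Sep_def by (rule mem_Coll)
qed

lemma mem_Coll_bounded:
  assumes "definable (\<lambda>e. P (e 0))" "\<And>x. P x \<Longrightarrow> x \<^bold>\<in> a"
  shows "x \<^bold>\<in> Coll P \<longleftrightarrow> P x"
proof -
  obtain b where "\<forall>x. x \<^bold>\<in> b \<longleftrightarrow> x \<^bold>\<in> a \<and> P x" using separation'[OF assms(1)] by blast
  then have "\<forall>x. x \<^bold>\<in> b \<longleftrightarrow> P x" using assms(2) by blast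
  then show ?thesis by (rule mem_Coll)
qed

lemma mem_img:
  assumes "definable_term (\<lambda>e. f (e 0))"
  shows "y \<^bold>\<in> img f a \<longleftrightarrow> (\<exists>x. x \<^bold>\<in> a \<and> y = f x)"
proof -
  obtain b where "\<forall>y. y \<^bold>\<in> b \<longleftrightarrow> (\<exists>x. x \<^bold>\<in> a \<and> y = f x)" using replacement'[OF assms] by blast
  then show ?thesis unfolding img_def by (rule mem_Coll)
qed

lemma mem_succ [simp]: "x \<^bold>\<in> succ a \<longleftrightarrow> x \<^bold>\<in> a \<or> x = a"
  by (simp add: succ_def)

lemma is_upair_iff: "is_upair p x y \<longleftrightarrow> p = upair x y"
  by (auto simp: is_upair_def intro: set_ext)

lemma is_pair_iff: "is_pair p x y \<longleftrightarrow> p = pair x y"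
  by (simp add: is_pair_def is_upair_iff pair_def)

lemma is_power_iff: "is_power p x \<longleftrightarrow> p = Pow x"
  by (auto simp: is_power_def intro: set_ext)

lemma maps_iff: "maps f x y \<longleftrightarrow> pair x y \<^bold>\<in> f"
  by (simp add: maps_def is_pair_iff)

lemma upair_eq_iff: "upair a b = upair c d \<longleftrightarrow> (a = c \<and> b = d) \<or> (a = d \<and> b = c)"
proof
  assume eq: "upair a b = upair c d"
  have "x = a \<or> x = b \<longleftrightarrow> x = c \<or> x = d" for x
    unfolding mem_upair[symmetric] eq ..
  from this[of a] this[of b] this[of c] this[of d]
  show "(a = c \<and> b = d) \<or> (a = d \<and> b = c)" by metis
next
  assume "(a = c \<and> b = d) \<or> (a = d \<and> b = c)"
  then show "upair a b = upair c d" by (auto intro: set_ext)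
qed

lemma pair_eq_iff [simp]: "pair a b = pair c d \<longleftrightarrow> a = c \<and> b = d"
  by (auto simp: pair_def upair_eq_iff)

lemma fst'_pair [simp]: "fst' (pair a b) = a"
  unfolding fst'_def by (rule descr_eq) auto

lemma snd'_pair [simp]: "snd' (pair a b) = b"
  unfolding snd'_def by (rule descr_eq) auto

lemma term_upair [definability]:
  "definable_term s \<Longrightarrow> definable_term t \<Longrightarrow> definable_term (\<lambda>e. upair (s e) (t e))"
  by (rule definable_term_bind2) (unfold upair_def, intro definability)

lemma term_join [definability]:
  "definable_term s \<Longrightarrow> definable_term t \<Longrightarrow> definable_term (\<lambda>e. join (s e) (t e))"
  by (rule definable_term_bind2) (unfold join_def, intro definability)

lemma term_Union [definability]: "definable_term t \<Longrightarrow> definable_term (\<lambda>e. Union (t e))"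
  by (rule definable_term_bind1) (unfold Union_def, intro definability)

lemma term_Pow [definability]: "definable_term t \<Longrightarrow> definable_term (\<lambda>e. Pow (t e))"
  by (rule definable_term_bind1) (unfold Pow_def, intro definability)

lemma term_succ [definability]: "definable_term t \<Longrightarrow> definable_term (\<lambda>e. succ (t e))"
  by (rule definable_term_bind1) (unfold succ_def, intro definability)

lemma term_pair [definability]:
  "definable_term s \<Longrightarrow> definable_term t \<Longrightarrow> definable_term (\<lambda>e. pair (s e) (t e))"
  unfolding pair_def by (intro definability)

lemma term_fst' [definability]: "definable_term t \<Longrightarrow> definable_term (\<lambda>e. fst' (t e))"
  by (rule definable_term_bind1) (unfold fst'_def, intro definability)

lemma term_snd' [definability]: "definable_term t \<Longrightarrow> definable_term (\<lambda>e. snd' (t e))"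
  by (rule definable_term_bind1) (unfold snd'_def, intro definability)

lemma term_app [definability]:
  "definable_term s \<Longrightarrow> definable_term t \<Longrightarrow> definable_term (\<lambda>e. app (s e) (t e))"
  by (rule definable_term_bind2) (unfold app_def, intro definability)

lemma term_cart [definability]:
  "definable_term s \<Longrightarrow> definable_term t \<Longrightarrow> definable_term (\<lambda>e. cart (s e) (t e))"
  by (rule definable_term_bind2) (unfold cart_def, intro definability)

lemma mem_cart: "p \<^bold>\<in> cart a b \<longleftrightarrow> (\<exists>x y. x \<^bold>\<in> a \<and> y \<^bold>\<in> b \<and> p = pair x y)"
  unfolding cart_def
proof (rule mem_Coll_bounded)
  fix p assume "\<exists>x y. x \<^bold>\<in> a \<and> y \<^bold>\<in> b \<and> p = pair x y"
  then show "p \<^bold>\<in> Pow (Pow (join a b))" by (auto simp: subset_def pair_def)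
qed (intro definability)

lemma mem_Lam:
  assumes "definable_term (\<lambda>e. f (e 0))"
  shows "p \<^bold>\<in> Lam a f \<longleftrightarrow> (\<exists>x. x \<^bold>\<in> a \<and> p = pair x (f x))"
  unfolding Lam_def by (rule mem_img) (intro definability assms)

lemma function_on_Lam:
  assumes "definable_term (\<lambda>e. f (e 0))"
  shows "function_on (Lam a f) a"
  unfolding function_on_def maps_iff is_pair_iff mem_Lam[OF assms] by auto

lemma app_eq: "(\<And>z. pair x z \<^bold>\<in> f \<longleftrightarrow> z = y) \<Longrightarrow> app f x = y"
  unfolding app_def by (rule descr_eq) auto

lemma app_Lam:
  assumes "definable_term (\<lambda>e. f (e 0))" "x \<^bold>\<in> a"
  shows "app (Lam a f) x = f x"
  by (rule app_eq) (use assms(2) in \<open>auto simp: mem_Lam[OF assms(1)]\<close>)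

lemma maps_app:
  assumes "function_on f d"
  shows "maps f x y \<longleftrightarrow> x \<^bold>\<in> d \<and> y = app f x"
proof
  assume m: "maps f x y"
  then have x: "x \<^bold>\<in> d" using assms by (auto simp: function_on_def maps_iff is_pair_iff)
  then have "\<exists>!y. maps f x y" using assms by (simp add: function_on_def)
  with m x show "x \<^bold>\<in> d \<and> y = app f x" by (auto simp: maps_iff intro!: app_eq[symmetric])
next
  assume x: "x \<^bold>\<in> d \<and> y = app f x"
  then obtain z where z: "maps f x z" "\<And>z'. maps f x z' \<Longrightarrow> z' = z"
    using assms unfolding function_on_def by blast
  have "app f x = z" by (rule app_eq) (use z in \<open>unfold maps_iff, blast\<close>)
  with x z(1) show "maps f x y" by simp
qed

subsection \<open>Foundation and ordinals\<close>

lemma minimal_element: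
  assumes "definable (\<lambda>e. P (e 0))" "x \<^bold>\<in> a" "P x"
  obtains y where "y \<^bold>\<in> a" "P y" "\<And>z. z \<^bold>\<in> y \<Longrightarrow> z \<^bold>\<in> a \<Longrightarrow> \<not> P z"
proof -
  have "\<exists>y. y \<^bold>\<in> Sep a P" using assms by (auto simp: mem_Sep)
  then obtain y where "y \<^bold>\<in> Sep a P" "\<not> (\<exists>z. z \<^bold>\<in> Sep a P \<and> z \<^bold>\<in> y)"
    using foundation by blast
  then show ?thesis using that assms(1) by (auto simp: mem_Sep)
qed

lemma mem_irrefl: "\<not> x \<^bold>\<in> x"
proof -
  obtain y where "y \<^bold>\<in> upair x x" "\<not> (\<exists>z. z \<^bold>\<in> upair x x \<and> z \<^bold>\<in> y)"
    using foundation[rule_format, of "upair x x"] by auto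
  then show ?thesis by auto
qed

lemma mem_asym: "x \<^bold>\<in> y \<Longrightarrow> \<not> y \<^bold>\<in> x"
proof
  assume "x \<^bold>\<in> y" "y \<^bold>\<in> x"
  moreover obtain z where "z \<^bold>\<in> upair x y" "\<not> (\<exists>u. u \<^bold>\<in> upair x y \<and> u \<^bold>\<in> z)"
    using foundation[rule_format, of "upair x y"] by auto
  ultimately show False by auto
qed

lemma definable_transitive_set [definability]:
  "definable_term t \<Longrightarrow> definable (\<lambda>e. transitive_set (t e))"
  by (rule definable_bind1) (unfold transitive_set_def, intro definability)

lemma definable_ordinal [definability]:
  "definable_term t \<Longrightarrow> definable (\<lambda>e. ordinal (t e))"
  by (rule definable_bind1) (unfold ordinal_def, intro definability)

lemma transitive_setD: "transitive_set a \<Longrightarrow> b \<^bold>\<in> a \<Longrightarrow> c \<^bold>\<in> b \<Longrightarrow> c \<^bold>\<in> a"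
  by (auto simp: transitive_set_def subset_def)

lemma ordinal_trans: "ordinal a \<Longrightarrow> b \<^bold>\<in> a \<Longrightarrow> c \<^bold>\<in> b \<Longrightarrow> c \<^bold>\<in> a"
  by (auto simp: ordinal_def dest: transitive_setD)

lemma ordinal_mem: "ordinal a \<Longrightarrow> b \<^bold>\<in> a \<Longrightarrow> ordinal b"
  by (auto simp: ordinal_def dest: transitive_setD)

lemma ordinal_subset: "ordinal a \<Longrightarrow> b \<^bold>\<in> a \<Longrightarrow> b \<^bold>\<subseteq> a"
  by (auto simp: subset_def dest: ordinal_trans)

lemma ordinalI: "(\<And>b c. b \<^bold>\<in> a \<Longrightarrow> c \<^bold>\<in> b \<Longrightarrow> c \<^bold>\<in> a) \<Longrightarrow> (\<And>b. b \<^bold>\<in> a \<Longrightarrow> ordinal b) \<Longrightarrow> ordinal a"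
  unfolding ordinal_def transitive_set_def subset_def by blast

lemma least_ordinal:
  assumes P: "definable (\<lambda>e. P (e 0))" and a: "ordinal a" "P a"
  obtains b where "ordinal b" "P b" "\<And>c. c \<^bold>\<in> b \<Longrightarrow> \<not> P c"
proof (cases "\<exists>b. b \<^bold>\<in> a \<and> P b")
  case True
  then obtain y where "y \<^bold>\<in> a" "P y" "\<And>z. z \<^bold>\<in> y \<Longrightarrow> z \<^bold>\<in> a \<Longrightarrow> \<not> P z"
    using minimal_element[OF P] by metis
  then show ?thesis using that a ordinal_mem ordinal_trans by blast
next
  case False
  then show ?thesis using that a by blast
qed

lemma ordinal_induct [consumes 2, case_names step]:
  assumes P: "definable (\<lambda>e. P (e 0))" and a: "ordinal a"
    and step: "\<And>a. ordinal a \<Longrightarrow> (\<And>b. b \<^bold>\<in> a \<Longrightarrow> P b) \<Longrightarrow> P a"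
  shows "P a"
proof (rule ccontr)
  assume "\<not> P a"
  then obtain b where "ordinal b" "\<not> P b" "\<And>c. c \<^bold>\<in> b \<Longrightarrow> \<not> \<not> P c"
    using least_ordinal[of "\<lambda>a. \<not> P a"] a definable_not[OF P] by metis
  then show False using step by blast
qed

text \<open>Double induction: two ordinals comparable with all smaller ones, yet not related by
  membership, have the same elements.\<close>

lemma ordinal_linear: "ordinal a \<Longrightarrow> ordinal b \<Longrightarrow> a \<^bold>\<in> b \<or> a = b \<or> b \<^bold>\<in> a"
proof -
  assume a: "ordinal a" and b: "ordinal b"
  have "\<forall>b. ordinal b \<longrightarrow> a \<^bold>\<in> b \<or> a = b \<or> b \<^bold>\<in> a"
  proof (rule ordinal_induct[of "\<lambda>a. \<forall>b. ordinal b \<longrightarrow> a \<^bold>\<in> b \<or> a = b \<or> b \<^bold>\<in> a", OF _ a])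
    fix a assume a: "ordinal a"
      and IH: "\<And>c. c \<^bold>\<in> a \<Longrightarrow> \<forall>b. ordinal b \<longrightarrow> c \<^bold>\<in> b \<or> c = b \<or> b \<^bold>\<in> c"
    show "\<forall>b. ordinal b \<longrightarrow> a \<^bold>\<in> b \<or> a = b \<or> b \<^bold>\<in> a"
    proof (intro allI impI)
      fix b assume b: "ordinal b"
      show "a \<^bold>\<in> b \<or> a = b \<or> b \<^bold>\<in> a"
      proof (rule ordinal_induct[of "\<lambda>b. a \<^bold>\<in> b \<or> a = b \<or> b \<^bold>\<in> a", OF _ b])
        fix b assume b: "ordinal b" and IHb: "\<And>c. c \<^bold>\<in> b \<Longrightarrow> a \<^bold>\<in> c \<or> a = c \<or> c \<^bold>\<in> a"
        have "a = b" if "\<not> a \<^bold>\<in> b" "\<not> b \<^bold>\<in> a"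
        proof (rule set_ext)
          fix z
          show "z \<^bold>\<in> a \<longleftrightarrow> z \<^bold>\<in> b"
            using IH[of z] IHb[of z] that a b ordinal_trans by blast
        qed
        then show "a \<^bold>\<in> b \<or> a = b \<or> b \<^bold>\<in> a" by blast
      qed (intro definability)
    qed
  qed (intro definability)
  with b show ?thesis by blast
qed

lemma ordinal_subset_iff: "ordinal a \<Longrightarrow> ordinal b \<Longrightarrow> a \<^bold>\<subseteq> b \<longleftrightarrow> a \<^bold>\<in> b \<or> a = b"
  using ordinal_linear ordinal_subset mem_irrefl by (metis subset_def)

lemma ordinal_emp: "ordinal emp"
  by (rule ordinalI) auto

lemma ordinal_succ: "ordinal a \<Longrightarrow> ordinal (succ a)"
  by (rule ordinalI) (auto dest: ordinal_trans ordinal_mem)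

lemma ordinal_Union: "(\<And>b. b \<^bold>\<in> a \<Longrightarrow> ordinal b) \<Longrightarrow> ordinal (Union a)"
  by (rule ordinalI) (auto dest: ordinal_trans ordinal_mem)

lemma limit_succ:
  assumes "limit_ordinal w" "a \<^bold>\<in> w" shows "succ a \<^bold>\<in> w"
proof -
  obtain b where b: "b \<^bold>\<in> w" "a \<^bold>\<in> b" using assms by (auto simp: limit_ordinal_def)
  have w: "ordinal w" using assms by (simp add: limit_ordinal_def)
  have ord: "ordinal b" "ordinal (succ a)"
    using b w assms(2) by (auto intro: ordinal_mem ordinal_succ)
  have "succ a \<^bold>\<subseteq> b" using b ord ordinal_trans by (auto simp: subset_def)
  then have "succ a \<^bold>\<in> b \<or> succ a = b" using ord ordinal_subset_iff by blast
  then show ?thesis using b w ordinal_trans by blast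
qed

lemma limit_emp:
  assumes "limit_ordinal w" shows "emp \<^bold>\<in> w"
proof -
  have w: "ordinal w" "\<exists>y. y \<^bold>\<in> w" using assms by (auto simp: limit_ordinal_def)
  then have "\<not> w \<^bold>\<in> emp" "w \<noteq> emp" by auto
  then show ?thesis using ordinal_linear[OF w(1) ordinal_emp] by blast
qed

lemma limit_exists: "\<exists>w. limit_ordinal w"
proof -
  obtain w z where w: "z \<^bold>\<in> w" "\<forall>x. \<not> x \<^bold>\<in> z"
    "\<forall>x. x \<^bold>\<in> w \<longrightarrow> (\<exists>y. y \<^bold>\<in> w \<and> (\<forall>z. z \<^bold>\<in> y \<longleftrightarrow> z \<^bold>\<in> x \<or> z = x))"
    using infinity by blast
  have z: "z = emp" using w(2) by (auto intro: set_ext)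
  have succ: "succ x \<^bold>\<in> w" if x: "x \<^bold>\<in> w" for x
  proof -
    obtain y where "y \<^bold>\<in> w" "\<forall>z. z \<^bold>\<in> y \<longleftrightarrow> z \<^bold>\<in> x \<or> z = x" using w(3) x by blast
    moreover then have "y = succ x" by (auto intro: set_ext)
    ultimately show ?thesis by simp
  qed
  \<comment> \<open>The set given by Infinity may contain non-ordinals and need not be transitive.
    The union of its ordinals is an ordinal, and closure of \<open>w\<close> under successor makes
    it a limit.\<close>
  let ?l = "Union (Sep w ordinal)"
  have mem: "x \<^bold>\<in> Sep w ordinal \<longleftrightarrow> x \<^bold>\<in> w \<and> ordinal x" for x
    by (rule mem_Sep) (intro definability)
  have "ordinal ?l" by (rule ordinal_Union) (simp add: mem)
  moreover have "emp \<^bold>\<in> ?l"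
    using succ[OF w(1)] ordinal_succ[OF ordinal_emp] by (auto simp: mem z)
  moreover have "\<exists>b. b \<^bold>\<in> ?l \<and> a \<^bold>\<in> b" if a: "a \<^bold>\<in> ?l" for a
  proof -
    obtain x where "a \<^bold>\<in> x" "x \<^bold>\<in> w" "ordinal x" using a by (auto simp: mem)
    then show ?thesis using succ[of x] ordinal_succ[of x]
      by (intro exI[of _ x]) (auto simp: mem)
  qed
  ultimately show ?thesis unfolding limit_ordinal_def by blast
qed

subsection \<open>Recursion\<close>

text \<open>Partial solutions on subsets of \<open>d\<close> closed under
  \<open>r\<close>-predecessors agree where they overlap; their common value is definable, and an
  \<open>r\<close>-minimal point missed by all of them could be added. The condition on
  \<open>H\<close> says that \<open>H x p\<close> consults \<open>p\<close> only at predecessors of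
  \<open>x\<close>.\<close>

lemma well_founded_recursion:
  assumes r: "definable (\<lambda>e. r (e 0) (e 1))" and H: "definable_term (\<lambda>e. H (e 0) (e 1))"
    and wf: "\<And>s. \<exists>x. x \<^bold>\<in> s \<Longrightarrow> s \<^bold>\<subseteq> d \<Longrightarrow> \<exists>x. x \<^bold>\<in> s \<and> (\<forall>y. y \<^bold>\<in> s \<longrightarrow> \<not> r y x)"
    and loc: "\<And>x p q. x \<^bold>\<in> d \<Longrightarrow> (\<And>y. y \<^bold>\<in> d \<Longrightarrow> r y x \<Longrightarrow> app p y = app q y) \<Longrightarrow> H x p = H x q"
  obtains f where "function_on f d" "\<And>x. x \<^bold>\<in> d \<Longrightarrow> app f x = H x f"
proof -
  note [definability] = definable_bind2[of r, OF r] definable_term_bind2[of H, OF H]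
  define approx where "approx p s \<longleftrightarrow> s \<^bold>\<subseteq> d \<and> (\<forall>x y. x \<^bold>\<in> s \<and> y \<^bold>\<in> d \<and> r y x \<longrightarrow> y \<^bold>\<in> s) \<and>
    (\<forall>x. x \<^bold>\<in> s \<longrightarrow> app p x = H x p)" for p s
  have unique: "app p x = app q x" if p: "approx p s" and q: "approx q t" and "x \<^bold>\<in> s" "x \<^bold>\<in> t"
    for p q s t x
  proof (rule ccontr)
    let ?P = "\<lambda>x. x \<^bold>\<in> t \<and> app p x \<noteq> app q x"
    have mem: "x \<^bold>\<in> Sep s ?P \<longleftrightarrow> x \<^bold>\<in> s \<and> ?P x" for x
      by (rule mem_Sep) (intro definability)
    assume "app p x \<noteq> app q x"
    then have "\<exists>x. x \<^bold>\<in> Sep s ?P" using that by (auto simp: mem)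
    moreover have "Sep s ?P \<^bold>\<subseteq> d" using p unfolding approx_def subset_def mem by blast
    ultimately obtain y where y: "y \<^bold>\<in> Sep s ?P" "\<forall>z. z \<^bold>\<in> Sep s ?P \<longrightarrow> \<not> r z y"
      using wf by blast
    have "H y p = H y q"
    proof (rule loc)
      show "y \<^bold>\<in> d" using y p unfolding approx_def subset_def mem by blast
      fix z assume "z \<^bold>\<in> d" "r z y"
      then have "z \<^bold>\<in> s" "z \<^bold>\<in> t" using y(1) p q unfolding approx_def mem by blast+
      with y \<open>r z y\<close> show "app p z = app q z" unfolding mem by blast
    qed
    moreover have "app p y = H y p" "app q y = H y q" "app p y \<noteq> app q y"
      using y(1) p q unfolding approx_def mem by blast+
    ultimately show False by simp
  qed
  define F where "F x = descr (\<lambda>y. \<exists>p s. approx p s \<and> x \<^bold>\<in> s \<and> y = app p x)" for x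
  have F: "F x = app p x" if "approx p s" "x \<^bold>\<in> s" for x p s
    unfolding F_def by (rule descr_eq) (use unique that in blast)+
  have dF: "definable_term (\<lambda>e. F (e 0))"
    unfolding F_def approx_def by (intro definability)
  define f where "f = Lam d F"
  have f: "app f x = F x" if "x \<^bold>\<in> d" for x
    unfolding f_def by (rule app_Lam[OF dF that])
  have fH: "F x = H x f" if "approx p s" "x \<^bold>\<in> s" for x p s
  proof -
    have "H x f = H x p"
    proof (rule loc)
      show "x \<^bold>\<in> d" using that unfolding approx_def subset_def by blast
      fix y assume y: "y \<^bold>\<in> d" "r y x"
      then have "y \<^bold>\<in> s" using that unfolding approx_def by blast
      then show "app f y = app p y" using F[OF that(1)] f[OF y(1)] by simp
    qed
    then show ?thesis using F[OF that] that by (simp add: approx_def)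
  qed
  let ?C = "\<lambda>x. \<exists>p s. approx p s \<and> x \<^bold>\<in> s"
  have dC: "definable (\<lambda>e. ?C (e 0))" unfolding approx_def by (intro definability)
  define c where "c = Sep d ?C"
  have c: "x \<^bold>\<in> c \<longleftrightarrow> x \<^bold>\<in> d \<and> ?C x" for x unfolding c_def by (rule mem_Sep[OF dC])
  have all: "?C x" if x: "x \<^bold>\<in> d" for x
  proof (rule ccontr)
    assume "\<not> ?C x"
    have mem: "x \<^bold>\<in> Sep d (\<lambda>x. \<not> ?C x) \<longleftrightarrow> x \<^bold>\<in> d \<and> \<not> ?C x" for x
      by (rule mem_Sep) (rule definable_not[OF dC])
    have "\<exists>x. x \<^bold>\<in> Sep d (\<lambda>x. \<not> ?C x)" using x \<open>\<not> ?C x\<close> unfolding mem by blast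
    moreover have "Sep d (\<lambda>x. \<not> ?C x) \<^bold>\<subseteq> d" unfolding subset_def mem by blast
    ultimately have "\<exists>y. y \<^bold>\<in> Sep d (\<lambda>x. \<not> ?C x) \<and> (\<forall>z. z \<^bold>\<in> Sep d (\<lambda>x. \<not> ?C x) \<longrightarrow> \<not> r z y)"
      by (rule wf)
    then obtain y where "y \<^bold>\<in> Sep d (\<lambda>x. \<not> ?C x)" "\<forall>z. z \<^bold>\<in> Sep d (\<lambda>x. \<not> ?C x) \<longrightarrow> \<not> r z y"
      by (elim exE conjE)
    then have y: "y \<^bold>\<in> d" "\<not> ?C y" "\<And>z. z \<^bold>\<in> d \<Longrightarrow> \<not> ?C z \<Longrightarrow> \<not> r z y"
      unfolding mem by blast+
    \<comment> \<open>The points already reached together with \<open>y\<close>. Each value is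
      recomputed from \<open>f\<close>, which on \<open>c\<close> agrees with the partial solutions,
      so this is again a partial solution.\<close>
    let ?s = "join c (upair y y)" and ?p = "Lam (join c (upair y y)) (\<lambda>z. H z f)"
    have p: "app ?p z = H z f" if "z \<^bold>\<in> ?s" for z
      by (rule app_Lam[OF _ that]) (intro definability)
    have closed: "u \<^bold>\<in> c" if "z \<^bold>\<in> ?s" "u \<^bold>\<in> d" "r u z" for z u
    proof (cases "z \<^bold>\<in> c")
      case True
      then obtain p s where "approx p s" "z \<^bold>\<in> s" using c by blast
      then have "u \<^bold>\<in> s" using that unfolding approx_def by blast
      with \<open>approx p s\<close> that c show ?thesis by blast
    next
      case False
      then have "z = y" using that by simp
      then show ?thesis using that y c by blast
    qed
    have "approx ?p ?s"
      unfolding approx_def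
    proof (intro conjI allI impI)
      show "?s \<^bold>\<subseteq> d" using y(1) c by (auto simp: subset_def)
      fix z u assume "z \<^bold>\<in> ?s \<and> u \<^bold>\<in> d \<and> r u z"
      then show "u \<^bold>\<in> ?s" using closed by auto
    next
      fix z assume z: "z \<^bold>\<in> ?s"
      have "H z f = H z ?p"
      proof (rule loc)
        show "z \<^bold>\<in> d" using z y(1) c by auto
        fix u assume u: "u \<^bold>\<in> d" "r u z"
        then have uc: "u \<^bold>\<in> c" using closed z by blast
        then obtain p s where ps: "approx p s" "u \<^bold>\<in> s" using c by blast
        have "app f u = F u" using u by (simp add: f)
        also have "\<dots> = H u f" by (rule fH[OF ps])
        also have "\<dots> = app ?p u" using p uc by simp
        finally show "app f u = app ?p u" .
      qed
      with p[OF z] show "app ?p z = H z ?p" by simp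
    qed
    then have "?C y" by (intro exI[of _ ?p] exI[of _ ?s]) simp
    with y(2) show False by blast
  qed
  show ?thesis
  proof (rule that)
    show "function_on f d" unfolding f_def by (rule function_on_Lam[OF dF])
    fix x assume "x \<^bold>\<in> d"
    with all fH f show "app f x = H x f" by metis
  qed
qed

text \<open>Only elements of \<open>x\<close> lying in \<open>d\<close> count as predecessors; this
  covers the Mostowski collapse, where \<open>d\<close> is not transitive.\<close>

lemma mem_recursion:
  assumes H: "definable_term (\<lambda>e. H (e 0) (e 1))"
    and loc: "\<And>x p q. x \<^bold>\<in> d \<Longrightarrow> (\<And>y. y \<^bold>\<in> d \<Longrightarrow> y \<^bold>\<in> x \<Longrightarrow> app p y = app q y) \<Longrightarrow> H x p = H x q"
  obtains f where "function_on f d" "\<And>x. x \<^bold>\<in> d \<Longrightarrow> app f x = H x f"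
proof (rule well_founded_recursion[of "\<lambda>y x. y \<^bold>\<in> x" H d])
  show "definable (\<lambda>e. e 0 \<^bold>\<in> e 1)" by (intro definability)
  show "\<exists>x. x \<^bold>\<in> s \<and> (\<forall>y. y \<^bold>\<in> s \<longrightarrow> \<not> y \<^bold>\<in> x)" if "\<exists>x. x \<^bold>\<in> s" for s
    using foundation that by blast
qed (use H loc that in blast)+

end

section \<open>The cumulative hierarchy\<close>

context ZFC_model begin

lemma definable_maps [definability]:
  "definable_term r \<Longrightarrow> definable_term s \<Longrightarrow> definable_term t \<Longrightarrow> definable (\<lambda>e. maps (r e) (s e) (t e))"
  unfolding maps_iff by (intro definability)

lemma definable_function_on [definability]:
  "definable_term s \<Longrightarrow> definable_term t \<Longrightarrow> definable (\<lambda>e. function_on (s e) (t e))"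
  by (rule definable_bind2) (unfold function_on_def is_pair_iff, intro definability)

lemma definable_cumulative_hierarchy [definability]:
  "definable_term s \<Longrightarrow> definable_term t \<Longrightarrow> definable (\<lambda>e. cumulative_hierarchy (s e) (t e))"
  by (rule definable_bind2) (unfold cumulative_hierarchy_def, intro definability)

lemma cumulative_hierarchy_iff:
  assumes "ordinal a"
  shows "cumulative_hierarchy f a \<longleftrightarrow> function_on f a \<and>
    (\<forall>b x. b \<^bold>\<in> a \<longrightarrow> (x \<^bold>\<in> app f b \<longleftrightarrow> (\<exists>c. c \<^bold>\<in> b \<and> x \<^bold>\<subseteq> app f c)))"
proof (cases "function_on f a")
  case True
  show ?thesis
    unfolding cumulative_hierarchy_def maps_app[OF True]
    using ordinal_trans[OF assms] by blast
qed (simp add: cumulative_hierarchy_def)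

lemma cumulative_hierarchy_exists:
  assumes "ordinal a"
  shows "\<exists>f. cumulative_hierarchy f a"
proof -
  define H where "H b p = Coll (\<lambda>u. \<exists>c. c \<^bold>\<in> b \<and> u \<^bold>\<subseteq> app p c)" for b p
  have H: "u \<^bold>\<in> H b p \<longleftrightarrow> (\<exists>c. c \<^bold>\<in> b \<and> u \<^bold>\<subseteq> app p c)" for u b p
    unfolding H_def
  proof (rule mem_Coll_bounded)
    have mem: "y \<^bold>\<in> img (app p) b \<longleftrightarrow> (\<exists>c. c \<^bold>\<in> b \<and> y = app p c)" for y
      by (rule mem_img) (intro definability)
    fix u assume "\<exists>c. c \<^bold>\<in> b \<and> u \<^bold>\<subseteq> app p c"
    then show "u \<^bold>\<in> Pow (Union (img (app p) b))"
      unfolding mem_Pow subset_def mem_Union mem by blast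
  qed (intro definability)
  obtain f where f: "function_on f a" "\<And>b. b \<^bold>\<in> a \<Longrightarrow> app f b = H b f"
  proof (rule mem_recursion[of H a])
    show "definable_term (\<lambda>e. H (e 0) (e 1))" unfolding H_def by (intro definability)
    fix b p q assume "b \<^bold>\<in> a" "\<And>c. c \<^bold>\<in> a \<Longrightarrow> c \<^bold>\<in> b \<Longrightarrow> app p c = app q c"
    then have "app p c = app q c" if "c \<^bold>\<in> b" for c
      using ordinal_trans[OF assms] that by blast
    then show "H b p = H b q" by (intro set_ext) (simp add: H cong: conj_cong)
  qed (rule that)
  then have "cumulative_hierarchy f a" by (simp add: cumulative_hierarchy_iff[OF assms] H)
  then show ?thesis ..
qed

lemma cumulative_hierarchy_unique:
  assumes a: "ordinal a" "cumulative_hierarchy f a" and b: "ordinal b" "cumulative_hierarchy g b"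
    and c: "c \<^bold>\<in> a" "c \<^bold>\<in> b"
  shows "app f c = app g c"
proof -
  have "ordinal c" using a(1) c(1) by (rule ordinal_mem)
  then have "c \<^bold>\<in> a \<longrightarrow> c \<^bold>\<in> b \<longrightarrow> app f c = app g c"
  proof (rule ordinal_induct[rotated])
    show "definable (\<lambda>e. e 0 \<^bold>\<in> a \<longrightarrow> e 0 \<^bold>\<in> b \<longrightarrow> app f (e 0) = app g (e 0))"
      by (intro definability)
    fix c assume IH: "\<And>d. d \<^bold>\<in> c \<Longrightarrow> d \<^bold>\<in> a \<longrightarrow> d \<^bold>\<in> b \<longrightarrow> app f d = app g d"
    show "c \<^bold>\<in> a \<longrightarrow> c \<^bold>\<in> b \<longrightarrow> app f c = app g c"
    proof (intro impI set_ext)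
      fix x assume c: "c \<^bold>\<in> a" "c \<^bold>\<in> b"
      then have "app f d = app g d" if "d \<^bold>\<in> c" for d
        using IH[OF that] that ordinal_trans[OF a(1)] ordinal_trans[OF b(1)] by blast
      then have "(\<exists>d. d \<^bold>\<in> c \<and> x \<^bold>\<subseteq> app f d) \<longleftrightarrow> (\<exists>d. d \<^bold>\<in> c \<and> x \<^bold>\<subseteq> app g d)"
        by (simp cong: conj_cong)
      with a b c show "x \<^bold>\<in> app f c \<longleftrightarrow> x \<^bold>\<in> app g c"
        by (simp add: cumulative_hierarchy_iff)
    qed
  qed
  with c show ?thesis by blast
qed

text \<open>\<open>Vset\<close> is a set of the metatheory; arguments inside the model need the same
  rank as an element of the model.\<close>

definition V :: "'v \<Rightarrow> 'v" where
  "V a = Coll (\<lambda>x. \<exists>f c z. cumulative_hierarchy f a \<and> maps f c z \<and> x \<^bold>\<subseteq> z)"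

lemma term_V [definability]: "definable_term t \<Longrightarrow> definable_term (\<lambda>e. V (t e))"
  by (rule definable_term_bind1) (unfold V_def, intro definability)

lemma Vset_Coll_hierarchy:
  assumes "ordinal a" "cumulative_hierarchy f a"
  shows "(\<exists>g c z. cumulative_hierarchy g a \<and> maps g c z \<and> x \<^bold>\<subseteq> z) \<longleftrightarrow> (\<exists>c. c \<^bold>\<in> a \<and> x \<^bold>\<subseteq> app f c)"
proof
  assume "\<exists>g c z. cumulative_hierarchy g a \<and> maps g c z \<and> x \<^bold>\<subseteq> z"
  then obtain g c z where g: "cumulative_hierarchy g a" "maps g c z" "x \<^bold>\<subseteq> z" by blast
  have "function_on g a" using g(1) by (simp add: cumulative_hierarchy_def)
  then have "c \<^bold>\<in> a" "z = app g c" using g(2) by (simp_all add: maps_app)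
  then show "\<exists>c. c \<^bold>\<in> a \<and> x \<^bold>\<subseteq> app f c"
    using g(3) cumulative_hierarchy_unique[OF assms(1) g(1) assms, of c] by auto
next
  assume "\<exists>c. c \<^bold>\<in> a \<and> x \<^bold>\<subseteq> app f c"
  then obtain c where c: "c \<^bold>\<in> a" "x \<^bold>\<subseteq> app f c" by blast
  have "function_on f a" using assms(2) by (simp add: cumulative_hierarchy_def)
  then have "maps f c (app f c)" using c(1) by (simp add: maps_app)
  then show "\<exists>g c z. cumulative_hierarchy g a \<and> maps g c z \<and> x \<^bold>\<subseteq> z" using assms(2) c(2) by blast
qed

lemma mem_V_hierarchy:
  assumes "ordinal a" "cumulative_hierarchy f a"
  shows "x \<^bold>\<in> V a \<longleftrightarrow> (\<exists>c. c \<^bold>\<in> a \<and> x \<^bold>\<subseteq> app f c)"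
  unfolding V_def Vset_Coll_hierarchy[OF assms]
proof (rule mem_Coll_bounded)
  have mem: "y \<^bold>\<in> img (app f) a \<longleftrightarrow> (\<exists>c. c \<^bold>\<in> a \<and> y = app f c)" for y
    by (rule mem_img) (intro definability)
  fix x assume "\<exists>c. c \<^bold>\<in> a \<and> x \<^bold>\<subseteq> app f c"
  then show "x \<^bold>\<in> Pow (Union (img (app f) a))"
    unfolding mem_Pow subset_def mem_Union mem by blast
qed (intro definability)

lemma Vset_eq:
  assumes "ordinal a"
  shows "Vset a = {x. x \<^bold>\<in> V a}"
proof -
  obtain f where f: "cumulative_hierarchy f a"
    using cumulative_hierarchy_exists[OF assms] by blast
  show ?thesis
    unfolding Vset_def mem_V_hierarchy[OF assms f] Vset_Coll_hierarchy[OF assms f] ..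
qed

lemma hierarchy_V:
  assumes a: "ordinal a" "cumulative_hierarchy f a" "c \<^bold>\<in> a"
  shows "app f c = V c"
proof (rule set_ext)
  fix x
  have c: "ordinal c" using a by (blast intro: ordinal_mem)
  obtain g where g: "cumulative_hierarchy g c" using cumulative_hierarchy_exists[OF c] by blast
  have "app g d = app f d" if "d \<^bold>\<in> c" for d
    using cumulative_hierarchy_unique[OF c g a(1,2) that] a that ordinal_trans by blast
  then show "x \<^bold>\<in> app f c \<longleftrightarrow> x \<^bold>\<in> V c"
    using a by (simp add: mem_V_hierarchy[OF c g] cumulative_hierarchy_iff cong: conj_cong)
qed

lemma mem_V:
  assumes "ordinal a"
  shows "x \<^bold>\<in> V a \<longleftrightarrow> (\<exists>c. c \<^bold>\<in> a \<and> x \<^bold>\<subseteq> V c)"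
proof -
  obtain f where f: "cumulative_hierarchy f a"
    using cumulative_hierarchy_exists[OF assms] by blast
  show ?thesis
    unfolding mem_V_hierarchy[OF assms f] using hierarchy_V[OF assms f] by auto
qed

lemma V_subset_mem: "ordinal a \<Longrightarrow> x \<^bold>\<in> V a \<Longrightarrow> y \<^bold>\<subseteq> x \<Longrightarrow> y \<^bold>\<in> V a"
  by (meson mem_V subset_trans)

lemma V_mono: "ordinal a \<Longrightarrow> ordinal b \<Longrightarrow> a \<^bold>\<subseteq> b \<Longrightarrow> V a \<^bold>\<subseteq> V b"
  unfolding subset_def mem_V by (meson mem_V)

lemma V_mem: "ordinal b \<Longrightarrow> a \<^bold>\<in> b \<Longrightarrow> V a \<^bold>\<in> V b"
  using mem_V subset_refl by blast

lemma V_trans: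
  assumes "ordinal a" "x \<^bold>\<in> V a" "y \<^bold>\<in> x"
  shows "y \<^bold>\<in> V a"
proof -
  obtain c where c: "c \<^bold>\<in> a" "x \<^bold>\<subseteq> V c" using assms mem_V by blast
  then have "ordinal c" "c \<^bold>\<subseteq> a" using assms(1) by (auto intro: ordinal_mem ordinal_subset)
  then have "V c \<^bold>\<subseteq> V a" using assms(1) V_mono by blast
  then show ?thesis using c assms(3) by (blast dest: subsetD)
qed

lemma V_trans_mem: "ordinal a \<Longrightarrow> b \<^bold>\<in> a \<Longrightarrow> x \<^bold>\<in> V b \<Longrightarrow> x \<^bold>\<in> V a"
  using V_mono ordinal_mem ordinal_subset subsetD by blast

lemma ordinal_subset_V: "ordinal a \<Longrightarrow> a \<^bold>\<subseteq> V a"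
proof (rule ordinal_induct[of "\<lambda>a. a \<^bold>\<subseteq> V a"])
  fix a assume a: "ordinal a" "\<And>b. b \<^bold>\<in> a \<Longrightarrow> b \<^bold>\<subseteq> V b"
  then show "a \<^bold>\<subseteq> V a" by (meson mem_V subset_def)
qed (intro definability)

text \<open>Together with \<open>ordinal_subset_V\<close> this identifies the ordinals in
  \<open>V a\<close> with the elements of \<open>a\<close>; it converts membership of worlds in
  ranks into order of their heights.\<close>

lemma ordinal_mem_V:
  assumes "ordinal a" "ordinal b" "b \<^bold>\<in> V a"
  shows "b \<^bold>\<in> a"
proof -
  have "\<forall>b. ordinal b \<longrightarrow> b \<^bold>\<in> V a \<longrightarrow> b \<^bold>\<in> a"
  proof (rule ordinal_induct[of "\<lambda>a. \<forall>b. ordinal b \<longrightarrow> b \<^bold>\<in> V a \<longrightarrow> b \<^bold>\<in> a", OF _ assms(1)])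
    fix a assume a: "ordinal a" and IH: "\<And>c. c \<^bold>\<in> a \<Longrightarrow> \<forall>b. ordinal b \<longrightarrow> b \<^bold>\<in> V c \<longrightarrow> b \<^bold>\<in> c"
    show "\<forall>b. ordinal b \<longrightarrow> b \<^bold>\<in> V a \<longrightarrow> b \<^bold>\<in> a"
    proof (intro allI impI)
      fix b assume b: "ordinal b" "b \<^bold>\<in> V a"
      then obtain c where c: "c \<^bold>\<in> a" "b \<^bold>\<subseteq> V c" using mem_V[OF a] by blast
      have "ordinal c" using a c by (blast intro: ordinal_mem)
      moreover have "b \<^bold>\<subseteq> c"
        using IH[OF c(1)] b(1) c(2) ordinal_mem unfolding subset_def by blast
      ultimately show "b \<^bold>\<in> a"
        using ordinal_subset_iff[OF b(1)] c(1) ordinal_trans[OF a] by blast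
    qed
  qed (intro definability)
  then show ?thesis using assms by blast
qed

subsection \<open>Rank and choice\<close>

text \<open>Recursion along a limit ordinal, each stage adding the elements of members of earlier
  stages. It gives Foundation a set in which to look for a minimal unranked element.\<close>

lemma transitive_closure: "\<exists>t. x \<^bold>\<subseteq> t \<and> transitive_set t"
proof -
  obtain w where w: "limit_ordinal w" using limit_exists by blast
  have wo: "ordinal w" using w by (simp add: limit_ordinal_def)
  define H where "H n p = join x (Coll (\<lambda>u. \<exists>m y. m \<^bold>\<in> n \<and> y \<^bold>\<in> app p m \<and> u \<^bold>\<in> y))" for n p
  have H: "u \<^bold>\<in> H n p \<longleftrightarrow> u \<^bold>\<in> x \<or> (\<exists>m y. m \<^bold>\<in> n \<and> y \<^bold>\<in> app p m \<and> u \<^bold>\<in> y)" for u n p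
  proof -
    have mem: "y \<^bold>\<in> img (app p) n \<longleftrightarrow> (\<exists>m. m \<^bold>\<in> n \<and> y = app p m)" for y
      by (rule mem_img) (intro definability)
    have "u \<^bold>\<in> Coll (\<lambda>u. \<exists>m y. m \<^bold>\<in> n \<and> y \<^bold>\<in> app p m \<and> u \<^bold>\<in> y) \<longleftrightarrow>
      (\<exists>m y. m \<^bold>\<in> n \<and> y \<^bold>\<in> app p m \<and> u \<^bold>\<in> y)"
    proof (rule mem_Coll_bounded)
      fix u assume "\<exists>m y. m \<^bold>\<in> n \<and> y \<^bold>\<in> app p m \<and> u \<^bold>\<in> y"
      then show "u \<^bold>\<in> Union (Union (img (app p) n))"
        unfolding mem_Union mem by blast
    qed (intro definability)
    then show ?thesis by (simp add: H_def)
  qed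
  obtain f where f: "function_on f w" "\<And>n. n \<^bold>\<in> w \<Longrightarrow> app f n = H n f"
  proof (rule mem_recursion[of H w])
    show "definable_term (\<lambda>e. H (e 0) (e 1))" unfolding H_def by (intro definability)
    fix n p q assume "n \<^bold>\<in> w" "\<And>m. m \<^bold>\<in> w \<Longrightarrow> m \<^bold>\<in> n \<Longrightarrow> app p m = app q m"
    then have "app p m = app q m" if "m \<^bold>\<in> n" for m
      using ordinal_trans[OF wo] that by blast
    then show "H n p = H n q" by (intro set_ext) (simp add: H cong: conj_cong)
  qed (rule that)
  have mem: "y \<^bold>\<in> img (app f) w \<longleftrightarrow> (\<exists>m. m \<^bold>\<in> w \<and> y = app f m)" for y
    by (rule mem_img) (intro definability)
  let ?t = "Union (img (app f) w)"
  have t: "u \<^bold>\<in> ?t \<longleftrightarrow> (\<exists>n. n \<^bold>\<in> w \<and> u \<^bold>\<in> H n f)" for u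
    unfolding mem_Union mem using f(2) by auto
  have "x \<^bold>\<subseteq> ?t" unfolding subset_def t H using limit_emp[OF w] by blast
  moreover have "u \<^bold>\<in> ?t" if y: "y \<^bold>\<in> ?t" "u \<^bold>\<in> y" for u y
  proof -
    obtain n where n: "n \<^bold>\<in> w" "y \<^bold>\<in> app f n" using y(1) f(2) unfolding t by auto
    then have "u \<^bold>\<in> H (succ n) f" using y(2) unfolding H by auto
    then show ?thesis using limit_succ[OF w n(1)] unfolding t by blast
  qed
  then have "transitive_set ?t" unfolding transitive_set_def subset_def by blast
  ultimately show ?thesis by blast
qed

text \<open>One more than the usual rank, since it asks for \<open>x\<close> as an element of a rank
  and not merely as a subset.\<close>

definition rank_bound :: "'v \<Rightarrow> 'v" where
  "rank_bound x = descr (\<lambda>a. ordinal a \<and> x \<^bold>\<in> V a \<and> (\<forall>b. b \<^bold>\<in> a \<longrightarrow> \<not> x \<^bold>\<in> V b))"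

lemma term_rank_bound [definability]:
  "definable_term t \<Longrightarrow> definable_term (\<lambda>e. rank_bound (t e))"
  by (rule definable_term_bind1) (unfold rank_bound_def, intro definability)

lemma rank_bound_aux:
  assumes "ordinal a" "x \<^bold>\<in> V a"
  shows "ordinal (rank_bound x) \<and> x \<^bold>\<in> V (rank_bound x) \<and> (\<forall>b. b \<^bold>\<in> rank_bound x \<longrightarrow> \<not> x \<^bold>\<in> V b)"
proof -
  obtain b where b: "ordinal b" "x \<^bold>\<in> V b" "\<And>c. c \<^bold>\<in> b \<Longrightarrow> \<not> x \<^bold>\<in> V c"
    by (rule least_ordinal[of "\<lambda>a. x \<^bold>\<in> V a", OF _ assms]) (intro definability, blast)
  have "rank_bound x = b"
    unfolding rank_bound_def
  proof (rule descr_eq)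
    fix c assume c: "ordinal c \<and> x \<^bold>\<in> V c \<and> (\<forall>b. b \<^bold>\<in> c \<longrightarrow> \<not> x \<^bold>\<in> V b)"
    then show "c = b" using ordinal_linear[of b c] b by blast
  qed (use b in blast)
  with b show ?thesis by blast
qed

text \<open>Induction on membership, run inside a transitive closure because Foundation speaks of
  sets only. The ordinal for \<open>x\<close> is the successor of the supremum of those of its
  elements.\<close>

lemma V_exists: "\<exists>a. ordinal a \<and> x \<^bold>\<in> V a"
proof -
  let ?R = "\<lambda>x. \<exists>a. ordinal a \<and> x \<^bold>\<in> V a"
  have step: "?R x" if x: "\<And>y. y \<^bold>\<in> x \<Longrightarrow> ?R y" for x
  proof -
    have mem: "z \<^bold>\<in> img rank_bound x \<longleftrightarrow> (\<exists>y. y \<^bold>\<in> x \<and> z = rank_bound y)" for z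
      by (rule mem_img) (intro definability)
    let ?s = "Union (img rank_bound x)"
    have rb: "ordinal (rank_bound y)" "y \<^bold>\<in> V (rank_bound y)" if "y \<^bold>\<in> x" for y
      using x[OF that] rank_bound_aux by blast+
    have s: "ordinal ?s" by (rule ordinal_Union) (use rb in \<open>auto simp: mem\<close>)
    have "y \<^bold>\<in> V ?s" if "y \<^bold>\<in> x" for y
    proof -
      have "rank_bound y \<^bold>\<subseteq> ?s" using that by (auto simp: subset_def mem)
      then show ?thesis using V_mono[OF rb(1)[OF that] s] rb(2)[OF that] subsetD by blast
    qed
    then have "x \<^bold>\<in> V (succ ?s)" using mem_V[OF ordinal_succ[OF s]] by (auto simp: subset_def)
    then show ?thesis using ordinal_succ[OF s] by blast
  qed
  have dR: "definable (\<lambda>e. \<not> ?R (e 0))" by (intro definability)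
  obtain t where t: "x \<^bold>\<subseteq> t" "transitive_set t" using transitive_closure by blast
  have "?R y" if y: "y \<^bold>\<in> t" for y
  proof (rule ccontr)
    assume "\<not> ?R y"
    then obtain z where z: "z \<^bold>\<in> t" "\<not> ?R z" "\<And>u. u \<^bold>\<in> z \<Longrightarrow> u \<^bold>\<in> t \<Longrightarrow> \<not> \<not> ?R u"
      using minimal_element[OF dR y] by blast
    have "?R z" by (rule step) (use z t(2) transitive_setD in blast)
    with z(2) show False ..
  qed
  then show ?thesis using step t(1) subsetD by blast
qed

lemma rank_bound:
  "ordinal (rank_bound x)" "x \<^bold>\<in> V (rank_bound x)" "b \<^bold>\<in> rank_bound x \<Longrightarrow> \<not> x \<^bold>\<in> V b"
  using V_exists[of x] rank_bound_aux by blast+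

lemma rank_bound_least:
  assumes "ordinal a" "x \<^bold>\<in> V a"
  shows "rank_bound x \<^bold>\<subseteq> a"
  using ordinal_linear[OF rank_bound(1) assms(1), of x] rank_bound(3)[of a x] assms(2)
  by (metis ordinal_subset assms(1) subset_refl)

text \<open>Scott's trick: the witnesses for \<open>x\<close> may form a proper class, so they are
  cut down to the first rank containing one. Tagging each witness with \<open>x\<close> makes the
  resulting sets disjoint, as the axiom of choice demands. Only the values \<open>app f x\<close>
  for \<open>x\<close> in \<open>a\<close> are asserted.\<close>

lemma choice_function:
  assumes R: "definable (\<lambda>e. R (e 0) (e 1))" and ex: "\<And>x. x \<^bold>\<in> a \<Longrightarrow> \<exists>y. R x y"
  obtains f where "\<And>x. x \<^bold>\<in> a \<Longrightarrow> R x (app f x)"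
proof -
  note [definability] = definable_bind2[of R, OF R]
  define b where "b x = descr (\<lambda>b. ordinal b \<and> (\<exists>y. y \<^bold>\<in> V b \<and> R x y) \<and>
    (\<forall>c. c \<^bold>\<in> b \<longrightarrow> \<not> (\<exists>y. y \<^bold>\<in> V c \<and> R x y)))" for x
  have b: "\<exists>y. y \<^bold>\<in> V (b x) \<and> R x y" if x: "x \<^bold>\<in> a" for x
  proof -
    obtain y where y: "R x y" using ex[OF x] by blast
    obtain d where d: "ordinal d" "y \<^bold>\<in> V d" using V_exists by blast
    obtain c where c: "ordinal c" "\<exists>y. y \<^bold>\<in> V c \<and> R x y" "\<And>d. d \<^bold>\<in> c \<Longrightarrow> \<not> (\<exists>y. y \<^bold>\<in> V d \<and> R x y)"
    proof (rule least_ordinal[of "\<lambda>c. \<exists>y. y \<^bold>\<in> V c \<and> R x y"])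
      show "definable (\<lambda>e. \<exists>y. y \<^bold>\<in> V (e 0) \<and> R x y)" by (intro definability)
    qed (use y d in blast)+
    have "b x = c"
      unfolding b_def
    proof (rule descr_eq)
      fix c' assume "ordinal c' \<and> (\<exists>y. y \<^bold>\<in> V c' \<and> R x y) \<and> (\<forall>d. d \<^bold>\<in> c' \<longrightarrow> \<not> (\<exists>y. y \<^bold>\<in> V d \<and> R x y))"
      then show "c' = c" using ordinal_linear[of c c'] c by blast
    qed (use c in blast)
    with c(2) show ?thesis by simp
  qed
  have db: "definable_term (\<lambda>e. b (e 0))" unfolding b_def by (intro definability)
  note [definability] = definable_term_bind1[of b, OF db]
  define Y where "Y x = Coll (\<lambda>p. \<exists>y. p = pair x y \<and> y \<^bold>\<in> V (b x) \<and> R x y)" for x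
  have Y: "p \<^bold>\<in> Y x \<longleftrightarrow> (\<exists>y. p = pair x y \<and> y \<^bold>\<in> V (b x) \<and> R x y)" for p x
    unfolding Y_def
  proof (rule mem_Coll_bounded)
    fix p assume "\<exists>y. p = pair x y \<and> y \<^bold>\<in> V (b x) \<and> R x y"
    then show "p \<^bold>\<in> cart (upair x x) (V (b x))" unfolding mem_cart by auto
  qed (intro definability)
  have mem: "z \<^bold>\<in> img Y a \<longleftrightarrow> (\<exists>x. x \<^bold>\<in> a \<and> z = Y x)" for z
    by (rule mem_img) (unfold Y_def, intro definability)
  have "(\<forall>y. y \<^bold>\<in> img Y a \<longrightarrow> (\<exists>z. z \<^bold>\<in> y)) \<and>
      (\<forall>y y' z. y \<^bold>\<in> img Y a \<and> y' \<^bold>\<in> img Y a \<and> z \<^bold>\<in> y \<and> z \<^bold>\<in> y' \<longrightarrow> y = y')"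
    unfolding mem using b by (auto simp: Y)
  then obtain c where c: "\<And>y. y \<^bold>\<in> img Y a \<Longrightarrow> \<exists>!z. z \<^bold>\<in> y \<and> z \<^bold>\<in> c"
    using choice by blast
  define f where "f = Coll (\<lambda>p. p \<^bold>\<in> c \<and> (\<exists>x. x \<^bold>\<in> a \<and> p \<^bold>\<in> Y x))"
  have f: "p \<^bold>\<in> f \<longleftrightarrow> p \<^bold>\<in> c \<and> (\<exists>x. x \<^bold>\<in> a \<and> p \<^bold>\<in> Y x)" for p
    unfolding f_def by (rule mem_Coll_bounded[of _ c]) (unfold Y, intro definability, blast)
  have "R x (app f x)" if x: "x \<^bold>\<in> a" for x
  proof -
    have "\<exists>!z. z \<^bold>\<in> Y x \<and> z \<^bold>\<in> c" by (rule c) (use x mem in blast)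
    then obtain z where z: "z \<^bold>\<in> Y x" "z \<^bold>\<in> c" "\<And>z'. z' \<^bold>\<in> Y x \<Longrightarrow> z' \<^bold>\<in> c \<Longrightarrow> z' = z" by blast
    then obtain y where y: "z = pair x y" "R x y" unfolding Y by blast
    have "app f x = y"
    proof (rule app_eq)
      fix u
      show "pair x u \<^bold>\<in> f \<longleftrightarrow> u = y"
      proof
        assume "pair x u \<^bold>\<in> f"
        then have "pair x u \<^bold>\<in> c" "pair x u \<^bold>\<in> Y x" unfolding f Y by auto
        then have "pair x u = pair x y" using z(3) y(1) by blast
        then show "u = y" by simp
      next
        assume "u = y"
        then show "pair x u \<^bold>\<in> f" using z(1,2) y(1) x unfolding f by blast
      qed
    qed
    with y(2) show ?thesis by simp
  qed
  then show ?thesis by (rule that)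
qed

end

section \<open>Inaccessible cardinals\<close>

context ZFC_model begin

lemma definable_inaccessible [definability]:
  "definable_term t \<Longrightarrow> definable (\<lambda>e. inaccessible (t e))"
  by (rule definable_bind1)
    (unfold inaccessible_def uncountable_cardinal_def cardinal_def regular_def strong_limit_def
      equinumerous_def bijection_def is_omega_def limit_ordinal_def is_power_def function_into_def,
      intro definability)

text \<open>A surjection onto \<^term>\<open>x\<close> need not be a function in the formal sense: \<^const>\<open>app\<close>
  is total.\<close>

definition small :: "'v \<Rightarrow> 'v \<Rightarrow> bool" where
  "small k x \<longleftrightarrow> (\<exists>a f. a \<^bold>\<in> k \<and> (\<forall>y. y \<^bold>\<in> x \<longrightarrow> (\<exists>d. d \<^bold>\<in> a \<and> y = app f d)))"

lemma definable_small [definability]: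
  "definable_term s \<Longrightarrow> definable_term t \<Longrightarrow> definable (\<lambda>e. small (s e) (t e))"
  by (rule definable_bind2) (unfold small_def, intro definability)

lemma small_subset: "small k x \<Longrightarrow> y \<^bold>\<subseteq> x \<Longrightarrow> small k y"
  unfolding small_def subset_def by blast

lemma small_mem: "a \<^bold>\<in> k \<Longrightarrow> small k a"
  unfolding small_def
  by (intro exI[of _ a] exI[of _ "Lam a (\<lambda>x. x)"]) (auto simp: app_Lam term_var)

lemma small_image:
  assumes h: "definable_term (\<lambda>e. h (e 0))" and x: "small k x"
    and cover: "\<And>y. y \<^bold>\<in> y' \<Longrightarrow> \<exists>z. z \<^bold>\<in> x \<and> y = h z"
  shows "small k y'"
proof -
  note [definability] = definable_term_bind1[of h, OF h]
  obtain a f where a: "a \<^bold>\<in> k" and f: "\<And>y. y \<^bold>\<in> x \<Longrightarrow> \<exists>d. d \<^bold>\<in> a \<and> y = app f d"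
    using x unfolding small_def by blast
  have lam: "app (Lam a (\<lambda>d. h (app f d))) d = h (app f d)" if "d \<^bold>\<in> a" for d
    by (rule app_Lam[OF _ that]) (intro definability)
  have "\<exists>d. d \<^bold>\<in> a \<and> y = app (Lam a (\<lambda>d. h (app f d))) d" if y: "y \<^bold>\<in> y'" for y
  proof -
    obtain z where z: "z \<^bold>\<in> x" "y = h z" using cover[OF y] by blast
    then obtain d where "d \<^bold>\<in> a" "z = app f d" using f by blast
    with z show ?thesis using lam by auto
  qed
  with a show ?thesis unfolding small_def by blast
qed

section \<open>Closure properties of smallness below an inaccessible\<close>

context
  fixes k :: 'v
  assumes inacc: "inaccessible k"
begin

lemma ordinal_inaccessible: "ordinal k"
  using inacc by (simp add: inaccessible_def uncountable_cardinal_def cardinal_def)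

lemma omega_inaccessible: "\<exists>w. limit_ordinal w \<and> w \<^bold>\<in> k"
  using inacc by (auto simp: inaccessible_def uncountable_cardinal_def is_omega_def)

lemma regular_bound:
  assumes a: "a \<^bold>\<in> k" and h: "definable_term (\<lambda>e. h (e 0))" "\<And>d. d \<^bold>\<in> a \<Longrightarrow> h d \<^bold>\<in> k"
  obtains b where "b \<^bold>\<in> k" "\<And>d. d \<^bold>\<in> a \<Longrightarrow> h d \<^bold>\<in> b"
proof -
  let ?f = "Lam a h"
  have fn: "function_on ?f a" by (rule function_on_Lam[OF h(1)])
  have m: "maps ?f x y \<longleftrightarrow> x \<^bold>\<in> a \<and> y = h x" for x y
    unfolding maps_app[OF fn] using app_Lam[OF h(1)] by auto
  have "function_into ?f a k" using fn h(2) by (simp add: function_into_def m)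
  then obtain b where "b \<^bold>\<in> k" "\<forall>x y. maps ?f x y \<longrightarrow> y \<^bold>\<in> b"
    using inacc a unfolding inaccessible_def regular_def by blast
  then show ?thesis using that by (simp add: m)
qed

text \<open>Regularity excludes successors: if \<open>k\<close> were \<open>succ b\<close>, the
  constant map with value \<open>b\<close> on a limit ordinal below \<open>k\<close> would have to
  be bounded by an element of \<open>succ b\<close>.\<close>

lemma succ_inaccessible: "b \<^bold>\<in> k \<Longrightarrow> succ b \<^bold>\<in> k"
proof (rule ccontr)
  assume b: "b \<^bold>\<in> k" and n: "\<not> succ b \<^bold>\<in> k"
  have ord: "ordinal b" "ordinal (succ b)"
    using b ordinal_inaccessible by (auto intro: ordinal_mem ordinal_succ)
  have "\<not> k \<^bold>\<in> succ b" using b mem_asym mem_irrefl by auto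
  then have k: "k = succ b"
    using ordinal_linear[OF ordinal_inaccessible ord(2)] n by blast
  obtain w where w: "limit_ordinal w" "w \<^bold>\<in> k" using omega_inaccessible by blast
  obtain c where c: "c \<^bold>\<in> k" "\<And>d. d \<^bold>\<in> w \<Longrightarrow> b \<^bold>\<in> c"
  proof (rule regular_bound[of w "\<lambda>d. b"])
    show "definable_term (\<lambda>e. b)" by (intro definability)
  qed (use w b in blast)+
  have "b \<^bold>\<in> c" using c(2) limit_emp[OF w(1)] by blast
  then show False using c(1) unfolding k using mem_asym mem_irrefl by auto
qed

lemma emp_inaccessible: "emp \<^bold>\<in> k"
  using omega_inaccessible limit_emp ordinal_trans[OF ordinal_inaccessible] by blast

lemma small_Pow_ordinal:
  assumes "a \<^bold>\<in> k"
  shows "small k (Pow a)"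
proof -
  obtain b g where b: "b \<^bold>\<in> k" "bijection g (Pow a) b"
    using inacc assms unfolding inaccessible_def strong_limit_def is_power_iff equinumerous_def
    by blast
  have g: "function_on g (Pow a)" "\<And>x y. maps g x y \<Longrightarrow> y \<^bold>\<in> b"
    "\<And>y. y \<^bold>\<in> b \<Longrightarrow> \<exists>!x. maps g x y"
    using b(2) unfolding bijection_def function_into_def by blast+
  show ?thesis
  proof (rule small_image[of "\<lambda>d. descr (\<lambda>x. maps g x d)" k b])
    show "definable_term (\<lambda>e. descr (\<lambda>x. maps g x (e 0)))" by (intro definability)
    show "small k b" using b(1) by (rule small_mem)
    fix y assume y: "y \<^bold>\<in> Pow a"
    then have m: "maps g y (app g y)" using maps_app[OF g(1)] by blast
    then have "descr (\<lambda>x. maps g x (app g y)) = y"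
      using g(2,3) by (intro descr_eq) blast+
    with m show "\<exists>d. d \<^bold>\<in> b \<and> y = descr (\<lambda>x. maps g x d)" using g(2) by metis
  qed
qed

text \<open>Each subset of \<open>x\<close> is the image under \<open>f\<close> of its preimage in
  \<open>a\<close>, so \<open>Pow a\<close> covers \<open>Pow x\<close>.\<close>

lemma small_Pow:
  assumes "small k x"
  shows "small k (Pow x)"
proof -
  obtain a f where a: "a \<^bold>\<in> k" and f: "\<And>y. y \<^bold>\<in> x \<Longrightarrow> \<exists>d. d \<^bold>\<in> a \<and> y = app f d"
    using assms unfolding small_def by blast
  let ?h = "\<lambda>s. Coll (\<lambda>y. \<exists>z. z \<^bold>\<in> s \<and> y = app f z)"
  show ?thesis
  proof (rule small_image[of ?h, OF _ small_Pow_ordinal[OF a]])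
    show "definable_term (\<lambda>e. ?h (e 0))" by (intro definability)
    fix s assume s: "s \<^bold>\<in> Pow x"
    let ?t = "Sep a (\<lambda>d. app f d \<^bold>\<in> s)"
    have t: "d \<^bold>\<in> ?t \<longleftrightarrow> d \<^bold>\<in> a \<and> app f d \<^bold>\<in> s" for d
      by (rule mem_Sep) (intro definability)
    have "y \<^bold>\<in> ?h ?t \<longleftrightarrow> (\<exists>z. z \<^bold>\<in> ?t \<and> y = app f z)" for y
      by (rule mem_Coll_bounded[of _ s]) (intro definability, auto simp: t)
    then have "y \<^bold>\<in> ?h ?t \<longleftrightarrow> y \<^bold>\<in> s" for y
      using s f[of y] by (auto simp: t subset_def)
    then have "s = ?h ?t" by (intro set_ext) simp
    moreover have "?t \<^bold>\<in> Pow a" by (simp add: subset_def t)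
    ultimately show "\<exists>t. t \<^bold>\<in> Pow a \<and> s = ?h t" by blast
  qed
qed

text \<open>Kuratowski pairs of elements of \<open>c\<close> lie in \<open>Pow (Pow c)\<close>. Two
  applications of the strong limit property replace the arithmetic of cardinal products.\<close>

lemma small_cart_ordinal:
  assumes "a \<^bold>\<in> k" "b \<^bold>\<in> k"
  shows "small k (cart a b)"
proof -
  have ord: "ordinal a" "ordinal b" using assms ordinal_mem ordinal_inaccessible by blast+
  then have "a \<^bold>\<subseteq> b \<or> b \<^bold>\<subseteq> a" using ordinal_linear[of a b] ordinal_subset by auto
  then obtain c where c: "c \<^bold>\<in> k" "a \<^bold>\<subseteq> c" "b \<^bold>\<subseteq> c" using assms by auto
  have "small k (Pow (Pow c))" by (intro small_Pow small_mem c)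
  then show ?thesis
  proof (rule small_subset)
    show "cart a b \<^bold>\<subseteq> Pow (Pow c)"
      unfolding subset_def mem_cart using c(2,3) by (auto simp: pair_def subset_def)
  qed
qed

lemma small_cart:
  assumes "small k x" "small k y"
  shows "small k (cart x y)"
proof -
  obtain a f where a: "a \<^bold>\<in> k" "\<And>u. u \<^bold>\<in> x \<Longrightarrow> \<exists>d. d \<^bold>\<in> a \<and> u = app f d"
    using assms(1) unfolding small_def by blast
  obtain b g where b: "b \<^bold>\<in> k" "\<And>u. u \<^bold>\<in> y \<Longrightarrow> \<exists>d. d \<^bold>\<in> b \<and> u = app g d"
    using assms(2) unfolding small_def by blast
  let ?h = "\<lambda>p. pair (app f (fst' p)) (app g (snd' p))"
  show ?thesis
  proof (rule small_image[of ?h, OF _ small_cart_ordinal[OF a(1) b(1)]])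
    show "definable_term (\<lambda>e. ?h (e 0))" by (intro definability)
    fix p assume "p \<^bold>\<in> cart x y"
    then obtain u v where "u \<^bold>\<in> x" "v \<^bold>\<in> y" "p = pair u v" unfolding mem_cart by blast
    moreover then obtain c d where "c \<^bold>\<in> a" "d \<^bold>\<in> b" "u = app f c" "v = app g d"
      using a(2) b(2) by blast
    ultimately show "\<exists>z. z \<^bold>\<in> cart a b \<and> p = ?h z"
      by (intro exI[of _ "pair c d"]) (simp add: mem_cart)
  qed
qed

text \<open>Choice fixes an enumeration of each member of \<open>F\<close> by an ordinal below
  \<open>k\<close>; regularity bounds these ordinals by one \<open>b\<close>, and
  \<open>cart a b\<close> then covers the union.\<close>

lemma small_Union:
  assumes "small k F" "\<And>x. x \<^bold>\<in> F \<Longrightarrow> small k x"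
  shows "small k (Union F)"
proof -
  obtain a f where a: "a \<^bold>\<in> k" and f: "\<And>y. y \<^bold>\<in> F \<Longrightarrow> \<exists>d. d \<^bold>\<in> a \<and> y = app f d"
    using assms(1) unfolding small_def by blast
  \<comment> \<open>\<open>f\<close> may take values outside \<open>F\<close>; for those, any
    ordinal below \<open>k\<close> with any \<open>g\<close> is accepted, which makes the relation
    total.\<close>
  let ?R = "\<lambda>d q. \<exists>b g. q = pair b g \<and> b \<^bold>\<in> k \<and>
    (app f d \<^bold>\<in> F \<longrightarrow> (\<forall>y. y \<^bold>\<in> app f d \<longrightarrow> (\<exists>z. z \<^bold>\<in> b \<and> y = app g z)))"
  have dR: "definable (\<lambda>e. ?R (e 0) (e 1))" by (intro definability)
  have ex: "\<exists>q. ?R d q" for d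
  proof (cases "app f d \<^bold>\<in> F")
    case True
    then show ?thesis using assms(2)[OF True] unfolding small_def by blast
  next
    case False
    then show ?thesis using emp_inaccessible by blast
  qed
  obtain c where c: "\<And>d. d \<^bold>\<in> a \<Longrightarrow> ?R d (app c d)"
    using choice_function[of ?R a, OF dR ex] by blast
  have fk: "fst' (app c d) \<^bold>\<in> k" if "d \<^bold>\<in> a" for d using c[OF that] by auto
  have df: "definable_term (\<lambda>e. fst' (app c (e 0)))" by (intro definability)
  obtain b where b: "b \<^bold>\<in> k" "\<And>d. d \<^bold>\<in> a \<Longrightarrow> fst' (app c d) \<^bold>\<in> b"
    using regular_bound[OF a, of "\<lambda>d. fst' (app c d)", OF df fk] by blast
  have ob: "ordinal b" using b(1) ordinal_mem ordinal_inaccessible by blast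
  let ?h = "\<lambda>p. app (snd' (app c (fst' p))) (snd' p)"
  show ?thesis
  proof (rule small_image[of ?h, OF _ small_cart_ordinal[OF a b(1)]])
    show "definable_term (\<lambda>e. ?h (e 0))" by (intro definability)
    fix y assume "y \<^bold>\<in> Union F"
    then obtain d where d: "d \<^bold>\<in> a" "app f d \<^bold>\<in> F" "y \<^bold>\<in> app f d" using f by auto
    obtain b' g where g: "app c d = pair b' g" "app f d \<^bold>\<in> F \<longrightarrow> (\<forall>y. y \<^bold>\<in> app f d \<longrightarrow> (\<exists>z. z \<^bold>\<in> b' \<and> y = app g z))"
      using c[OF d(1)] by blast
    then obtain z where z: "z \<^bold>\<in> b'" "y = app g z" using d by blast
    have "b' \<^bold>\<in> b" using b(2)[OF d(1)] g(1) by simp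
    then have "z \<^bold>\<in> b" using z(1) ob ordinal_trans by blast
    then show "\<exists>p. p \<^bold>\<in> cart a b \<and> y = ?h p"
      using z d g(1) by (intro exI[of _ "pair d z"]) (simp add: mem_cart)
  qed
qed

lemma small_join:
  assumes "small k x" "small k y"
  shows "small k (join x y)"
proof -
  let ?o = "upair emp emp"
  have one: "succ emp = ?o" by (rule set_ext) simp
  have "?o \<noteq> emp" using mem_upair mem_emp by metis
  let ?f = "upair (pair emp x) (pair ?o y)"
  have f: "app ?f emp = x" "app ?f ?o = y" using \<open>?o \<noteq> emp\<close> by (auto intro!: app_eq)
  have "succ (succ emp) \<^bold>\<in> k" by (intro succ_inaccessible emp_inaccessible)
  moreover have "\<exists>d. d \<^bold>\<in> succ (succ emp) \<and> z = app ?f d" if "z \<^bold>\<in> upair x y" for z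
    using that f one by (metis mem_succ mem_upair)
  ultimately have "small k (upair x y)" unfolding small_def by blast
  then have "small k (Union (upair x y))" by (rule small_Union) (use assms in auto)
  then show ?thesis by (rule small_subset) (auto simp: subset_def)
qed

lemma small_V: "a \<^bold>\<in> k \<Longrightarrow> small k (V a)"
proof -
  assume a: "a \<^bold>\<in> k"
  then have "ordinal a" using ordinal_inaccessible ordinal_mem by blast
  then have "a \<^bold>\<in> k \<longrightarrow> small k (V a)"
  proof (rule ordinal_induct[rotated])
    show "definable (\<lambda>e. e 0 \<^bold>\<in> k \<longrightarrow> small k (V (e 0)))" by (intro definability)
    fix a assume o: "ordinal a" and IH: "\<And>b. b \<^bold>\<in> a \<Longrightarrow> b \<^bold>\<in> k \<longrightarrow> small k (V b)"
    show "a \<^bold>\<in> k \<longrightarrow> small k (V a)"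
    proof
      assume a: "a \<^bold>\<in> k"
      let ?F = "img (\<lambda>b. Pow (V b)) a"
      have F: "y \<^bold>\<in> ?F \<longleftrightarrow> (\<exists>b. b \<^bold>\<in> a \<and> y = Pow (V b))" for y
        by (rule mem_img) (intro definability)
      have "small k (Union ?F)"
      proof (rule small_Union)
        show "small k ?F"
        proof (rule small_image[of "\<lambda>b. Pow (V b)" k a])
          show "definable_term (\<lambda>e. Pow (V (e 0)))" by (intro definability)
          show "small k a" using a by (rule small_mem)
        qed (use F in blast)
        fix x assume "x \<^bold>\<in> ?F"
        then show "small k x"
          unfolding F using IH ordinal_trans[OF ordinal_inaccessible a] small_Pow by auto
      qed
      moreover have "V a \<^bold>\<subseteq> Union ?F"
      proof
        fix z assume "z \<^bold>\<in> V a"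
        then obtain b where "b \<^bold>\<in> a" "z \<^bold>\<in> Pow (V b)" using mem_V[OF o] by auto
        then show "z \<^bold>\<in> Union ?F" unfolding mem_Union F by blast
      qed
      ultimately show "small k (V a)" by (rule small_subset)
    qed
  qed
  with a show ?thesis by blast
qed

section \<open>Closure of an inaccessible rank under set operations\<close>

lemma mem_V_inaccessible: "x \<^bold>\<in> V k \<longleftrightarrow> (\<exists>a. a \<^bold>\<in> k \<and> x \<^bold>\<subseteq> V a)"
  by (rule mem_V[OF ordinal_inaccessible])

lemma small_mem_V: "x \<^bold>\<in> V k \<Longrightarrow> small k x"
  unfolding mem_V_inaccessible using small_V small_subset by blast

lemma rank_bound_inaccessible:
  assumes "x \<^bold>\<in> V k"
  shows "rank_bound x \<^bold>\<in> k"
proof -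
  obtain a where a: "a \<^bold>\<in> k" "x \<^bold>\<subseteq> V a" using assms mem_V_inaccessible by blast
  have o: "ordinal a" "ordinal (succ a)"
    using a ordinal_inaccessible ordinal_mem ordinal_succ by blast+
  then have "x \<^bold>\<in> V (succ a)" using a mem_V[OF o(2)] by auto
  then have "rank_bound x \<^bold>\<subseteq> succ a" by (rule rank_bound_least[OF o(2)])
  then have "rank_bound x \<^bold>\<in> succ a \<or> rank_bound x = succ a"
    using ordinal_subset_iff[OF rank_bound(1) o(2)] by simp
  then show ?thesis
    using succ_inaccessible[OF a(1)] ordinal_trans[OF ordinal_inaccessible, of "succ a"] by auto
qed

text \<open>Regularity applied to ranks: fewer than \<open>k\<close> many ranks below
  \<open>k\<close> have a common bound below \<open>k\<close>. All closure properties of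
  \<open>V k\<close> that involve size go through this.\<close>

lemma small_subset_mem_V:
  assumes "small k x" "x \<^bold>\<subseteq> V k"
  shows "x \<^bold>\<in> V k"
proof -
  obtain a f where a: "a \<^bold>\<in> k" and f: "\<And>y. y \<^bold>\<in> x \<Longrightarrow> \<exists>d. d \<^bold>\<in> a \<and> y = app f d"
    using assms(1) unfolding small_def by blast
  \<comment> \<open>A conditional written as a comprehension to keep it definable: the rank bound
    when \<open>app f d\<close> lies in \<open>x\<close>, and \<open>emp\<close> otherwise. Outside
    \<open>x\<close> the rank might not be below \<open>k\<close>.\<close>
  let ?h = "\<lambda>d. Coll (\<lambda>u. app f d \<^bold>\<in> x \<and> u \<^bold>\<in> rank_bound (app f d))"
  have h: "u \<^bold>\<in> ?h d \<longleftrightarrow> app f d \<^bold>\<in> x \<and> u \<^bold>\<in> rank_bound (app f d)" for u d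
    by (rule mem_Coll_bounded[of _ "rank_bound (app f d)"]) (intro definability, blast)
  have h_eq: "?h d = (if app f d \<^bold>\<in> x then rank_bound (app f d) else emp)" for d
    by (rule set_ext) (simp add: h)
  have hk: "?h d \<^bold>\<in> k" for d
    unfolding h_eq using rank_bound_inaccessible emp_inaccessible assms(2) subsetD by auto
  have dh: "definable_term (\<lambda>e. ?h (e 0))" by (intro definability)
  obtain b where b: "b \<^bold>\<in> k" "\<And>d. d \<^bold>\<in> a \<Longrightarrow> ?h d \<^bold>\<in> b"
    using regular_bound[OF a, of ?h, OF dh hk] by blast
  have o: "ordinal b" using b(1) ordinal_inaccessible ordinal_mem by blast
  have "y \<^bold>\<in> V b" if "y \<^bold>\<in> x" for y
  proof -
    obtain d where "d \<^bold>\<in> a" "y = app f d" using f[OF \<open>y \<^bold>\<in> x\<close>] by blast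
    then have "rank_bound y \<^bold>\<in> b" using b(2)[of d] \<open>y \<^bold>\<in> x\<close> by (simp add: h_eq)
    then show ?thesis using rank_bound(2) V_trans_mem[OF o] by blast
  qed
  then show ?thesis unfolding mem_V_inaccessible using b(1) by (auto simp: subset_def)
qed

lemma V_k_trans: "x \<^bold>\<in> V k \<Longrightarrow> y \<^bold>\<in> x \<Longrightarrow> y \<^bold>\<in> V k"
  by (rule V_trans[OF ordinal_inaccessible])

lemma V_k_subset: "x \<^bold>\<in> V k \<Longrightarrow> y \<^bold>\<subseteq> x \<Longrightarrow> y \<^bold>\<in> V k"
  by (rule V_subset_mem[OF ordinal_inaccessible])

lemma Pow_mem_V: "x \<^bold>\<in> V k \<Longrightarrow> Pow x \<^bold>\<in> V k"
  by (rule small_subset_mem_V[OF small_Pow[OF small_mem_V]])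
    (auto simp: subset_def[of "Pow x"] intro: V_k_subset)

lemma upair_mem_V:
  assumes "x \<^bold>\<in> V k" "y \<^bold>\<in> V k"
  shows "upair x y \<^bold>\<in> V k"
proof -
  obtain a b where ab: "a \<^bold>\<in> k" "x \<^bold>\<subseteq> V a" "b \<^bold>\<in> k" "y \<^bold>\<subseteq> V b"
    using assms mem_V_inaccessible by blast
  have ord: "ordinal a" "ordinal b" using ab ordinal_mem ordinal_inaccessible by blast+
  then have "a \<^bold>\<subseteq> b \<or> b \<^bold>\<subseteq> a" using ordinal_linear[of a b] ordinal_subset by auto
  then obtain c where c: "c \<^bold>\<in> k" "V a \<^bold>\<subseteq> V c" "V b \<^bold>\<subseteq> V c"
    using ab ord V_mono by (metis subset_refl)
  have oc: "ordinal (succ c)" using c ordinal_mem ordinal_inaccessible ordinal_succ by blast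
  have "x \<^bold>\<in> V (succ c)" "y \<^bold>\<in> V (succ c)"
    using c ab mem_V[OF oc] subset_trans by (meson mem_succ)+
  then have "upair x y \<^bold>\<subseteq> V (succ c)" by (auto simp: subset_def)
  then show ?thesis using succ_inaccessible[OF c(1)] mem_V_inaccessible by blast
qed

lemma pair_mem_V: "x \<^bold>\<in> V k \<Longrightarrow> y \<^bold>\<in> V k \<Longrightarrow> pair x y \<^bold>\<in> V k"
  unfolding pair_def by (intro upair_mem_V)

lemma cart_mem_V: "x \<^bold>\<in> V k \<Longrightarrow> y \<^bold>\<in> V k \<Longrightarrow> cart x y \<^bold>\<in> V k"
  by (rule small_subset_mem_V[OF small_cart[OF small_mem_V small_mem_V]])
    (auto simp: subset_def mem_cart intro!: pair_mem_V intro: V_k_trans)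

lemma ordinal_mem_V_inaccessible: "a \<^bold>\<in> k \<Longrightarrow> a \<^bold>\<in> V k"
  using ordinal_subset_V[OF ordinal_inaccessible] subsetD by blast

lemma function_mem_V:
  assumes f: "function_on f a" and a: "a \<^bold>\<in> V k" and b: "b \<^bold>\<in> V k" and im: "\<And>x y. maps f x y \<Longrightarrow> y \<^bold>\<in> b"
  shows "f \<^bold>\<in> V k"
proof (rule V_k_subset[OF cart_mem_V[OF a b]])
  show "f \<^bold>\<subseteq> cart a b"
  proof
    fix p assume p: "p \<^bold>\<in> f"
    then obtain x y where xy: "x \<^bold>\<in> a" "p = pair x y"
      using f unfolding function_on_def is_pair_iff by blast
    then have "y \<^bold>\<in> b" using p im unfolding maps_iff by blast
    with xy show "p \<^bold>\<in> cart a b" unfolding mem_cart by blast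
  qed
qed

end

lemma inaccessible_V_mono:
  "inaccessible k \<Longrightarrow> inaccessible l \<Longrightarrow> k = l \<or> k \<^bold>\<in> l \<Longrightarrow> x \<^bold>\<in> V k \<Longrightarrow> x \<^bold>\<in> V l"
  using V_trans_mem[OF ordinal_inaccessible] by blast

lemma V_mem_V_iff:
  assumes "inaccessible k" "inaccessible l"
  shows "V k \<^bold>\<in> V l \<longleftrightarrow> k \<^bold>\<in> l"
proof
  assume kl: "V k \<^bold>\<in> V l"
  have "\<not> V k \<^bold>\<in> V k" by (rule mem_irrefl)
  then have "\<not> (l = k \<or> l \<^bold>\<in> k)"
    using inaccessible_V_mono[OF assms(2,1)] kl by blast
  then show "k \<^bold>\<in> l"
    using ordinal_linear[OF ordinal_inaccessible[OF assms(1)] ordinal_inaccessible[OF assms(2)]]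
    by blast
qed (rule V_mem[OF ordinal_inaccessible[OF assms(2)]])

lemma Vset_inaccessible: "inaccessible k \<Longrightarrow> Vset k = {x. x \<^bold>\<in> V k}"
  by (rule Vset_eq[OF ordinal_inaccessible])

end

section \<open>Inaccessible ranks are $\Sigma_1$-elementary\<close>

text \<open>The formulas for which a hull must supply Skolem witnesses. The guard of a bounded
  quantifier is part of the body.\<close>

primrec bodies :: "fm \<Rightarrow> fm list" where
  "bodies (Member i j) = []"
| "bodies (Equal i j) = []"
| "bodies (Neg \<phi>) = bodies \<phi>"
| "bodies (Conj \<phi> \<psi>) = bodies \<phi> @ bodies \<psi>"
| "bodies (Exists \<phi>) = \<phi> # bodies \<phi>"

lemma bound_bodies: "\<chi> \<in> set (bodies \<phi>) \<Longrightarrow> bound \<chi> \<le> bound \<phi>"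
  by (induction \<phi>) auto

section \<open>Coded valuations, Skolem hulls and collapse\<close>

context ZFC_model begin

text \<open>Valuations are functions of the metatheory and cannot be quantified over in the model.
  The finitely many values a formula can see are coded as nested pairs, with a length that is a
  natural number of the metatheory.\<close>

primrec tuples :: "nat \<Rightarrow> 'v \<Rightarrow> 'v" where
  "tuples 0 y = upair emp emp"
| "tuples (Suc n) y = cart y (tuples n y)"

primrec proj :: "nat \<Rightarrow> 'v \<Rightarrow> 'v" where
  "proj 0 c = fst' c"
| "proj (Suc n) c = proj n (snd' c)"

lemma term_tuples [definability]: "definable_term t \<Longrightarrow> definable_term (\<lambda>e. tuples n (t e))"
  by (induction n) (simp_all, (intro definability)+)

lemma term_proj [definability]: "definable_term t \<Longrightarrow> definable_term (\<lambda>e. proj n (t e))"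
  by (induction n arbitrary: t) (simp_all add: term_fst' term_snd')

lemma tuple_exists:
  "(\<And>n. n < N \<Longrightarrow> e n \<^bold>\<in> y) \<Longrightarrow> \<exists>c. c \<^bold>\<in> tuples N y \<and> (\<forall>n<N. proj n c = e n)"
proof (induction N arbitrary: e)
  case (Suc N)
  obtain c where c: "c \<^bold>\<in> tuples N y" "\<forall>n<N. proj n c = e (Suc n)"
    using Suc.IH[of "\<lambda>n. e (Suc n)"] Suc.prems by auto
  have "proj n (pair (e 0) c) = e n" if "n < Suc N" for n
    using that c(2) by (cases n) auto
  moreover have "pair (e 0) c \<^bold>\<in> tuples (Suc N) y" using c(1) Suc.prems by (auto simp: mem_cart)
  ultimately show ?case by blast
qed (auto intro: exI[of _ emp])

definition holds :: "fm \<Rightarrow> 'v \<Rightarrow> 'v \<Rightarrow> bool" where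
  "holds \<chi> u c \<longleftrightarrow> sat mem UNIV (case_nat u (\<lambda>n. proj n c)) \<chi>"

lemma definable_holds [definability]:
  assumes "definable_term s" "definable_term t"
  shows "definable (\<lambda>e. holds \<chi> (s e) (t e))"
proof -
  have "definable (\<lambda>e. sat mem UNIV (\<lambda>n. (case_nat s (\<lambda>n e. proj n (t e))) n e) \<chi>)"
    by (rule definable_sat) (use assms in \<open>auto intro: term_proj split: nat.split\<close>)
  moreover have "(\<lambda>n. (case_nat s (\<lambda>n e. proj n (t e))) n e) =
      case_nat (s e) (\<lambda>n. proj n (t e))" for e
    by (auto split: nat.split)
  ultimately show ?thesis by (simp add: holds_def)
qed

lemma holds_iff:
  assumes "bound \<chi> \<le> N" "\<forall>n<N. proj n c = e n"
  shows "holds \<chi> u c \<longleftrightarrow> sat mem UNIV (case_nat u e) \<chi>"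
  unfolding holds_def
proof (rule sat_cong)
  fix n assume "n < bound \<chi>"
  then show "case_nat u (\<lambda>n. proj n c) n = case_nat u e n" using assms by (cases n) auto
qed

lemma definable_list_all [definability]:
  assumes "\<And>\<chi>. definable (P \<chi>)"
  shows "definable (\<lambda>e. \<forall>\<chi>\<in>set L. P \<chi> e)"
proof (induction L)
  case Nil
  show ?case by (simp add: definable_const)
next
  case (Cons \<chi> L)
  have "definable (\<lambda>e. P \<chi> e \<and> (\<forall>\<chi>\<in>set L. P \<chi> e))"
    by (rule definable_conj[OF assms Cons.IH])
  then show ?case by simp
qed

text \<open>One round of Skolem closure. Witnesses are sought in a set \<open>t\<close>, so that the
  successive hulls are subsets of a set and choice applies to them.\<close>

definition closing :: "fm list \<Rightarrow> nat \<Rightarrow> 'v \<Rightarrow> 'v \<Rightarrow> 'v \<Rightarrow> bool" where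
  "closing L N t y y' \<longleftrightarrow> (\<forall>\<chi>\<in>set L. \<forall>c. c \<^bold>\<in> tuples N y \<and> (\<exists>u. u \<^bold>\<in> t \<and> holds \<chi> u c) \<longrightarrow>
     (\<exists>u. u \<^bold>\<in> y' \<and> holds \<chi> u c))"

lemma definable_closing [definability]:
  assumes "definable_term r" "definable_term s"
  shows "definable (\<lambda>e. closing L N t (r e) (s e))"
  by (rule definable_bind2[OF _ assms]) (unfold closing_def, intro definability)

context
  fixes k :: 'v
  assumes inacc: "inaccessible k"
begin

lemma small_emp: "small k emp"
  by (rule small_mem[OF emp_inaccessible[OF inacc]])

lemma small_singleton: "small k (upair x x)"
proof (rule small_image[of "\<lambda>_. x" k "succ emp"])
  show "small k (succ emp)"
    by (intro small_mem succ_inaccessible[OF inacc] emp_inaccessible[OF inacc])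
qed (intro definability, auto)

lemma small_tuples: "small k y \<Longrightarrow> small k (tuples n y)"
  by (induction n) (simp_all add: small_singleton small_cart[OF inacc])

lemma finite_set_small:
  "\<exists>x. small k x \<and> (\<forall>y. y \<^bold>\<in> x \<longleftrightarrow> (\<exists>n<N. y = e n))" for N :: nat
proof (induction N)
  case 0
  show ?case using small_emp by (intro exI[of _ emp]) simp
next
  case (Suc N)
  then obtain x where "small k x" "\<forall>y. y \<^bold>\<in> x \<longleftrightarrow> (\<exists>n<N. y = e n)" by blast
  then show ?case
    by (intro exI[of _ "join x (upair (e N) (e N))"])
      (auto intro: small_join[OF inacc] small_singleton simp: less_Suc_eq)
qed

lemma closing_exists:
  assumes y: "small k y" "y \<^bold>\<subseteq> t"
  shows "\<exists>y'. small k y' \<and> y' \<^bold>\<subseteq> t \<and> y \<^bold>\<subseteq> y' \<and> closing L N t y y'"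
proof (induction L)
  case Nil
  show ?case using y by (intro exI[of _ y]) (simp add: closing_def)
next
  case (Cons \<chi> L)
  then obtain y' where y': "small k y'" "y' \<^bold>\<subseteq> t" "y \<^bold>\<subseteq> y'" "closing L N t y y'" by blast
  \<comment> \<open>Made total: for a tuple without witness in \<open>t\<close> any value will do,
    and the later intersection with \<open>t\<close> discards unwanted values.\<close>
  let ?R = "\<lambda>c u. (\<exists>u. u \<^bold>\<in> t \<and> holds \<chi> u c) \<longrightarrow> u \<^bold>\<in> t \<and> holds \<chi> u c"
  have dR: "definable (\<lambda>e. ?R (e 0) (e 1))" by (intro definability)
  have ex: "\<exists>u. ?R c u" for c by blast
  obtain g where g: "\<And>c. c \<^bold>\<in> tuples N y \<Longrightarrow> ?R c (app g c)"
    using choice_function[of ?R "tuples N y", OF dR ex] by blast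
  let ?z = "Coll (\<lambda>u. u \<^bold>\<in> t \<and> (\<exists>c. c \<^bold>\<in> tuples N y \<and> u = app g c))"
  have z: "u \<^bold>\<in> ?z \<longleftrightarrow> u \<^bold>\<in> t \<and> (\<exists>c. c \<^bold>\<in> tuples N y \<and> u = app g c)" for u
    by (rule mem_Coll_bounded[of _ t]) (intro definability, blast)
  have "small k ?z"
  proof (rule small_image[of "app g", OF _ small_tuples[OF y(1)]])
    show "definable_term (\<lambda>e. app g (e 0))" by (intro definability)
  qed (use z in blast)
  moreover have "?z \<^bold>\<subseteq> t" unfolding subset_def z by blast
  moreover have "closing (\<chi> # L) N t y (join y' ?z)"
  proof -
    have "\<exists>u. u \<^bold>\<in> join y' ?z \<and> holds \<chi> u c" if c: "c \<^bold>\<in> tuples N y" "\<exists>u. u \<^bold>\<in> t \<and> holds \<chi> u c" for c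
    proof -
      have "app g c \<^bold>\<in> t" "holds \<chi> (app g c) c" using g[OF c(1)] c(2) by blast+
      then show ?thesis using c(1) z by auto
    qed
    note \<chi>_case = this
    have "\<exists>u. u \<^bold>\<in> join y' ?z \<and> holds \<chi>' u c"
      if "\<chi>' \<in> set L" "c \<^bold>\<in> tuples N y" "\<exists>u. u \<^bold>\<in> t \<and> holds \<chi>' u c" for \<chi>' c
      using y'(4) that unfolding closing_def mem_join by blast
    with \<chi>_case show ?thesis unfolding closing_def set_simps by blast
  qed
  ultimately show ?case using y' small_join[OF inacc]
    by (intro exI[of _ "join y' ?z"]) (auto simp: subset_def)
qed

text \<open>Closure rounds are iterated along a limit ordinal below \<open>k\<close>, so regularity
  keeps the union small. Finitely many parameters from the union already occur at one stage, and the
  next stage contains the witness.\<close>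

lemma hull_exists:
  assumes A: "small k A" "A \<^bold>\<subseteq> t" and L: "\<And>\<chi>. \<chi> \<in> set L \<Longrightarrow> bound \<chi> \<le> N"
  obtains x where "A \<^bold>\<subseteq> x" "x \<^bold>\<subseteq> t" "small k x"
    "\<And>\<chi> e u. \<chi> \<in> set L \<Longrightarrow> (\<forall>n<N. e n \<^bold>\<in> x) \<Longrightarrow> u \<^bold>\<in> t \<Longrightarrow> sat mem UNIV (case_nat u e) \<chi> \<Longrightarrow>
      \<exists>u. u \<^bold>\<in> x \<and> sat mem UNIV (case_nat u e) \<chi>"
proof -
  obtain w where w: "limit_ordinal w" "w \<^bold>\<in> k" using omega_inaccessible[OF inacc] by blast
  have wo: "ordinal w" using w(1) by (simp add: limit_ordinal_def)
  have wk: "n \<^bold>\<in> k" if "n \<^bold>\<in> w" for n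
    using that w(2) ordinal_trans[OF ordinal_inaccessible[OF inacc]] by blast
  let ?S = "\<lambda>y. small k y \<and> y \<^bold>\<subseteq> t"
  let ?R = "\<lambda>y y'. ?S y' \<and> y \<^bold>\<subseteq> y' \<and> closing L N t y y'"
  \<comment> \<open>The small subsets of \<open>t\<close> form a set, so one choice function
    performs a closure round for all of them.\<close>
  let ?s = "Sep (Pow t) (small k)"
  have s: "y \<^bold>\<in> ?s \<longleftrightarrow> ?S y" for y
    using mem_Sep[of "small k" y "Pow t"] definable_small[OF term_const term_var] by auto
  have dR: "definable (\<lambda>e. ?R (e 0) (e 1))" by (intro definability)
  have ex: "\<exists>y'. ?R y y'" if "y \<^bold>\<in> ?s" for y
    using closing_exists[of y t L N] that unfolding s by blast
  obtain h where "\<And>y. y \<^bold>\<in> ?s \<Longrightarrow> ?R y (app h y)"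
    using choice_function[of ?R ?s, OF dR ex] by blast
  then have h: "\<And>y. ?S y \<Longrightarrow> ?R y (app h y)" unfolding s by blast
  define H where "H n p = join A (Coll (\<lambda>u. \<exists>m. m \<^bold>\<in> n \<and> u \<^bold>\<in> app h (app p m)))" for n p
  have H: "u \<^bold>\<in> H n p \<longleftrightarrow> u \<^bold>\<in> A \<or> (\<exists>m. m \<^bold>\<in> n \<and> u \<^bold>\<in> app h (app p m))" for u n p
  proof -
    have mem: "y \<^bold>\<in> img (\<lambda>m. app h (app p m)) n \<longleftrightarrow> (\<exists>m. m \<^bold>\<in> n \<and> y = app h (app p m))" for y
      by (rule mem_img) (intro definability)
    have "u \<^bold>\<in> Coll (\<lambda>u. \<exists>m. m \<^bold>\<in> n \<and> u \<^bold>\<in> app h (app p m)) \<longleftrightarrow> (\<exists>m. m \<^bold>\<in> n \<and> u \<^bold>\<in> app h (app p m))"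
    proof (rule mem_Coll_bounded)
      fix u assume "\<exists>m. m \<^bold>\<in> n \<and> u \<^bold>\<in> app h (app p m)"
      then show "u \<^bold>\<in> Union (img (\<lambda>m. app h (app p m)) n)" unfolding mem_Union mem by blast
    qed (intro definability)
    then show ?thesis by (simp add: H_def)
  qed
  obtain f where "function_on f w" and f: "\<And>n. n \<^bold>\<in> w \<Longrightarrow> app f n = H n f"
  proof (rule mem_recursion[of H w])
    show "definable_term (\<lambda>e. H (e 0) (e 1))" unfolding H_def by (intro definability)
    fix n p q assume "n \<^bold>\<in> w" "\<And>m. m \<^bold>\<in> w \<Longrightarrow> m \<^bold>\<in> n \<Longrightarrow> app p m = app q m"
    then have "app p m = app q m" if "m \<^bold>\<in> n" for m
      using ordinal_trans[OF wo] that by blast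
    then show "H n p = H n q" by (intro set_ext) (simp add: H cong: conj_cong)
  qed (rule that)
  have S: "?S (app f n)" if "n \<^bold>\<in> w" for n
  proof -
    have "ordinal n" using that wo ordinal_mem by blast
    then have "n \<^bold>\<in> w \<longrightarrow> ?S (app f n)"
    proof (rule ordinal_induct[rotated])
      show "definable (\<lambda>e. e 0 \<^bold>\<in> w \<longrightarrow> ?S (app f (e 0)))" by (intro definability)
      fix n assume IH: "\<And>m. m \<^bold>\<in> n \<Longrightarrow> m \<^bold>\<in> w \<longrightarrow> ?S (app f m)"
      show "n \<^bold>\<in> w \<longrightarrow> ?S (app f n)"
      proof
        assume n: "n \<^bold>\<in> w"
        have hm: "?S (app h (app f m))" if "m \<^bold>\<in> n" for m
          using IH[OF that] ordinal_trans[OF wo n that] h by blast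
        let ?F = "img (\<lambda>m. app h (app f m)) n"
        have F: "y \<^bold>\<in> ?F \<longleftrightarrow> (\<exists>m. m \<^bold>\<in> n \<and> y = app h (app f m))" for y
          by (rule mem_img) (intro definability)
        have "small k ?F"
        proof (rule small_image[of "\<lambda>m. app h (app f m)", OF _ small_mem[OF wk[OF n]]])
          show "definable_term (\<lambda>e. app h (app f (e 0)))" by (intro definability)
        qed (use F in blast)
        then have "small k (Union ?F)"
        proof (rule small_Union[OF inacc])
          fix y assume "y \<^bold>\<in> ?F"
          then obtain m where "m \<^bold>\<in> n" "y = app h (app f m)" unfolding F by blast
          with hm show "small k y" by blast
        qed
        then have "small k (join A (Union ?F))" by (rule small_join[OF inacc A(1)])
        moreover have "app f n \<^bold>\<subseteq> join A (Union ?F)"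
          unfolding subset_def f[OF n] H mem_join mem_Union F by blast
        moreover have "app f n \<^bold>\<subseteq> t"
          unfolding subset_def f[OF n] H using A(2) hm by (auto dest: subsetD)
        ultimately show "?S (app f n)" using small_subset by blast
      qed
    qed
    with that show ?thesis by blast
  qed
  have h_sub: "app h (app f m) \<^bold>\<subseteq> app f n" if "m \<^bold>\<in> n" "n \<^bold>\<in> w" for m n
    unfolding subset_def f[OF that(2)] H using that(1) by blast
  have mono: "app f m \<^bold>\<subseteq> app f n" if "m \<^bold>\<in> n" "n \<^bold>\<in> w" for m n
    using h_sub[OF that] h[OF S] ordinal_trans[OF wo that(2,1)] subset_trans by blast
  let ?x = "Union (img (app f) w)"
  have img: "y \<^bold>\<in> img (app f) w \<longleftrightarrow> (\<exists>n. n \<^bold>\<in> w \<and> y = app f n)" for y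
    by (rule mem_img) (intro definability)
  have x: "u \<^bold>\<in> ?x \<longleftrightarrow> (\<exists>n. n \<^bold>\<in> w \<and> u \<^bold>\<in> app f n)" for u
    unfolding mem_Union img by blast
  show ?thesis
  proof (rule that)
    show "A \<^bold>\<subseteq> ?x"
      unfolding subset_def x using f[OF limit_emp[OF w(1)]] limit_emp[OF w(1)] H by auto
    show "?x \<^bold>\<subseteq> t" unfolding subset_def x using S by (blast dest: subsetD)
    have "small k (img (app f) w)"
    proof (rule small_image[of "app f", OF _ small_mem[OF w(2)]])
      show "definable_term (\<lambda>e. app f (e 0))" by (intro definability)
    qed (use img in blast)
    then show "small k ?x"
    proof (rule small_Union[OF inacc])
      fix y assume "y \<^bold>\<in> img (app f) w"
      then obtain n where "n \<^bold>\<in> w" "y = app f n" unfolding img by blast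
      with S show "small k y" by blast
    qed
    fix \<chi> e u
    assume \<chi>: "\<chi> \<in> set L" and e: "\<forall>n<N. e n \<^bold>\<in> ?x" and u: "u \<^bold>\<in> t" "sat mem UNIV (case_nat u e) \<chi>"
    \<comment> \<open>The stages increase, so finitely many parameters lie in a common one; the
      induction is over the length in the metatheory.\<close>
    have "\<exists>m. m \<^bold>\<in> w \<and> (\<forall>n<M. e n \<^bold>\<in> app f m)" if "M \<le> N" for M
      using that
    proof (induction M)
      case 0
      show ?case using limit_emp[OF w(1)] by auto
    next
      case (Suc M)
      then obtain m where m: "m \<^bold>\<in> w" "\<forall>n<M. e n \<^bold>\<in> app f m" by auto
      obtain m' where m': "m' \<^bold>\<in> w" "e M \<^bold>\<in> app f m'" using e Suc.prems x[of "e M"] by auto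
      have "m \<^bold>\<in> m' \<or> m = m' \<or> m' \<^bold>\<in> m"
        using m(1) m'(1) wo ordinal_linear ordinal_mem by blast
      then show ?case
        using m m' mono[of m m'] mono[of m' m] unfolding less_Suc_eq by (metis subsetD)
    qed
    then obtain m where m: "m \<^bold>\<in> w" "\<forall>n<N. e n \<^bold>\<in> app f m" by blast
    obtain c where c: "c \<^bold>\<in> tuples N (app f m)" "\<forall>n<N. proj n c = e n"
      using tuple_exists[of N e "app f m"] m(2) by blast
    have hi: "holds \<chi> u c \<longleftrightarrow> sat mem UNIV (case_nat u e) \<chi>" for u
      by (rule holds_iff[OF L[OF \<chi>] c(2)])
    have "closing L N t (app f m) (app h (app f m))" using h[OF S[OF m(1)]] by blast
    then obtain v where v: "v \<^bold>\<in> app h (app f m)" "holds \<chi> v c"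
      using c(1) \<chi> u unfolding closing_def hi[symmetric] by blast
    have "v \<^bold>\<in> app f (succ m)"
      using h_sub[of m "succ m"] limit_succ[OF w(1) m(1)] v(1) by (auto dest: subsetD)
    then show "\<exists>u. u \<^bold>\<in> ?x \<and> sat mem UNIV (case_nat u e) \<chi>"
      using limit_succ[OF w(1) m(1)] v(2) x hi by blast
  qed
qed

text \<open>Mostowski collapse. A least failure of injectivity contradicts extensionality of
  \<open>x\<close>; a least \<open>y\<close> with value outside \<open>V k\<close> would collapse to
  a small subset of \<open>V k\<close>. Transitive parts of \<open>x\<close> are not moved, which is
  what preserves parameters.\<close>

lemma collapse_exists:
  assumes x: "small k x"
    and ext: "\<And>y z. y \<^bold>\<in> x \<Longrightarrow> z \<^bold>\<in> x \<Longrightarrow> y \<noteq> z \<Longrightarrow> \<exists>u. u \<^bold>\<in> x \<and> (u \<^bold>\<in> y \<longleftrightarrow> \<not> u \<^bold>\<in> z)"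
  obtains f where
    "\<And>y z. y \<^bold>\<in> x \<Longrightarrow> z \<^bold>\<in> x \<Longrightarrow> f y = f z \<longleftrightarrow> y = z"
    "\<And>y v. y \<^bold>\<in> x \<Longrightarrow> v \<^bold>\<in> f y \<longleftrightarrow> (\<exists>u. u \<^bold>\<in> x \<and> u \<^bold>\<in> y \<and> v = f u)"
    "\<And>y. y \<^bold>\<in> x \<Longrightarrow> f y \<^bold>\<in> V k"
    "\<And>A y. transitive_set A \<Longrightarrow> A \<^bold>\<subseteq> x \<Longrightarrow> y \<^bold>\<in> A \<Longrightarrow> f y = y"
proof -
  define H where "H y p = Coll (\<lambda>v. \<exists>u. u \<^bold>\<in> x \<and> u \<^bold>\<in> y \<and> v = app p u)" for y p
  have H: "v \<^bold>\<in> H y p \<longleftrightarrow> (\<exists>u. u \<^bold>\<in> x \<and> u \<^bold>\<in> y \<and> v = app p u)" for v y p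
    unfolding H_def
  proof (rule mem_Coll_bounded)
    have mem: "v \<^bold>\<in> img (app p) x \<longleftrightarrow> (\<exists>u. u \<^bold>\<in> x \<and> v = app p u)" for v
      by (rule mem_img) (intro definability)
    fix v assume "\<exists>u. u \<^bold>\<in> x \<and> u \<^bold>\<in> y \<and> v = app p u"
    then show "v \<^bold>\<in> img (app p) x" unfolding mem by blast
  qed (intro definability)
  obtain g where "function_on g x" and g: "\<And>y. y \<^bold>\<in> x \<Longrightarrow> app g y = H y g"
  proof (rule mem_recursion[of H x])
    show "definable_term (\<lambda>e. H (e 0) (e 1))" unfolding H_def by (intro definability)
    fix y p q assume "\<And>u. u \<^bold>\<in> x \<Longrightarrow> u \<^bold>\<in> y \<Longrightarrow> app p u = app q u"
    then show "H y p = H y q" by (intro set_ext) (simp add: H cong: conj_cong)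
  qed (rule that)
  let ?f = "app g"
  have f: "v \<^bold>\<in> ?f y \<longleftrightarrow> (\<exists>u. u \<^bold>\<in> x \<and> u \<^bold>\<in> y \<and> v = ?f u)" if "y \<^bold>\<in> x" for y v
    unfolding g[OF that] H ..
  have inj: "y = z" if yz: "y \<^bold>\<in> x" "z \<^bold>\<in> x" "?f y = ?f z" for y z
  proof (rule ccontr)
    let ?P = "\<lambda>y. \<exists>z. z \<^bold>\<in> x \<and> ?f y = ?f z \<and> y \<noteq> z"
    have dP: "definable (\<lambda>e. ?P (e 0))" by (intro definability)
    assume "y \<noteq> z"
    then have "?P y" using yz by blast
    then obtain y where y: "y \<^bold>\<in> x" "?P y" "\<And>u. u \<^bold>\<in> y \<Longrightarrow> u \<^bold>\<in> x \<Longrightarrow> \<not> ?P u"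
      using minimal_element[of ?P, OF dP yz(1)] by blast
    then obtain z where z: "z \<^bold>\<in> x" "?f y = ?f z" "y \<noteq> z" by blast
    obtain u where u: "u \<^bold>\<in> x" "u \<^bold>\<in> y \<longleftrightarrow> \<not> u \<^bold>\<in> z" using ext[OF y(1) z(1,3)] by blast
    show False
    proof (cases "u \<^bold>\<in> y")
      case True
      then have "?f u \<^bold>\<in> ?f z" using f[OF y(1)] u(1) z(2) by auto
      then obtain u' where "u' \<^bold>\<in> x" "u' \<^bold>\<in> z" "?f u = ?f u'" using f[OF z(1)] by blast
      then show False using y(3)[OF True u(1)] u(2) True by blast
    next
      case False
      then have "?f u \<^bold>\<in> ?f y" using f[OF z(1)] u z(2) by auto
      then obtain u' where "u' \<^bold>\<in> x" "u' \<^bold>\<in> y" "?f u = ?f u'" using f[OF y(1)] by blast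
      then show False using y(3)[of u'] u(1) False by metis
    qed
  qed
  have in_V: "?f y \<^bold>\<in> V k" if y: "y \<^bold>\<in> x" for y
  proof (rule ccontr)
    have dP: "definable (\<lambda>e. \<not> ?f (e 0) \<^bold>\<in> V k)" by (intro definability)
    assume "\<not> ?f y \<^bold>\<in> V k"
    then obtain z where z: "z \<^bold>\<in> x" "\<not> ?f z \<^bold>\<in> V k" "\<And>u. u \<^bold>\<in> z \<Longrightarrow> u \<^bold>\<in> x \<Longrightarrow> \<not> \<not> ?f u \<^bold>\<in> V k"
      using minimal_element[of "\<lambda>y. \<not> ?f y \<^bold>\<in> V k", OF dP y] by blast
    have "small k (?f z)"
    proof (rule small_image[of ?f, OF _ x])
      show "definable_term (\<lambda>e. ?f (e 0))" by (intro definability)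
    qed (use f[OF z(1)] in blast)
    moreover have "?f z \<^bold>\<subseteq> V k" unfolding subset_def f[OF z(1)] using z(3) by blast
    ultimately show False using z(2) small_subset_mem_V[OF inacc] by blast
  qed
  have fix_A: "?f y = y" if A: "transitive_set A" "A \<^bold>\<subseteq> x" "y \<^bold>\<in> A" for A y
  proof (rule ccontr)
    have dP: "definable (\<lambda>e. ?f (e 0) \<noteq> e 0)" by (intro definability)
    assume "?f y \<noteq> y"
    then obtain z where z: "z \<^bold>\<in> A" "?f z \<noteq> z" "\<And>u. u \<^bold>\<in> z \<Longrightarrow> u \<^bold>\<in> A \<Longrightarrow> \<not> ?f u \<noteq> u"
      using minimal_element[of "\<lambda>y. ?f y \<noteq> y", OF dP A(3)] by blast
    have zx: "z \<^bold>\<in> x" using z(1) A(2) by (rule subsetD[rotated])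
    have "?f u = u \<and> u \<^bold>\<in> x" if "u \<^bold>\<in> z" for u
      using z(3)[OF that] transitive_setD[OF A(1) z(1) that] subsetD[OF A(2)] by blast
    then have "v \<^bold>\<in> ?f z \<longleftrightarrow> v \<^bold>\<in> z" for v unfolding f[OF zx] by metis
    then have "?f z = z" by (rule set_ext)
    with z(2) show False ..
  qed
  show ?thesis by (rule that[of ?f]) (use inj f in_V fix_A in blast)+
qed

text \<open>A small hull containing \<open>A\<close> and the relevant values of \<open>e\<close> is
  taken inside a rank and collapsed into \<open>V k\<close>. Since \<open>\<delta>\<close> is
  bounded and the rank is transitive, its quantifiers never look outside that rank, and values in
  \<open>A\<close> stay fixed.\<close>

lemma Delta0_reflect:
  assumes \<delta>: "is_Delta0 \<delta>" and A: "A \<^bold>\<in> V k" "transitive_set A"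
  obtains e' where "range e' \<subseteq> {x. x \<^bold>\<in> V k}" "\<And>n. n < bound \<delta> \<Longrightarrow> e n \<^bold>\<in> A \<Longrightarrow> e' n = e n"
    "sat mem UNIV e' \<delta> \<longleftrightarrow> sat mem UNIV e \<delta>"
proof -
  \<comment> \<open>Closing the hull under witnesses for membership in one set but not in another
    makes it extensional, as the collapse requires.\<close>
  define ext where "ext = Conj (Member 0 1) (Neg (Member 0 2))"
  define L where "L = ext # bodies \<delta>"
  \<comment> \<open>The 3 is the bound of \<open>ext\<close>.\<close>
  define N where "N = max 3 (bound \<delta>)"
  have LN: "bound \<chi> \<le> N" if "\<chi> \<in> set L" for \<chi>
    using that bound_bodies[of \<chi> \<delta>] by (auto simp: L_def N_def ext_def)
  obtain x0 where x0: "small k x0" "\<And>y. y \<^bold>\<in> x0 \<longleftrightarrow> (\<exists>n<N. y = e n)"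
    using finite_set_small[of N e] by blast
  let ?A = "join A x0"
  have sA: "small k ?A" by (intro small_join[OF inacc] small_mem_V[OF inacc] A x0)
  let ?t = "V (rank_bound ?A)"
  have t_trans: "v \<^bold>\<in> ?t" if "u \<^bold>\<in> ?t" "v \<^bold>\<in> u" for u v
    using V_trans[OF rank_bound(1)] that by blast
  have tA: "?A \<^bold>\<subseteq> ?t" unfolding subset_def using t_trans rank_bound(2) by blast
  obtain x where x: "?A \<^bold>\<subseteq> x" "x \<^bold>\<subseteq> ?t" "small k x"
    and hull: "\<And>\<chi> e u. \<chi> \<in> set L \<Longrightarrow> (\<forall>n<N. e n \<^bold>\<in> x) \<Longrightarrow> u \<^bold>\<in> ?t \<Longrightarrow>
      sat mem UNIV (case_nat u e) \<chi> \<Longrightarrow> \<exists>u. u \<^bold>\<in> x \<and> sat mem UNIV (case_nat u e) \<chi>"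
    using hull_exists[of ?A ?t L N, OF sA tA LN] by blast
  have half: "\<exists>u. u \<^bold>\<in> x \<and> u \<^bold>\<in> y \<and> \<not> u \<^bold>\<in> z" if yz: "y \<^bold>\<in> x" "z \<^bold>\<in> x" "u \<^bold>\<in> y" "\<not> u \<^bold>\<in> z" for y z u
  proof -
    have "u \<^bold>\<in> ?t" using yz(1,3) x(2) t_trans subsetD by blast
    moreover have "sat mem UNIV (case_nat u (case_nat y (\<lambda>_. z))) ext"
      using yz by (simp add: ext_def numeral_2_eq_2)
    moreover have "\<forall>n<N. case_nat y (\<lambda>_. z) n \<^bold>\<in> x" using yz by (simp split: nat.split)
    moreover have "ext \<in> set L" by (simp add: L_def)
    ultimately obtain v where "v \<^bold>\<in> x" "sat mem UNIV (case_nat v (case_nat y (\<lambda>_. z))) ext"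
      using hull by blast
    then show ?thesis by (auto simp: ext_def numeral_2_eq_2)
  qed
  have ext_x: "\<exists>u. u \<^bold>\<in> x \<and> (u \<^bold>\<in> y \<longleftrightarrow> \<not> u \<^bold>\<in> z)" if yz: "y \<^bold>\<in> x" "z \<^bold>\<in> x" "y \<noteq> z" for y z
  proof -
    obtain u where "u \<^bold>\<in> y \<longleftrightarrow> \<not> u \<^bold>\<in> z" using yz(3) set_ext by blast
    then show ?thesis using half[of y z u] half[of z y u] yz(1,2) by blast
  qed
  obtain f where inj: "\<And>y z. y \<^bold>\<in> x \<Longrightarrow> z \<^bold>\<in> x \<Longrightarrow> f y = f z \<longleftrightarrow> y = z"
    and f: "\<And>y v. y \<^bold>\<in> x \<Longrightarrow> v \<^bold>\<in> f y \<longleftrightarrow> (\<exists>u. u \<^bold>\<in> x \<and> u \<^bold>\<in> y \<and> v = f u)"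
    and fV: "\<And>y. y \<^bold>\<in> x \<Longrightarrow> f y \<^bold>\<in> V k"
    and fixed: "\<And>A y. transitive_set A \<Longrightarrow> A \<^bold>\<subseteq> x \<Longrightarrow> y \<^bold>\<in> A \<Longrightarrow> f y = y"
    using collapse_exists[of x, OF x(3) ext_x] by blast
  have transfer: "sat mem UNIV (\<lambda>n. f (e n)) \<chi> \<longleftrightarrow> sat mem UNIV e \<chi>"
    if "is_Delta0 \<chi>" "bound \<chi> \<le> N" "set (bodies \<chi>) \<subseteq> set L" "\<forall>n<N. e n \<^bold>\<in> x" for \<chi> e
    using that
  proof (induction \<chi> arbitrary: e rule: is_Delta0.induct)
    case (1 i j)
    then have "e i \<^bold>\<in> x" "e j \<^bold>\<in> x" by auto
    then have "f (e i) \<^bold>\<in> f (e j) \<longleftrightarrow> e i \<^bold>\<in> e j" using f inj by metis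
    then show ?case by simp
  next
    case (2 i j)
    then show ?case using inj by auto
  next
    case (5 \<chi> i)
    have ix: "e i \<^bold>\<in> x" using 5 by auto
    have IH: "sat mem UNIV (case_nat (f u) (\<lambda>n. f (e n))) \<chi> \<longleftrightarrow> sat mem UNIV (case_nat u e) \<chi>"
      if u: "u \<^bold>\<in> x" for u
    proof -
      have "\<forall>n<N. case_nat u e n \<^bold>\<in> x" using u 5 by (auto split: nat.split)
      moreover have "(\<lambda>n. f (case_nat u e n)) = case_nat (f u) (\<lambda>n. f (e n))"
        by (auto split: nat.split)
      ultimately show ?thesis using 5(2)[of "case_nat u e"] 5(3,4) by simp
    qed
    \<comment> \<open>Because the guard belongs to the listed body, the witness supplied by the hull
      lies in \<open>e i\<close> again.\<close>
    let ?b = "Conj (Member 0 (Suc i)) \<chi>"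
    have bL: "?b \<in> set L" using 5 by simp
    show ?case
    proof
      assume "sat mem UNIV (\<lambda>n. f (e n)) (Exists ?b)"
      then obtain v where v: "v \<^bold>\<in> f (e i)" "sat mem UNIV (case_nat v (\<lambda>n. f (e n))) \<chi>" by auto
      then obtain u where "u \<^bold>\<in> x" "u \<^bold>\<in> e i" "v = f u" using f[OF ix] by blast
      then show "sat mem UNIV e (Exists ?b)" using v(2) IH by auto
    next
      assume "sat mem UNIV e (Exists ?b)"
      then obtain u where u: "u \<^bold>\<in> e i" "sat mem UNIV (case_nat u e) ?b" by auto
      have "u \<^bold>\<in> ?t" using u(1) ix x(2) t_trans subsetD by blast
      then obtain v where "v \<^bold>\<in> x" "sat mem UNIV (case_nat v e) ?b"
        using hull[OF bL _ _ u(2)] 5 by blast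
      then have v: "v \<^bold>\<in> x" "v \<^bold>\<in> e i" "sat mem UNIV (case_nat v e) \<chi>" by auto
      then have "f v \<^bold>\<in> f (e i)" using f[OF ix] by blast
      then show "sat mem UNIV (\<lambda>n. f (e n)) (Exists ?b)" using IH[OF v(1)] v(3) by auto
    qed
  qed auto
  have ex: "e n \<^bold>\<in> x" if "n < N" for n using that x0 x(1) by (auto simp: subset_def)
  \<comment> \<open>Indices from \<open>N\<close> on do not matter for \<open>\<delta>\<close>;
    \<open>emp\<close> keeps the range inside \<open>V k\<close>.\<close>
  define e' where "e' n = (if n < N then f (e n) else emp)" for n
  have b: "bound \<delta> \<le> N" by (simp add: N_def)
  show ?thesis
  proof (rule that)
    show "range e' \<subseteq> {x. x \<^bold>\<in> V k}"
      using fV ex ordinal_mem_V_inaccessible[OF inacc emp_inaccessible[OF inacc]]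
      by (auto simp: e'_def)
    have "A \<^bold>\<subseteq> x" using x(1) by (auto simp: subset_def)
    then show "e' n = e n" if "n < bound \<delta>" "e n \<^bold>\<in> A" for n
      using fixed[OF A(2)] that b by (simp add: e'_def)
    have "sat mem UNIV e' \<delta> \<longleftrightarrow> sat mem UNIV (\<lambda>n. f (e n)) \<delta>"
      using b by (intro sat_cong) (simp add: e'_def)
    also have "\<dots> \<longleftrightarrow> sat mem UNIV e \<delta>"
      using transfer[OF \<delta> b] ex by (auto simp: L_def)
    finally show "sat mem UNIV e' \<delta> \<longleftrightarrow> sat mem UNIV e \<delta>" .
  qed
qed

lemma Delta0_absolute_V:
  "is_Delta0 \<phi> \<Longrightarrow> range e \<subseteq> {x. x \<^bold>\<in> V k} \<Longrightarrow> sat mem {x. x \<^bold>\<in> V k} e \<phi> \<longleftrightarrow> sat mem UNIV e \<phi>"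
  by (rule Delta0_absolute) (auto intro: V_k_trans[OF inacc])

text \<open>Upwards this is absoluteness of bounded formulas. Downwards, arbitrary witnesses in the
  universe are collapsed into \<open>V k\<close> while the parameters remain fixed.\<close>

theorem Sigma1_elementary_V:
  assumes \<phi>: "is_Sigma 1 \<phi>" and e: "range e \<subseteq> {x. x \<^bold>\<in> V k}"
  shows "sat mem {x. x \<^bold>\<in> V k} e \<phi> \<longleftrightarrow> sat mem UNIV e \<phi>"
proof -
  let ?U = "{x. x \<^bold>\<in> V k}"
  obtain m \<delta> where \<delta>: "is_Delta0 \<delta>" and block: "\<And>U e. sat mem U e \<phi> \<longleftrightarrow>
      (\<exists>zs. length zs = m \<and> set zs \<subseteq> U \<and> sat mem U (prepend zs e) \<delta>)"
    using Sigma_block[where n = 0 and \<phi> = \<phi> and E = mem] \<phi> by (simp, blast)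
  show ?thesis
  proof
    assume "sat mem ?U e \<phi>"
    then obtain zs where "length zs = m" "set zs \<subseteq> ?U" "sat mem ?U (prepend zs e) \<delta>"
      unfolding block by blast
    then have "sat mem UNIV (prepend zs e) \<delta>" using Delta0_absolute_V[OF \<delta>] e by simp
    then show "sat mem UNIV e \<phi>" using block[of UNIV e] \<open>length zs = m\<close> by auto
  next
    assume "sat mem UNIV e \<phi>"
    then obtain zs where zs: "length zs = m" "sat mem UNIV (prepend zs e) \<delta>"
      unfolding block by blast
    \<comment> \<open>The range of \<open>e\<close> may be unbounded in \<open>V k\<close>. Only the
      finitely many values that \<open>\<delta>\<close> can see are collected, and these lie in one
      \<open>V a\<close> with \<open>a\<close> below \<open>k\<close>.\<close>
    obtain x where x: "small k x" "\<And>y. y \<^bold>\<in> x \<longleftrightarrow> (\<exists>n<bound \<delta>. y = e n)"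
      using finite_set_small[of "bound \<delta>" e] by blast
    have "x \<^bold>\<in> V k" by (rule small_subset_mem_V[OF inacc x(1)]) (use e x(2) in \<open>auto simp: subset_def\<close>)
    then obtain a where a: "a \<^bold>\<in> k" "x \<^bold>\<subseteq> V a" using mem_V_inaccessible[OF inacc] by blast
    have oa: "ordinal a" using a(1) ordinal_inaccessible[OF inacc] ordinal_mem by blast
    have "V a \<^bold>\<in> V k" using V_mem[OF ordinal_inaccessible[OF inacc] a(1)] .
    moreover have "transitive_set (V a)"
      unfolding transitive_set_def subset_def using V_trans[OF oa] by blast
    ultimately obtain e' where e': "range e' \<subseteq> ?U"
      "\<And>n. n < bound \<delta> \<Longrightarrow> prepend zs e n \<^bold>\<in> V a \<Longrightarrow> e' n = prepend zs e n"
      "sat mem UNIV e' \<delta> \<longleftrightarrow> sat mem UNIV (prepend zs e) \<delta>"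
      using Delta0_reflect[OF \<delta>, of "V a" "prepend zs e"] by blast
    let ?zs = "map e' [0..<m]"
    have "sat mem UNIV (prepend ?zs e) \<delta> \<longleftrightarrow> sat mem UNIV e' \<delta>"
    proof (rule sat_cong)
      fix n assume n: "n < bound \<delta>"
      show "prepend ?zs e n = e' n"
      proof (cases "n < m")
        case True
        then show ?thesis using prepend_less[of n ?zs e] by simp
      next
        case False
        then obtain j where j: "n = m + j" using le_Suc_ex not_less by blast
        then have ej: "prepend zs e n = e j" "prepend ?zs e n = e j"
          using prepend_ge[of zs e j] prepend_ge[of ?zs e j] zs(1) by simp_all
        have "e j \<^bold>\<in> x" unfolding x(2) using n j by (intro exI[of _ j]) simp
        then have "e j \<^bold>\<in> V a" using a(2) subsetD by blast
        then show ?thesis using e'(2)[OF n] ej by simp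
      qed
    qed
    then have "sat mem UNIV (prepend ?zs e) \<delta>" using e'(3) zs(2) by simp
    moreover have "set ?zs \<subseteq> ?U" using e'(1) by auto
    ultimately have "sat mem ?U (prepend ?zs e) \<delta>" using Delta0_absolute_V[OF \<delta>] e by simp
    then show "sat mem ?U e \<phi>"
      unfolding block using \<open>set ?zs \<subseteq> ?U\<close> by (intro exI[of _ ?zs]) simp
  qed
qed

end

end

section \<open>Inaccessibility as a $\Pi_1$ property\<close>

context set_structure begin

text \<open>Parameter-free, in contrast to \<open>definable\<close>: the resulting formula is
  evaluated in different worlds, and its place in the hierarchy matters.\<close>

definition Delta0_pred :: "((nat \<Rightarrow> 'v) \<Rightarrow> bool) \<Rightarrow> bool" where
  "Delta0_pred P \<longleftrightarrow> (\<exists>\<phi>. is_Delta0 \<phi> \<and> (\<forall>e. P e \<longleftrightarrow> sat mem UNIV e \<phi>))"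

text \<open>The double union of \<open>f\<close>. It contains both coordinates of every Kuratowski
  pair in \<open>f\<close>, so quantifiers over arguments and values become bounded.\<close>

definition field :: "'v \<Rightarrow> 'v \<Rightarrow> bool" where
  "field f x \<longleftrightarrow> (\<exists>p. p \<^bold>\<in> f \<and> (\<exists>b. b \<^bold>\<in> p \<and> x \<^bold>\<in> b))"

lemma Delta0_pred_mem: "Delta0_pred (\<lambda>e. e i \<^bold>\<in> e j)"
  unfolding Delta0_pred_def by (intro exI[of _ "Member i j"]) (simp add: is_Delta0.intros(1))

lemma Delta0_pred_eq: "Delta0_pred (\<lambda>e. e i = e j)"
  unfolding Delta0_pred_def by (intro exI[of _ "Equal i j"]) (simp add: is_Delta0.intros(2))

lemma Delta0_pred_not:
  assumes "Delta0_pred P" shows "Delta0_pred (\<lambda>e. \<not> P e)"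
proof -
  obtain \<phi> where "is_Delta0 \<phi>" "\<forall>e. P e \<longleftrightarrow> sat mem UNIV e \<phi>"
    using assms unfolding Delta0_pred_def by blast
  then show ?thesis
    unfolding Delta0_pred_def by (intro exI[of _ "Neg \<phi>"]) (simp add: is_Delta0.intros(3))
qed

lemma Delta0_pred_conj:
  assumes "Delta0_pred P" "Delta0_pred Q" shows "Delta0_pred (\<lambda>e. P e \<and> Q e)"
proof -
  obtain \<phi> \<psi> where "is_Delta0 \<phi>" "\<forall>e. P e \<longleftrightarrow> sat mem UNIV e \<phi>"
    "is_Delta0 \<psi>" "\<forall>e. Q e \<longleftrightarrow> sat mem UNIV e \<psi>"
    using assms unfolding Delta0_pred_def by blast
  then show ?thesis
    unfolding Delta0_pred_def by (intro exI[of _ "Conj \<phi> \<psi>"]) (simp add: is_Delta0.intros(4))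
qed

lemma Delta0_pred_imp:
  assumes "Delta0_pred P" "Delta0_pred Q" shows "Delta0_pred (\<lambda>e. P e \<longrightarrow> Q e)"
proof -
  have "Delta0_pred (\<lambda>e. \<not> (P e \<and> \<not> Q e))"
    by (intro Delta0_pred_not Delta0_pred_conj assms)
  then show ?thesis by simp
qed

lemma Delta0_pred_disj:
  assumes "Delta0_pred P" "Delta0_pred Q" shows "Delta0_pred (\<lambda>e. P e \<or> Q e)"
proof -
  have "Delta0_pred (\<lambda>e. \<not> P e \<longrightarrow> Q e)"
    by (intro Delta0_pred_not Delta0_pred_imp assms)
  then show ?thesis by (simp add: disj_imp)
qed

lemma Delta0_pred_bex:
  assumes "Delta0_pred (\<lambda>e. P (e 0) (\<lambda>n. e (Suc n)))"
  shows "Delta0_pred (\<lambda>e. \<exists>x. x \<^bold>\<in> e i \<and> P x e)"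
proof -
  obtain \<phi> where \<phi>: "is_Delta0 \<phi>" "\<And>e. P (e 0) (\<lambda>n. e (Suc n)) \<longleftrightarrow> sat mem UNIV e \<phi>"
    using assms unfolding Delta0_pred_def by blast
  have "P x e \<longleftrightarrow> sat mem UNIV (case_nat x e) \<phi>" for x e
    using \<phi>(2)[of "case_nat x e"] by simp
  then show ?thesis
    unfolding Delta0_pred_def
    by (intro exI[of _ "Exists (Conj (Member 0 (Suc i)) \<phi>)"]) (simp add: is_Delta0.intros(5) \<phi>(1))
qed

lemma Delta0_pred_ball:
  assumes "Delta0_pred (\<lambda>e. P (e 0) (\<lambda>n. e (Suc n)))"
  shows "Delta0_pred (\<lambda>e. \<forall>x. x \<^bold>\<in> e i \<longrightarrow> P x e)"
proof -
  have "Delta0_pred (\<lambda>e. \<not> (\<exists>x. x \<^bold>\<in> e i \<and> \<not> P x e))"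
    by (intro Delta0_pred_not Delta0_pred_bex assms)
  then show ?thesis by simp
qed

lemma Delta0_pred_rename:
  assumes "Delta0_pred P" shows "Delta0_pred (\<lambda>e. P (\<lambda>n. e (r n)))"
proof -
  obtain \<phi> where "is_Delta0 \<phi>" "\<forall>e. P e \<longleftrightarrow> sat mem UNIV e \<phi>"
    using assms unfolding Delta0_pred_def by blast
  then show ?thesis
    unfolding Delta0_pred_def
    by (intro exI[of _ "rename r \<phi>"]) (simp add: is_Delta0_rename sat_rename)
qed

lemma Delta0_pred_bex_field:
  assumes "Delta0_pred (\<lambda>e. P (e 0) (\<lambda>n. e (Suc n)))"
  shows "Delta0_pred (\<lambda>e. \<exists>x. field (e i) x \<and> P x e)"
proof -
  have 1: "Delta0_pred (\<lambda>e. P (e 0) (\<lambda>n. e (Suc (Suc (Suc n)))))"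
    using Delta0_pred_rename[OF assms, of "case_nat 0 (\<lambda>n. Suc (Suc (Suc n)))"] by simp
  have "Delta0_pred (\<lambda>e. \<exists>p. p \<^bold>\<in> e i \<and> (\<exists>b. b \<^bold>\<in> p \<and> (\<exists>x. x \<^bold>\<in> b \<and> P x e)))"
    by (intro Delta0_pred_bex 1)
  moreover have "(\<exists>p. p \<^bold>\<in> e i \<and> (\<exists>b. b \<^bold>\<in> p \<and> (\<exists>x. x \<^bold>\<in> b \<and> P x e))) \<longleftrightarrow>
      (\<exists>x. field (e i) x \<and> P x e)" for e
    unfolding field_def by blast
  ultimately show ?thesis by simp
qed

lemma Delta0_pred_ball_field:
  assumes "Delta0_pred (\<lambda>e. P (e 0) (\<lambda>n. e (Suc n)))"
  shows "Delta0_pred (\<lambda>e. \<forall>x. field (e i) x \<longrightarrow> P x e)"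
proof -
  have "Delta0_pred (\<lambda>e. \<not> (\<exists>x. field (e i) x \<and> \<not> P x e))"
    by (intro Delta0_pred_not Delta0_pred_bex_field assms)
  then show ?thesis by simp
qed

lemmas Delta0_intros = Delta0_pred_mem Delta0_pred_eq Delta0_pred_not Delta0_pred_conj
  Delta0_pred_bex Delta0_pred_ball Delta0_pred_bex_field Delta0_pred_ball_field
  Delta0_pred_imp Delta0_pred_disj

section \<open>Bounded definitions of the basic notions\<close>

lemma Delta0_pred_subset: "Delta0_pred (\<lambda>e. e i \<^bold>\<subseteq> e j)"
  unfolding subset_def by (intro Delta0_intros)

lemma Delta0_pred_is_upair: "Delta0_pred (\<lambda>e. is_upair (e i) (e j) (e k))"
proof -
  have eq: "is_upair p x y \<longleftrightarrow> x \<^bold>\<in> p \<and> y \<^bold>\<in> p \<and> (\<forall>z. z \<^bold>\<in> p \<longrightarrow> z = x \<or> z = y)" for p x y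
    unfolding is_upair_def by blast
  show ?thesis unfolding eq by (intro Delta0_intros)
qed

lemma Delta0_pred_is_pair: "Delta0_pred (\<lambda>e. is_pair (e i) (e j) (e k))"
proof -
  have eq: "is_pair p x y \<longleftrightarrow> (\<exists>a. a \<^bold>\<in> p \<and>
      (\<exists>b. b \<^bold>\<in> p \<and> is_upair a x x \<and> is_upair b x y \<and> is_upair p a b))" for p x y
    unfolding is_pair_def is_upair_def[of p] by blast
  show ?thesis unfolding eq by (intro Delta0_intros Delta0_pred_is_upair)
qed

lemma Delta0_pred_maps: "Delta0_pred (\<lambda>e. maps (e i) (e j) (e k))"
  unfolding maps_def by (intro Delta0_intros Delta0_pred_is_pair)

lemma is_pair_field:
  assumes "p \<^bold>\<in> f" "is_pair p x y"
  shows "field f x" "field f y"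
proof -
  obtain b where "b \<^bold>\<in> p" "is_upair b x y"
    using assms(2) unfolding is_pair_def is_upair_def by blast
  then show "field f x" "field f y" using assms(1) unfolding field_def is_upair_def by blast+
qed

lemma maps_field: "maps f x y \<Longrightarrow> field f x \<and> field f y"
  unfolding maps_def using is_pair_field by blast

lemma function_on_bounded: "function_on f d \<longleftrightarrow>
    (\<forall>p. p \<^bold>\<in> f \<longrightarrow> (\<exists>x. x \<^bold>\<in> d \<and> (\<exists>y. field f y \<and> is_pair p x y))) \<and>
    (\<forall>x. x \<^bold>\<in> d \<longrightarrow> (\<exists>y. field f y \<and> maps f x y) \<and>
      (\<forall>y. field f y \<longrightarrow> (\<forall>z. field f z \<longrightarrow> maps f x y \<and> maps f x z \<longrightarrow> y = z)))"
proof -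
  have 1: "(\<forall>p. p \<^bold>\<in> f \<longrightarrow> (\<exists>x y. x \<^bold>\<in> d \<and> is_pair p x y)) \<longleftrightarrow>
      (\<forall>p. p \<^bold>\<in> f \<longrightarrow> (\<exists>x. x \<^bold>\<in> d \<and> (\<exists>y. field f y \<and> is_pair p x y)))"
    using is_pair_field(2) by blast
  have 2: "(\<exists>!y. maps f x y) \<longleftrightarrow> (\<exists>y. field f y \<and> maps f x y) \<and>
      (\<forall>y. field f y \<longrightarrow> (\<forall>z. field f z \<longrightarrow> maps f x y \<and> maps f x z \<longrightarrow> y = z))" for x
    using maps_field by blast
  show ?thesis unfolding function_on_def 1 2 ..
qed

lemma Delta0_pred_function_on: "Delta0_pred (\<lambda>e. function_on (e i) (e j))"
  unfolding function_on_bounded by (intro Delta0_intros Delta0_pred_maps Delta0_pred_is_pair)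

lemma Delta0_pred_function_into: "Delta0_pred (\<lambda>e. function_into (e i) (e j) (e k))"
proof -
  have eq: "function_into f d c \<longleftrightarrow> function_on f d \<and>
      (\<forall>x. field f x \<longrightarrow> (\<forall>y. field f y \<longrightarrow> maps f x y \<longrightarrow> y \<^bold>\<in> c))" for f d c
    unfolding function_into_def using maps_field by blast
  show ?thesis unfolding eq by (intro Delta0_intros Delta0_pred_maps Delta0_pred_function_on)
qed

lemma Delta0_pred_bijection: "Delta0_pred (\<lambda>e. bijection (e i) (e j) (e k))"
proof -
  have 1: "(\<exists>!x. maps f x y) \<longleftrightarrow> (\<exists>x. field f x \<and> maps f x y) \<and>
      (\<forall>x. field f x \<longrightarrow> (\<forall>z. field f z \<longrightarrow> maps f x y \<and> maps f z y \<longrightarrow> x = z))" for f y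
    using maps_field by blast
  show ?thesis
    unfolding bijection_def 1
    by (intro Delta0_intros Delta0_pred_maps Delta0_pred_function_into)
qed

lemma Delta0_pred_transitive_set: "Delta0_pred (\<lambda>e. transitive_set (e i))"
  unfolding transitive_set_def by (intro Delta0_intros Delta0_pred_subset)

lemma Delta0_pred_ordinal: "Delta0_pred (\<lambda>e. ordinal (e i))"
  unfolding ordinal_def by (intro Delta0_intros Delta0_pred_transitive_set)

lemma Delta0_pred_limit_ordinal: "Delta0_pred (\<lambda>e. limit_ordinal (e i))"
proof -
  \<comment> \<open>The repeated conjunct brings the bare existential quantifier into the shape of a
    bounded quantifier with a body.\<close>
  have eq: "limit_ordinal x \<longleftrightarrow> ordinal x \<and> (\<exists>y. y \<^bold>\<in> x \<and> y \<^bold>\<in> x) \<and>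
      (\<forall>y. y \<^bold>\<in> x \<longrightarrow> (\<exists>z. z \<^bold>\<in> x \<and> y \<^bold>\<in> z))" for x
    unfolding limit_ordinal_def by blast
  show ?thesis unfolding eq by (intro Delta0_intros Delta0_pred_ordinal)
qed

lemma Delta0_pred_is_omega: "Delta0_pred (\<lambda>e. is_omega (e i))"
  unfolding is_omega_def by (intro Delta0_intros Delta0_pred_limit_ordinal)

text \<open>The universal closure over \<^term>\<open>z\<close> of this bounded condition says that \<^term>\<open>l\<close> is
  inaccessible, \<^term>\<open>h\<close> is its cumulative hierarchy and \<^term>\<open>v\<close> is the rank
  \<open>V\<^sub>l\<close>. The single variable \<^term>\<open>z\<close> serves all unbounded quantifiers; the bijections
  for the strong limit property are sought in \<^term>\<open>v\<close>.\<close>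

definition world_condition :: "'v \<Rightarrow> 'v \<Rightarrow> 'v \<Rightarrow> 'v \<Rightarrow> bool" where
  "world_condition z h l v \<longleftrightarrow>
     ordinal l \<and> (\<exists>w. w \<^bold>\<in> l \<and> is_omega w) \<and>
     (\<forall>a. a \<^bold>\<in> l \<longrightarrow> \<not> bijection z a l) \<and>
     (\<forall>a. a \<^bold>\<in> l \<longrightarrow> function_into z a l \<longrightarrow>
        (\<exists>b. b \<^bold>\<in> l \<and> (\<forall>x. field z x \<longrightarrow> (\<forall>y. field z y \<longrightarrow> maps z x y \<longrightarrow> y \<^bold>\<in> b)))) \<and>
     (\<forall>a. a \<^bold>\<in> l \<longrightarrow> (\<exists>p. p \<^bold>\<in> v \<and> (\<forall>u. u \<^bold>\<in> p \<longrightarrow> u \<^bold>\<subseteq> a) \<and> (\<forall>u. u \<^bold>\<in> v \<longrightarrow> u \<^bold>\<subseteq> a \<longrightarrow> u \<^bold>\<in> p) \<and>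
        (\<exists>b. b \<^bold>\<in> l \<and> (\<exists>f. f \<^bold>\<in> v \<and> bijection f p b)))) \<and>
     function_on h l \<and>
     (\<forall>b. field h b \<longrightarrow> (\<forall>y. field h y \<longrightarrow> maps h b y \<longrightarrow>
        (\<forall>x. x \<^bold>\<in> y \<longrightarrow> (\<exists>c. c \<^bold>\<in> b \<and> (\<exists>u. field h u \<and> maps h c u \<and> x \<^bold>\<subseteq> u))) \<and>
        ((\<exists>c. c \<^bold>\<in> b \<and> (\<exists>u. field h u \<and> maps h c u \<and> z \<^bold>\<subseteq> u)) \<longrightarrow> z \<^bold>\<in> y))) \<and>
     (\<forall>x. x \<^bold>\<in> v \<longrightarrow> (\<exists>c. c \<^bold>\<in> l \<and> (\<exists>u. field h u \<and> maps h c u \<and> x \<^bold>\<subseteq> u))) \<and>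
     ((\<exists>c. c \<^bold>\<in> l \<and> (\<exists>u. field h u \<and> maps h c u \<and> z \<^bold>\<subseteq> u)) \<longrightarrow> z \<^bold>\<in> v)"

lemma Delta0_pred_world_condition:
  "Delta0_pred (\<lambda>e. world_condition (e i) (e j) (e k) (e l))"
  unfolding world_condition_def
  by (intro Delta0_intros Delta0_pred_ordinal Delta0_pred_is_omega Delta0_pred_bijection
      Delta0_pred_function_into Delta0_pred_function_on Delta0_pred_maps Delta0_pred_subset)

end

context ZFC_model begin

text \<open>The strong limit clause is where inaccessibility of \<open>l\<close> asks for functions
  to exist. The power sets and bijections in question belong to \<open>V l\<close>, so searching for
  them in \<open>v\<close> loses nothing.\<close>

lemma all_world_condition_iff:
  "(\<forall>z. world_condition z h l v) \<longleftrightarrow> inaccessible l \<and> cumulative_hierarchy h l \<and> v = V l"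
proof
  assume W: "\<forall>z. world_condition z h l v"
  have l: "ordinal l" "\<exists>w. w \<^bold>\<in> l \<and> is_omega w" "function_on h l"
    using W unfolding world_condition_def by blast+
  have all_card: "\<forall>a. a \<^bold>\<in> l \<longrightarrow> \<not> bijection z a l" for z
    using W[rule_format, of z] unfolding world_condition_def by (elim conjE)
  have card: "\<not> bijection z a l" if "a \<^bold>\<in> l" for z a
    using all_card that by blast
  have reg: "\<exists>b. b \<^bold>\<in> l \<and> (\<forall>x y. maps z x y \<longrightarrow> y \<^bold>\<in> b)" if za: "a \<^bold>\<in> l" "function_into z a l" for z a
  proof -
    have "\<forall>a. a \<^bold>\<in> l \<longrightarrow> function_into z a l \<longrightarrow>
        (\<exists>b. b \<^bold>\<in> l \<and> (\<forall>x. field z x \<longrightarrow> (\<forall>y. field z y \<longrightarrow> maps z x y \<longrightarrow> y \<^bold>\<in> b)))"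
      using W[rule_format, of z] unfolding world_condition_def by (elim conjE)
    then obtain b where "b \<^bold>\<in> l" "\<forall>x. field z x \<longrightarrow> (\<forall>y. field z y \<longrightarrow> maps z x y \<longrightarrow> y \<^bold>\<in> b)"
      using za by blast
    then show ?thesis using maps_field by blast
  qed
  \<comment> \<open>This clause does not mention \<open>z\<close>; the instance \<open>h\<close> is
    arbitrary.\<close>
  have all_str: "\<forall>a. a \<^bold>\<in> l \<longrightarrow> (\<exists>p. p \<^bold>\<in> v \<and> (\<forall>u. u \<^bold>\<in> p \<longrightarrow> u \<^bold>\<subseteq> a) \<and>
      (\<forall>u. u \<^bold>\<in> v \<longrightarrow> u \<^bold>\<subseteq> a \<longrightarrow> u \<^bold>\<in> p) \<and> (\<exists>b. b \<^bold>\<in> l \<and> (\<exists>f. f \<^bold>\<in> v \<and> bijection f p b)))"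
    using W[rule_format, of h] unfolding world_condition_def by (elim conjE)
  have str: "\<exists>p. p \<^bold>\<in> v \<and> (\<forall>u. u \<^bold>\<in> p \<longrightarrow> u \<^bold>\<subseteq> a) \<and> (\<forall>u. u \<^bold>\<in> v \<longrightarrow> u \<^bold>\<subseteq> a \<longrightarrow> u \<^bold>\<in> p) \<and>
      (\<exists>b. b \<^bold>\<in> l \<and> (\<exists>f. f \<^bold>\<in> v \<and> bijection f p b))" if "a \<^bold>\<in> l" for a
    using all_str that by blast
  have hier: "\<forall>b. field h b \<longrightarrow> (\<forall>y. field h y \<longrightarrow> maps h b y \<longrightarrow>
        (\<forall>x. x \<^bold>\<in> y \<longrightarrow> (\<exists>c. c \<^bold>\<in> b \<and> (\<exists>u. field h u \<and> maps h c u \<and> x \<^bold>\<subseteq> u))) \<and>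
        ((\<exists>c. c \<^bold>\<in> b \<and> (\<exists>u. field h u \<and> maps h c u \<and> z \<^bold>\<subseteq> u)) \<longrightarrow> z \<^bold>\<in> y))" for z
    using W[rule_format, of z] unfolding world_condition_def by (elim conjE)
  have top1: "\<forall>x. x \<^bold>\<in> v \<longrightarrow> (\<exists>c. c \<^bold>\<in> l \<and> (\<exists>u. field h u \<and> maps h c u \<and> x \<^bold>\<subseteq> u))"
    using W[rule_format, of h] unfolding world_condition_def by (elim conjE)
  have top2: "(\<exists>c. c \<^bold>\<in> l \<and> (\<exists>u. field h u \<and> maps h c u \<and> z \<^bold>\<subseteq> u)) \<longrightarrow> z \<^bold>\<in> v" for z
    using W[rule_format, of z] unfolding world_condition_def by (elim conjE)
  have h1: "\<exists>c u. c \<^bold>\<in> b \<and> maps h c u \<and> x \<^bold>\<subseteq> u" if "maps h b y" "x \<^bold>\<in> y" for b y x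
  proof -
    have "field h b" "field h y" using that(1) maps_field by blast+
    then show ?thesis using hier[of h] that by blast
  qed
  have h2: "x \<^bold>\<in> y" if "maps h b y" "c \<^bold>\<in> b" "maps h c u" "x \<^bold>\<subseteq> u" for b y x c u
  proof -
    have "field h b" "field h y" "field h u" using that(1,3) maps_field by blast+
    then show ?thesis using hier[of x] that by blast
  qed
  have v1: "\<exists>c u. c \<^bold>\<in> l \<and> maps h c u \<and> x \<^bold>\<subseteq> u" if "x \<^bold>\<in> v" for x
    using top1 that by blast
  have v2: "x \<^bold>\<in> v" if "c \<^bold>\<in> l" "maps h c u" "x \<^bold>\<subseteq> u" for x c u
  proof -
    have "field h u" using that(2) maps_field by blast
    then show ?thesis using top2[of x] that by blast
  qed
  have h: "cumulative_hierarchy h l"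
    unfolding cumulative_hierarchy_def using l(3) h1 h2 by blast
  have "x \<^bold>\<in> v \<longleftrightarrow> (\<exists>c. c \<^bold>\<in> l \<and> x \<^bold>\<subseteq> app h c)" for x
    using v1[of x] v2[of _ _ x] unfolding maps_app[OF l(3)] by blast
  then have v: "v = V l" using mem_V_hierarchy[OF l(1) h] by (intro set_ext) simp
  \<comment> \<open>Only now that \<open>v\<close> is known to be \<open>V l\<close>, hence closed
    under subsets, is the power set computed in \<open>v\<close> seen to be the true one.\<close>
  have sl: "\<exists>b. b \<^bold>\<in> l \<and> equinumerous (Pow a) b" if a: "a \<^bold>\<in> l" for a
  proof -
    obtain p b f where p: "\<forall>u. u \<^bold>\<in> p \<longrightarrow> u \<^bold>\<subseteq> a" "\<forall>u. u \<^bold>\<in> v \<longrightarrow> u \<^bold>\<subseteq> a \<longrightarrow> u \<^bold>\<in> p"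
      and f: "b \<^bold>\<in> l" "bijection f p b" using str[OF a] by blast
    have "a \<^bold>\<in> V l" using ordinal_subset_V[OF l(1)] a subsetD by blast
    then have "u \<^bold>\<in> v" if "u \<^bold>\<subseteq> a" for u using V_subset_mem[OF l(1)] that v by blast
    then have "p = Pow a" using p by (intro set_ext) auto
    then show ?thesis using f unfolding equinumerous_def by blast
  qed
  have "inaccessible l"
    unfolding inaccessible_def uncountable_cardinal_def cardinal_def regular_def strong_limit_def
      is_power_iff equinumerous_def
    using l card reg sl[unfolded equinumerous_def] by blast
  with h v show "inaccessible l \<and> cumulative_hierarchy h l \<and> v = V l" by blast
next
  assume "inaccessible l \<and> cumulative_hierarchy h l \<and> v = V l"
  then have i: "inaccessible l" and h: "cumulative_hierarchy h l" and v: "v = V l" by blast+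
  have o: "ordinal l" by (rule ordinal_inaccessible[OF i])
  have w: "\<exists>w. w \<^bold>\<in> l \<and> is_omega w"
    using i by (auto simp: inaccessible_def uncountable_cardinal_def)
  have fn: "function_on h l" using h by (simp add: cumulative_hierarchy_def)
  have card: "\<not> bijection z a l" if "a \<^bold>\<in> l" for z a
    using i that unfolding inaccessible_def uncountable_cardinal_def cardinal_def equinumerous_def
    by blast
  have reg: "\<exists>b. b \<^bold>\<in> l \<and> (\<forall>x. field z x \<longrightarrow> (\<forall>y. field z y \<longrightarrow> maps z x y \<longrightarrow> y \<^bold>\<in> b))"
    if za: "a \<^bold>\<in> l" "function_into z a l" for z a
  proof -
    obtain b where "b \<^bold>\<in> l" "\<forall>x y. maps z x y \<longrightarrow> y \<^bold>\<in> b"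
      using i za unfolding inaccessible_def regular_def by blast
    then show ?thesis by blast
  qed
  have str: "\<exists>p. p \<^bold>\<in> v \<and> (\<forall>u. u \<^bold>\<in> p \<longrightarrow> u \<^bold>\<subseteq> a) \<and> (\<forall>u. u \<^bold>\<in> v \<longrightarrow> u \<^bold>\<subseteq> a \<longrightarrow> u \<^bold>\<in> p) \<and>
      (\<exists>b. b \<^bold>\<in> l \<and> (\<exists>f. f \<^bold>\<in> v \<and> bijection f p b))" if a: "a \<^bold>\<in> l" for a
  proof -
    obtain b f where b: "b \<^bold>\<in> l" "bijection f (Pow a) b"
      using i a unfolding inaccessible_def strong_limit_def is_power_iff equinumerous_def by blast
    have V: "a \<^bold>\<in> V l" "b \<^bold>\<in> V l" using a b(1) ordinal_mem_V_inaccessible[OF i] by blast+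
    have "f \<^bold>\<in> V l"
      by (rule function_mem_V[OF i _ Pow_mem_V[OF i V(1)] V(2)])
        (use b(2) in \<open>unfold bijection_def function_into_def, blast+\<close>)
    then show ?thesis
      using b Pow_mem_V[OF i V(1)] v by (intro exI[of _ "Pow a"]) auto
  qed
  have hier: "x \<^bold>\<in> y \<longleftrightarrow> (\<exists>c u. c \<^bold>\<in> b \<and> maps h c u \<and> x \<^bold>\<subseteq> u)" if "maps h b y" for x b y
    using h that unfolding cumulative_hierarchy_def by blast
  have vh: "x \<^bold>\<in> v \<longleftrightarrow> (\<exists>c u. c \<^bold>\<in> l \<and> maps h c u \<and> x \<^bold>\<subseteq> u)" for x
    unfolding v mem_V_hierarchy[OF o h] maps_app[OF fn] by blast
  show "\<forall>z. world_condition z h l v"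
  proof
    fix z
    have "(\<forall>x. x \<^bold>\<in> y \<longrightarrow> (\<exists>c. c \<^bold>\<in> b \<and> (\<exists>u. field h u \<and> maps h c u \<and> x \<^bold>\<subseteq> u))) \<and>
        ((\<exists>c. c \<^bold>\<in> b \<and> (\<exists>u. field h u \<and> maps h c u \<and> z \<^bold>\<subseteq> u)) \<longrightarrow> z \<^bold>\<in> y)" if "maps h b y" for b y
      using hier[OF that] maps_field by blast
    moreover have "\<exists>c. c \<^bold>\<in> l \<and> (\<exists>u. field h u \<and> maps h c u \<and> x \<^bold>\<subseteq> u)" if "x \<^bold>\<in> v" for x
      using vh[of x] that maps_field by blast
    moreover have "(\<exists>c. c \<^bold>\<in> l \<and> (\<exists>u. field h u \<and> maps h c u \<and> z \<^bold>\<subseteq> u)) \<longrightarrow> z \<^bold>\<in> v"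
      using vh by blast
    ultimately show "world_condition z h l v"
      unfolding world_condition_def using o w fn card reg str by (intro conjI) blast+
  qed
qed

text \<open>The renaming removes any dependence on variables other than the first four.\<close>

definition world_matrix :: fm where
  "world_matrix = rename (\<lambda>n. min n 3) (SOME \<phi>. is_Delta0 \<phi> \<and>
     (\<forall>e. world_condition (e 0) (e 1) (e 2) (e 3) \<longleftrightarrow> sat mem UNIV e \<phi>))"

text \<open>The free variable, index 0, is the rank \<open>v\<close>. The quantifiers introduce
  \<open>l\<close>, \<open>h\<close> and \<open>z\<close> in this order, so that the matrix finds
  \<open>z\<close>, \<open>h\<close>, \<open>l\<close>, \<open>v\<close> at indices 0 to 3.\<close>

definition world_fm :: fm where
  "world_fm = Exists (Exists (Forall world_matrix))"

lemma world_matrix_aux: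
  obtains \<phi> where "world_matrix = rename (\<lambda>n. min n 3) \<phi>" "is_Delta0 \<phi>"
    "\<And>e. sat mem UNIV e \<phi> \<longleftrightarrow> world_condition (e 0) (e 1) (e 2) (e 3)"
proof -
  have "\<exists>\<phi>. is_Delta0 \<phi> \<and> (\<forall>e. world_condition (e 0) (e 1) (e 2) (e 3) \<longleftrightarrow> sat mem UNIV e \<phi>)"
    using Delta0_pred_world_condition[of 0 1 2 3] unfolding Delta0_pred_def .
  from someI_ex[OF this] show ?thesis using that unfolding world_matrix_def by blast
qed

lemma is_Delta0_world_matrix: "is_Delta0 world_matrix"
  by (rule world_matrix_aux) (simp add: is_Delta0_rename)

lemma sat_world_matrix:
  "sat mem UNIV e world_matrix \<longleftrightarrow> world_condition (e 0) (e 1) (e 2) (e 3)"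
  by (rule world_matrix_aux) (simp add: sat_rename)

text \<open>The negation is Sigma_1, so inaccessible ranks and the universe agree on which of their
  elements are worlds.\<close>

lemma sat_Forall_world_matrix:
  assumes U: "U = UNIV \<or> (\<exists>k. inaccessible k \<and> U = {x. x \<^bold>\<in> V k})"
    and "h \<in> U" "l \<in> U" "v \<in> U"
  shows "sat mem U (case_nat h (case_nat l (case_nat v e))) (Forall world_matrix) \<longleftrightarrow>
    inaccessible l \<and> cumulative_hierarchy h l \<and> v = V l"
proof -
  obtain \<phi> where \<phi>: "world_matrix = rename (\<lambda>n. min n 3) \<phi>" "is_Delta0 \<phi>"
    "\<And>e. sat mem UNIV e \<phi> \<longleftrightarrow> world_condition (e 0) (e 1) (e 2) (e 3)"
    by (rule world_matrix_aux) (rule that)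
  \<comment> \<open>The tail \<open>e\<close> may leave \<open>U\<close>, which elementarity does
    not allow; the built-in renaming lets it be replaced by the constant \<open>v\<close>.\<close>
  let ?e = "case_nat h (case_nat l (\<lambda>_. v))"
  have "(\<lambda>n. case_nat z (case_nat h (case_nat l (case_nat v e))) (min n 3)) = case_nat z ?e" for z
    by (auto simp: fun_eq_iff min_def numeral_3_eq_3 split: nat.split)
  then have "sat mem U (case_nat h (case_nat l (case_nat v e))) (Forall world_matrix) \<longleftrightarrow>
      \<not> sat mem U ?e (Exists (Neg \<phi>))"
    by (simp add: \<phi>(1) sat_rename)
  also have "sat mem U ?e (Exists (Neg \<phi>)) \<longleftrightarrow> sat mem UNIV ?e (Exists (Neg \<phi>))"
  proof (cases "U = UNIV")
    case False
    then obtain k where k: "inaccessible k" "U = {x. x \<^bold>\<in> V k}" using U by blast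
    have "is_Pi 0 (Neg \<phi>)" using \<phi>(2) by (simp add: is_Delta0.intros(3))
    then have "is_Sigma 1 (Exists (Neg \<phi>))"
      using is_Sigma_is_Pi.intros(3,4)[of 0 "Neg \<phi>"] by simp
    moreover have "range ?e \<subseteq> {x. x \<^bold>\<in> V k}" using assms(2-4) k(2) by auto
    ultimately show ?thesis unfolding k(2) by (rule Sigma1_elementary_V[OF k(1)])
  qed simp
  also have "\<not> \<dots> \<longleftrightarrow> (\<forall>z. world_condition z h l v)"
    by (simp add: \<phi>(3) numeral_2_eq_2 numeral_3_eq_3)
  finally show ?thesis by (simp only: all_world_condition_iff)
qed

text \<open>The height \<open>l\<close> and the hierarchy \<open>h\<close> of a world below
  \<open>k\<close> are themselves elements of \<open>V k\<close>, so \<open>V k\<close> can certify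
  that world.\<close>

lemma sat_world_fm:
  assumes k: "inaccessible k" and v: "v \<^bold>\<in> V k"
  shows "sat mem {x. x \<^bold>\<in> V k} (case_nat v e) world_fm \<longleftrightarrow>
    (\<exists>l. inaccessible l \<and> l \<^bold>\<in> k \<and> v = V l)"
proof -
  let ?U = "{x. x \<^bold>\<in> V k}"
  have ok: "ordinal k" by (rule ordinal_inaccessible[OF k])
  have eq: "sat mem ?U (case_nat h (case_nat l (case_nat v e))) (Forall world_matrix) \<longleftrightarrow>
      inaccessible l \<and> cumulative_hierarchy h l \<and> v = V l" if "l \<in> ?U" "h \<in> ?U" for l h
    by (rule sat_Forall_world_matrix) (use k v that in auto)
  have "sat mem ?U (case_nat v e) world_fm \<longleftrightarrow>
      (\<exists>l\<in>?U. \<exists>h\<in>?U. inaccessible l \<and> cumulative_hierarchy h l \<and> v = V l)"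
    unfolding world_fm_def sat.simps(5)[of mem ?U] by (intro bex_cong refl eq)
  also have "\<dots> \<longleftrightarrow> (\<exists>l. inaccessible l \<and> l \<^bold>\<in> k \<and> v = V l)"
  proof
    assume "\<exists>l\<in>?U. \<exists>h\<in>?U. inaccessible l \<and> cumulative_hierarchy h l \<and> v = V l"
    then show "\<exists>l. inaccessible l \<and> l \<^bold>\<in> k \<and> v = V l"
      using ordinal_mem_V[OF ok] ordinal_inaccessible by blast
  next
    assume "\<exists>l. inaccessible l \<and> l \<^bold>\<in> k \<and> v = V l"
    then obtain l where l: "inaccessible l" "l \<^bold>\<in> k" "v = V l" by blast
    have ol: "ordinal l" by (rule ordinal_inaccessible[OF l(1)])
    obtain h where h: "cumulative_hierarchy h l" using cumulative_hierarchy_exists[OF ol] by blast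
    have fn: "function_on h l" using h by (simp add: cumulative_hierarchy_def)
    have "h \<^bold>\<in> V k"
    proof (rule function_mem_V[OF k fn])
      show "l \<^bold>\<in> V k" using ordinal_mem_V_inaccessible[OF k l(2)] .
      show "V l \<^bold>\<in> V k" using v l(3) by simp
      show "y \<^bold>\<in> V l" if "maps h x y" for x y
        using that V_mem[OF ol] hierarchy_V[OF ol h] unfolding maps_app[OF fn] by auto
    qed
    then show "\<exists>l\<in>?U. \<exists>h\<in>?U. inaccessible l \<and> cumulative_hierarchy h l \<and> v = V l"
      using l h ordinal_mem_V_inaccessible[OF k l(2)] by auto
  qed
  finally show ?thesis .
qed

text \<open>Under the four quantifiers the indices 0 to 3 are \<open>z\<close>, \<open>h\<close>,
  \<open>l\<close>, \<open>v\<close>; index 4 is the set to be contained in the world, and the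
  parameters of the formula start at 5. The unbounded prefix is one existential block followed by
  one universal quantifier.\<close>

definition some_world :: "fm \<Rightarrow> fm" where
  "some_world \<phi> = Exists (Exists (Exists (Forall (Conj world_matrix
     (Conj (Member 4 3) (relativize 3 (rename (\<lambda>n. n + 5) \<phi>)))))))"

lemma is_Sigma_some_world: "is_Sigma 2 (some_world \<phi>)"
proof -
  have "is_Sigma 0 (Conj world_matrix (Conj (Member 4 3) (relativize 3 (rename (\<lambda>n. n + 5) \<phi>))))"
    by (simp add: is_Delta0.intros is_Delta0_world_matrix is_Delta0_relativize)
  then show ?thesis
    unfolding some_world_def numeral_2_eq_2 by (intro is_Sigma_is_Pi.intros(3-6))
qed

lemma sat_some_world:
  "sat mem UNIV (case_nat x e) (some_world \<phi>) \<longleftrightarrow>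
    (\<exists>l. inaccessible l \<and> x \<^bold>\<in> V l \<and> sat mem {y. y \<^bold>\<in> V l} e \<phi>)"
proof -
  have "sat mem UNIV (case_nat x e) (some_world \<phi>) \<longleftrightarrow>
    (\<exists>v l h. (\<forall>z. world_condition z h l v) \<and> x \<^bold>\<in> v \<and> sat mem {y. y \<^bold>\<in> v} e \<phi>)"
    by (simp add: some_world_def sat_world_matrix sat_relativize sat_rename
        numeral_2_eq_2 numeral_3_eq_3 eval_nat_numeral, blast)
  also have "\<dots> \<longleftrightarrow> (\<exists>l. inaccessible l \<and> x \<^bold>\<in> V l \<and> sat mem {y. y \<^bold>\<in> V l} e \<phi>)"
    unfolding all_world_condition_iff
    using cumulative_hierarchy_exists ordinal_inaccessible by blast
  finally show ?thesis .
qed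

text \<open>A witness found inside \<open>V k\<close> has its height below \<open>k\<close>. This is
  what later shows a reflecting \<open>k\<close> to be a limit of inaccessibles.\<close>

lemma sat_some_world_V:
  assumes k: "inaccessible k" and x: "x \<^bold>\<in> V k"
    and sat: "sat mem {x. x \<^bold>\<in> V k} (case_nat x e) (some_world \<phi>)"
  shows "\<exists>l. inaccessible l \<and> l \<^bold>\<in> k \<and> x \<^bold>\<in> V l"
proof -
  let ?U = "{x. x \<^bold>\<in> V k}"
  let ?e = "\<lambda>v l h. case_nat h (case_nat l (case_nat v (case_nat x e)))"
  obtain v l h where vlh: "v \<in> ?U" "l \<in> ?U" "h \<in> ?U"
    and "\<forall>z\<in>?U. sat mem ?U (case_nat z (?e v l h)) (Conj world_matrix
     (Conj (Member 4 3) (relativize 3 (rename (\<lambda>n. n + 5) \<phi>))))"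
    using sat unfolding some_world_def by auto
  then have "sat mem ?U (?e v l h) (Forall world_matrix)" and
    mem: "\<forall>z\<in>?U. sat mem ?U (case_nat z (?e v l h)) (Member 4 3)"
    by auto
  then have l: "inaccessible l" "v = V l" using sat_Forall_world_matrix[of ?U h l v] k vlh by auto
  have "x \<^bold>\<in> v" using mem x by (auto simp: eval_nat_numeral)
  moreover have "l \<^bold>\<in> k"
    using ordinal_mem_V ordinal_inaccessible k l(1) vlh(2) by blast
  ultimately show ?thesis using l by blast
qed

end

section \<open>From maximality to reflection\<close>

context ZFC_model begin

lemma accesses_trans:
  assumes "accesses k l" "accesses l m" shows "accesses k m"
  using assms ordinal_trans[OF ordinal_inaccessible[of m]] unfolding accesses_def by blast

lemma accesses_refl: "inaccessible k \<Longrightarrow> accesses k k"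
  by (simp add: accesses_def)

lemma accesses_V: "accesses k l \<Longrightarrow> x \<^bold>\<in> V k \<Longrightarrow> x \<^bold>\<in> V l"
  using inaccessible_V_mono[of k l] unfolding accesses_def by blast

text \<open>Witnesses for the existential block remain witnesses, and elementarity at level
  \<open>n\<close> decides the Pi matrix. Elementarity thus yields upward persistence one level
  higher.\<close>

lemma Sigma_up:
  assumes el: "\<And>\<phi> e. is_Sigma n \<phi> \<Longrightarrow> range e \<subseteq> U \<Longrightarrow> sat mem U e \<phi> \<longleftrightarrow> sat mem UNIV e \<phi>"
    and \<phi>: "is_Sigma (Suc n) \<phi>" and e: "range e \<subseteq> U" and sat: "sat mem U e \<phi>"
  shows "sat mem UNIV e \<phi>"
proof -
  obtain m \<psi> where \<psi>: "is_Pi n \<psi>" and block: "\<And>U e. sat mem U e \<phi> \<longleftrightarrow>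
      (\<exists>zs. length zs = m \<and> set zs \<subseteq> U \<and> sat mem U (prepend zs e) \<psi>)"
    using Sigma_block[where E = mem, OF \<phi>] by blast
  obtain \<chi> where \<chi>: "is_Sigma n \<chi>" "\<And>U e. sat mem U e \<chi> \<longleftrightarrow> \<not> sat mem U e \<psi>"
    using Pi_dual[where E = mem, OF \<psi>] by blast
  obtain zs where zs: "length zs = m" "set zs \<subseteq> U" "sat mem U (prepend zs e) \<psi>"
    using sat unfolding block by blast
  have "sat mem UNIV (prepend zs e) \<psi>"
    using el[OF \<chi>(1), of "prepend zs e"] \<chi>(2) zs e by simp
  with zs(1) show ?thesis unfolding block by blast
qed

text \<open>Fix true witnesses for the leading block. In a world containing them the Pi_2 matrix
  cannot fail, since its failure is a Sigma_2 statement and would persist to the universe.\<close>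

lemma Sigma3_eventually:
  assumes ua: "universe_axiom" and k: "inaccessible k"
    and \<phi>: "is_Sigma 3 \<phi>" and e: "range e \<subseteq> {x. x \<^bold>\<in> V k}" and sat: "sat mem UNIV e \<phi>"
  obtains l where "accesses k l" "\<And>m. accesses l m \<Longrightarrow> sat mem {x. x \<^bold>\<in> V m} e \<phi>"
proof -
  have \<phi>': "is_Sigma (Suc 2) \<phi>" using \<phi> by (simp add: numeral_3_eq_3 numeral_2_eq_2)
  obtain N \<psi> where \<psi>: "is_Pi 2 \<psi>" and block: "\<And>U e. sat mem U e \<phi> \<longleftrightarrow>
      (\<exists>zs. length zs = N \<and> set zs \<subseteq> U \<and> sat mem U (prepend zs e) \<psi>)"
    using Sigma_block[where E = mem, OF \<phi>'] by blast
  obtain \<chi> where "is_Sigma 2 \<chi>" and \<chi>: "\<And>U e. sat mem U e \<chi> \<longleftrightarrow> \<not> sat mem U e \<psi>"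
    using Pi_dual[where E = mem, OF \<psi>] by blast
  then have \<chi>2: "is_Sigma (Suc 1) \<chi>" by (simp add: numeral_2_eq_2)
  obtain zs where zs: "length zs = N" "sat mem UNIV (prepend zs e) \<psi>"
    using sat unfolding block by blast
  obtain x where x: "\<And>y. y \<^bold>\<in> x \<longleftrightarrow> (\<exists>n<N. y = zs ! n)"
    using finite_set_small[OF k, of N "\<lambda>n. zs ! n"] by blast
  \<comment> \<open>Adding \<open>k\<close> to the witnesses forces the world found to lie above
    \<open>V k\<close>.\<close>
  let ?x = "join x (upair k k)"
  let ?a = "rank_bound ?x"
  have xa: "y \<^bold>\<in> V ?a" if "y \<^bold>\<in> ?x" for y
    using V_trans[OF rank_bound(1) rank_bound(2)] that by blast
  obtain l where l: "inaccessible l" "?a \<^bold>\<in> l"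
    using ua rank_bound(1)[of ?x] unfolding universe_axiom_def by blast
  have al: "y \<^bold>\<in> V l" if "y \<^bold>\<in> ?x" for y
    using V_trans_mem[OF ordinal_inaccessible[OF l(1)] l(2) xa[OF that]] .
  have "k \<^bold>\<in> V l" using al by simp
  then have kl: "accesses k l"
    using ordinal_mem_V ordinal_inaccessible k l(1) by (simp add: accesses_def)
  show ?thesis
  proof (rule that[OF kl])
    fix m assume lm: "accesses l m"
    then have m: "inaccessible m" by (simp add: accesses_def)
    let ?U = "{x. x \<^bold>\<in> V m}"
    have "set zs \<subseteq> ?U"
    proof
      fix z assume "z \<in> set zs"
      then obtain n where "n < N" "z = zs ! n" using zs(1) by (metis in_set_conv_nth)
      then have "z \<^bold>\<in> ?x" using x by auto
      then show "z \<in> ?U" using al accesses_V[OF lm] by blast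
    qed
    moreover have "range e \<subseteq> ?U" using e accesses_V[OF accesses_trans[OF kl lm]] by blast
    ultimately have r: "range (prepend zs e) \<subseteq> ?U" by simp
    have "sat mem ?U (prepend zs e) \<psi>"
    proof (rule ccontr)
      assume "\<not> sat mem ?U (prepend zs e) \<psi>"
      then have "sat mem UNIV (prepend zs e) \<chi>"
        using Sigma_up[OF Sigma1_elementary_V[OF m] \<chi>2 r] \<chi> by blast
      then show False using \<chi> zs(2) by blast
    qed
    then show "sat mem ?U e \<phi>" using \<open>set zs \<subseteq> ?U\<close> zs(1) unfolding block by blast
  qed
qed

lemma maximality_reflecting:
  assumes k: "inaccessible k" and ua: "universe_axiom"
    and val: "S5 \<subseteq> Val k (assertions (Vset k))"
  shows "Sigma_reflecting 3 k"
proof -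
  let ?U = "{x. x \<^bold>\<in> V k}"
  have Vs: "Vset m = {x. x \<^bold>\<in> V m}" if "inaccessible m" for m
    by (rule Vset_inaccessible[OF that])
  have down: "sat mem ?U e \<phi>"
    if \<phi>: "is_Sigma 3 \<phi>" and e: "range e \<subseteq> ?U" and sat: "sat mem UNIV e \<phi>" for \<phi> e
  proof -
    obtain l where l: "accesses k l" "\<And>m. accesses l m \<Longrightarrow> sat mem {x. x \<^bold>\<in> V m} e \<phi>"
      using Sigma3_eventually[OF ua k \<phi> e sat] by blast
    have "Imp (Dia (Box (Atom 0))) (Atom 0) \<in> Val k (assertions (Vset k))"
      using val S5_Dia_Box by blast
    then have valid: "\<forall>\<sigma>. range \<sigma> \<subseteq> assertions (Vset k) \<longrightarrow>
        true_at k (map_modal \<sigma> (Imp (Dia (Box (Atom (0::nat)))) (Atom 0)))"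
      by (simp only: Val_def mem_Collect_eq)
    have "range (\<lambda>_::nat. (\<phi>, e)) \<subseteq> assertions (Vset k)"
      using e by (auto simp: assertions_def Vs[OF k])
    then have "true_at k (map_modal (\<lambda>_. (\<phi>, e)) (Imp (Dia (Box (Atom (0::nat)))) (Atom 0)))"
      by (rule valid[rule_format])
    then have "(\<exists>l. accesses k l \<and> (\<forall>m. accesses l m \<longrightarrow> sat mem (Vset m) e \<phi>)) \<longrightarrow>
        sat mem (Vset k) e \<phi>"
      by simp
    moreover have "sat mem (Vset m) e \<phi>" if "accesses l m" for m
      using l(2)[OF that] that Vs by (simp add: accesses_def)
    ultimately show ?thesis using l(1) Vs[OF k] by auto
  qed
  \<comment> \<open>Upward persistence of Sigma_3 needs Sigma_2-elementarity; \<open>down\<close>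
    covers Sigma_2 formulas as well, so elementarity climbs from level 1 to 2 and then to 3.\<close>
  have Sigma2: "sat mem ?U e \<phi> \<longleftrightarrow> sat mem UNIV e \<phi>" if \<phi>: "is_Sigma 2 \<phi>" and e: "range e \<subseteq> ?U" for \<phi> e
  proof
    assume "sat mem ?U e \<phi>"
    moreover have "is_Sigma (Suc 1) \<phi>" using \<phi> by (simp add: numeral_2_eq_2)
    ultimately show "sat mem UNIV e \<phi>"
      using Sigma_up[OF Sigma1_elementary_V[OF k]] e by blast
  next
    have "is_Sigma 3 \<phi>" using Sigma_mono[OF \<phi>] by (simp add: numeral_3_eq_3 numeral_2_eq_2)
    then show "sat mem UNIV e \<phi> \<Longrightarrow> sat mem ?U e \<phi>" using down e by blast
  qed
  have "sat mem ?U e \<phi> \<longleftrightarrow> sat mem UNIV e \<phi>" if \<phi>: "is_Sigma 3 \<phi>" and e: "range e \<subseteq> ?U" for \<phi> e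
  proof -
    have "is_Sigma (Suc 2) \<phi>" using \<phi> by (simp add: numeral_3_eq_3 numeral_2_eq_2)
    then show ?thesis using Sigma_up[OF Sigma2] down[OF \<phi> e] e by blast
  qed
  then show ?thesis
    unfolding Sigma_reflecting_def Sigma_elementary_def using k Vs[OF k] by auto
qed

section \<open>From reflection to maximality\<close>

text \<open>One formula for all worlds and all valuations, hence a property of worlds expressed
  without parameters.\<close>

definition expressible :: "('v \<Rightarrow> bool) \<Rightarrow> bool" where
  "expressible P \<longleftrightarrow> (\<exists>\<phi>. \<forall>m e. inaccessible m \<longrightarrow> (sat mem {x. x \<^bold>\<in> V m} e \<phi> \<longleftrightarrow> P m))"

lemma expressible_const: "expressible (\<lambda>m. b)"
proof (cases b)
  case True
  then show ?thesis unfolding expressible_def by (intro exI[of _ Top]) simp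
next
  case False
  then show ?thesis unfolding expressible_def by (intro exI[of _ "Neg Top"]) simp
qed

lemma expressible_not:
  assumes "expressible P" shows "expressible (\<lambda>m. \<not> P m)"
proof -
  obtain \<phi> where "\<forall>m e. inaccessible m \<longrightarrow> (sat mem {x. x \<^bold>\<in> V m} e \<phi> \<longleftrightarrow> P m)"
    using assms unfolding expressible_def by blast
  then show ?thesis unfolding expressible_def by (intro exI[of _ "Neg \<phi>"]) simp
qed

lemma expressible_conj:
  assumes "expressible P" "expressible Q" shows "expressible (\<lambda>m. P m \<and> Q m)"
proof -
  obtain \<phi> \<psi> where "\<forall>m e. inaccessible m \<longrightarrow> (sat mem {x. x \<^bold>\<in> V m} e \<phi> \<longleftrightarrow> P m)"
    "\<forall>m e. inaccessible m \<longrightarrow> (sat mem {x. x \<^bold>\<in> V m} e \<psi> \<longleftrightarrow> Q m)"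
    using assms unfolding expressible_def by blast
  then show ?thesis unfolding expressible_def by (intro exI[of _ "Conj \<phi> \<psi>"]) simp
qed

lemma expressible_disj:
  assumes "expressible P" "expressible Q" shows "expressible (\<lambda>m. P m \<or> Q m)"
proof -
  have "expressible (\<lambda>m. \<not> (\<not> P m \<and> \<not> Q m))"
    by (intro expressible_not expressible_conj assms)
  then show ?thesis by simp
qed

lemma expressible_ex_less:
  fixes n :: nat
  assumes "\<And>i. expressible (P i)" shows "expressible (\<lambda>m. \<exists>i<n. P i m)"
proof (induction n)
  case 0
  show ?case by (simp add: expressible_const)
next
  case (Suc n)
  have "expressible (\<lambda>m. P n m \<or> (\<exists>i<n. P i m))" by (rule expressible_disj[OF assms Suc.IH])
  moreover have "(P n m \<or> (\<exists>i<n. P i m)) \<longleftrightarrow> (\<exists>i<Suc n. P i m)" for m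
    by (auto simp: less_Suc_eq)
  ultimately show ?case by simp
qed

text \<open>\<^term>\<open>nth_above_limit j m\<close>: the inaccessible \<^term>\<open>m\<close> is the \<^term>\<open>j\<close>-th inaccessible
  after an inaccessible limit of inaccessibles.\<close>

primrec nth_above_limit :: "nat \<Rightarrow> 'v \<Rightarrow> bool" where
  "nth_above_limit 0 m \<longleftrightarrow> (\<forall>x. x \<^bold>\<in> V m \<longrightarrow> (\<exists>l. inaccessible l \<and> l \<^bold>\<in> m \<and> x \<^bold>\<in> V l))"
| "nth_above_limit (Suc j) m \<longleftrightarrow> (\<exists>l. inaccessible l \<and> l \<^bold>\<in> m \<and> nth_above_limit j l \<and>
     \<not> (\<exists>l'. inaccessible l' \<and> l' \<^bold>\<in> m \<and> V l \<^bold>\<in> V l'))"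

text \<open>In the successor clause index 0 holds the largest world below;
  \<open>relativize 0\<close> evaluates the recursive formula there, and \<open>rename Suc\<close>
  makes that formula skip index 0.\<close>

primrec nth_above_limit_fm :: "nat \<Rightarrow> fm" where
  "nth_above_limit_fm 0 = Forall (Exists (Conj world_fm (Member 1 0)))"
| "nth_above_limit_fm (Suc j) = Exists (Conj world_fm (Conj
     (relativize 0 (rename Suc (nth_above_limit_fm j)))
     (Neg (Exists (Conj world_fm (Member 1 0))))))"

lemma sat_larger_world:
  assumes m: "inaccessible m" and x: "x \<^bold>\<in> V m"
  shows "sat mem {x. x \<^bold>\<in> V m} (case_nat x e) (Exists (Conj world_fm (Member 1 0))) \<longleftrightarrow>
    (\<exists>l. inaccessible l \<and> l \<^bold>\<in> m \<and> x \<^bold>\<in> V l)"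
proof -
  have "sat mem {x. x \<^bold>\<in> V m} (case_nat x e) (Exists (Conj world_fm (Member 1 0))) \<longleftrightarrow>
      (\<exists>v. v \<^bold>\<in> V m \<and> (\<exists>l. inaccessible l \<and> l \<^bold>\<in> m \<and> v = V l) \<and> x \<^bold>\<in> v)"
    using sat_world_fm[OF m] by auto
  also have "\<dots> \<longleftrightarrow> (\<exists>l. inaccessible l \<and> l \<^bold>\<in> m \<and> x \<^bold>\<in> V l)"
    using V_mem[OF ordinal_inaccessible[OF m]] by blast
  finally show ?thesis .
qed

lemma sat_relativize_V:
  assumes m: "inaccessible m" and l: "l \<^bold>\<in> m"
  shows "sat mem {x. x \<^bold>\<in> V m} (case_nat (V l) e) (relativize 0 \<phi>) \<longleftrightarrow>
    sat mem {x. x \<^bold>\<in> V l} (case_nat (V l) e) \<phi>"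
proof -
  have "sat mem {x. x \<^bold>\<in> V m} e (relativize k \<phi>) \<longleftrightarrow> sat mem {x. x \<^bold>\<in> e k} e \<phi>"
    if "\<forall>x. x \<^bold>\<in> e k \<longrightarrow> x \<^bold>\<in> V m" for e k
    using that
  proof (induction \<phi> arbitrary: e k)
    case (Exists \<phi>)
    have "sat mem {x. x \<^bold>\<in> V m} (case_nat x e) (relativize (Suc k) \<phi>) \<longleftrightarrow>
        sat mem {x. x \<^bold>\<in> e k} (case_nat x e) \<phi>" for x
      using Exists.IH[of "case_nat x e" "Suc k"] Exists.prems by simp
    then show ?case using Exists.prems by auto
  qed simp_all
  from this[of "case_nat (V l) e" 0] show ?thesis
    using V_trans_mem[OF ordinal_inaccessible[OF m] l] by simp
qed

lemma sat_nth_above_limit_fm: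
  "inaccessible m \<Longrightarrow> sat mem {x. x \<^bold>\<in> V m} e (nth_above_limit_fm j) \<longleftrightarrow> nth_above_limit j m"
proof (induction j arbitrary: m e)
  case 0
  have "sat mem {x. x \<^bold>\<in> V m} e (nth_above_limit_fm 0) \<longleftrightarrow> (\<forall>x. x \<^bold>\<in> V m \<longrightarrow>
      sat mem {x. x \<^bold>\<in> V m} (case_nat x e) (Exists (Conj world_fm (Member 1 0))))"
    by auto
  then show ?case unfolding nth_above_limit.simps using sat_larger_world[OF 0] by blast
next
  case (Suc j)
  note m = Suc.prems
  let ?U = "{x. x \<^bold>\<in> V m}"
  let ?larger = "Exists (Conj world_fm (Member 1 0))"
  let ?rel = "relativize 0 (rename Suc (nth_above_limit_fm j))"
  have "sat mem ?U e (nth_above_limit_fm (Suc j)) \<longleftrightarrow> (\<exists>v. v \<^bold>\<in> V m \<and>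
      sat mem ?U (case_nat v e) world_fm \<and> sat mem ?U (case_nat v e) ?rel \<and>
      \<not> sat mem ?U (case_nat v e) ?larger)"
    by auto
  also have "\<dots> \<longleftrightarrow> (\<exists>l. inaccessible l \<and> l \<^bold>\<in> m \<and> sat mem ?U (case_nat (V l) e) ?rel \<and>
      \<not> sat mem ?U (case_nat (V l) e) ?larger)"
    using sat_world_fm[OF m, of _ e] V_mem[OF ordinal_inaccessible[OF m]] by blast
  also have "\<dots> \<longleftrightarrow> nth_above_limit (Suc j) m"
  proof -
    have "sat mem ?U (case_nat (V l) e) ?rel \<longleftrightarrow> nth_above_limit j l"
      if "inaccessible l" "l \<^bold>\<in> m" for l
      using sat_relativize_V[OF m that(2)] Suc.IH[OF that(1)] by (simp add: sat_rename)
    moreover have "sat mem ?U (case_nat (V l) e) ?larger \<longleftrightarrow>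
        (\<exists>l'. inaccessible l' \<and> l' \<^bold>\<in> m \<and> V l \<^bold>\<in> V l')" if "l \<^bold>\<in> m" for l
      using sat_larger_world[OF m V_mem[OF ordinal_inaccessible[OF m] that]] .
    ultimately show ?thesis unfolding nth_above_limit.simps by blast
  qed
  finally show ?case .
qed

lemma expressible_nth_above_limit: "expressible (nth_above_limit j)"
  unfolding expressible_def using sat_nth_above_limit_fm by blast

text \<open>A limit of inaccessibles has no largest inaccessible below it: if \<open>l\<close> were
  the largest, some smaller world would still have to contain \<open>V l\<close>.\<close>

lemma nth_above_limit_0_Suc:
  assumes "inaccessible m" "nth_above_limit 0 m" shows "\<not> nth_above_limit (Suc j) m"
  using assms V_mem[OF ordinal_inaccessible[OF assms(1)]] by auto

text \<open>The largest inaccessible below \<open>m\<close> is unique, so both counts descend to the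
  same world.\<close>

lemma nth_above_limit_unique:
  "inaccessible m \<Longrightarrow> nth_above_limit i m \<Longrightarrow> nth_above_limit j m \<Longrightarrow> i = j"
proof (induction i arbitrary: j m)
  case 0
  then show ?case using nth_above_limit_0_Suc by (cases j) blast+
next
  case (Suc i)
  then obtain j' where j: "j = Suc j'" using nth_above_limit_0_Suc by (cases j) blast+
  obtain l where l: "inaccessible l" "l \<^bold>\<in> m" "nth_above_limit i l"
    "\<not> (\<exists>l'. inaccessible l' \<and> l' \<^bold>\<in> m \<and> V l \<^bold>\<in> V l')"
    using Suc.prems(2) by auto
  obtain l' where l': "inaccessible l'" "l' \<^bold>\<in> m" "nth_above_limit j' l'"
    "\<not> (\<exists>l''. inaccessible l'' \<and> l'' \<^bold>\<in> m \<and> V l' \<^bold>\<in> V l'')"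
    using Suc.prems(3) j by auto
  have "l = l'"
    using ordinal_linear[OF ordinal_inaccessible[OF l(1)] ordinal_inaccessible[OF l'(1)]]
      V_mem_V_iff l l' by blast
  then show ?case using Suc.IH[OF l(1,3)] l'(3) j by simp
qed

section \<open>Consequences of reflection: constant boxes and the exact validities\<close>

context
  fixes k :: 'v
  assumes refl: "Sigma_reflecting 3 k"
begin

lemma inaccessible_k: "inaccessible k"
  using refl by (simp add: Sigma_reflecting_def)

lemma Sigma3_elementary_k:
  "is_Sigma 3 \<phi> \<Longrightarrow> range e \<subseteq> {x. x \<^bold>\<in> V k} \<Longrightarrow> sat mem {x. x \<^bold>\<in> V k} e \<phi> \<longleftrightarrow> sat mem UNIV e \<phi>"
  using refl Vset_inaccessible[OF inaccessible_k]
  by (simp add: Sigma_reflecting_def Sigma_elementary_def)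

lemma Sigma2_elementary_k:
  "is_Sigma 2 \<phi> \<Longrightarrow> range e \<subseteq> {x. x \<^bold>\<in> V k} \<Longrightarrow> sat mem {x. x \<^bold>\<in> V k} e \<phi> \<longleftrightarrow> sat mem UNIV e \<phi>"
  using Sigma3_elementary_k[of \<phi> e] Sigma_mono[of 2 \<phi>] by (simp add: numeral_3_eq_3 numeral_2_eq_2)

lemma unboundedly_many_worlds:
  assumes e: "range e \<subseteq> {x. x \<^bold>\<in> V k}" and l: "accesses k l" "sat mem {x. x \<^bold>\<in> V l} e \<phi>"
  shows "\<exists>m. inaccessible m \<and> x \<^bold>\<in> V m \<and> sat mem {x. x \<^bold>\<in> V m} e \<phi>"
proof -
  let ?U = "{x. x \<^bold>\<in> V k}"
  \<comment> \<open>The single world \<open>V l\<close> contains every \<open>x\<close> in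
    \<open>V k\<close>; Sigma_2-elementarity then produces such a world inside \<open>V k\<close>,
    possibly a different one for each \<open>x\<close>.\<close>
  have "sat mem ?U (case_nat x e) (some_world \<phi>)" if "x \<^bold>\<in> V k" for x
  proof -
    have "sat mem UNIV (case_nat x e) (some_world \<phi>)"
      using l accesses_V[OF l(1) that] unfolding sat_some_world accesses_def by blast
    then show ?thesis using Sigma2_elementary_k[OF is_Sigma_some_world] e that by simp
  qed
  then have "sat mem ?U e (Forall (some_world \<phi>))" by auto
  moreover have "is_Pi 3 (Forall (some_world \<phi>))"
    using is_Sigma_is_Pi.intros(5,6)[of 2 "some_world \<phi>"] is_Sigma_some_world
    by (simp add: numeral_3_eq_3 numeral_2_eq_2)
  then obtain \<chi> where \<chi>: "is_Sigma 3 \<chi>"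
    "\<And>U e. sat mem U e \<chi> \<longleftrightarrow> \<not> sat mem U e (Forall (some_world \<phi>))"
    using Pi_dual[where E = mem] by blast
  ultimately have "sat mem UNIV e (Forall (some_world \<phi>))"
    using Sigma3_elementary_k[OF \<chi>(1) e] by blast
  then have "sat mem UNIV (case_nat x e) (some_world \<phi>)" by simp
  then show ?thesis unfolding sat_some_world .
qed

lemma unboundedly_many_successors:
  assumes "range e \<subseteq> {x. x \<^bold>\<in> V k}" "accesses k l" "sat mem {x. x \<^bold>\<in> V l} e \<phi>"
    and m: "accesses k m"
  shows "\<exists>m'. accesses m m' \<and> sat mem {x. x \<^bold>\<in> V m'} e \<phi>"
proof -
  have im: "inaccessible m" using m by (simp add: accesses_def)
  obtain m' where m': "inaccessible m'" "m \<^bold>\<in> V m'" "sat mem {x. x \<^bold>\<in> V m'} e \<phi>"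
    using unboundedly_many_worlds[OF assms(1-3)] by blast
  have "m \<^bold>\<in> m'" by (rule ordinal_mem_V[OF _ _ m'(2)]) (intro ordinal_inaccessible m' im)+
  then show ?thesis using im m' unfolding accesses_def by blast
qed

lemma emp_mem_V_k: "emp \<^bold>\<in> V k"
  using ordinal_mem_V_inaccessible emp_inaccessible inaccessible_k by blast

lemma universe_axiom_k: "universe_axiom"
  unfolding universe_axiom_def
proof (intro allI impI)
  fix a assume a: "ordinal a"
  \<comment> \<open>The trivial assertion holds at \<open>V k\<close> itself, so worlds containing
    any given set exist.\<close>
  have "\<exists>m. inaccessible m \<and> a \<^bold>\<in> V m \<and> sat mem {x. x \<^bold>\<in> V m} (\<lambda>_. emp) Top"
    by (rule unboundedly_many_worlds[OF _ accesses_refl[OF inaccessible_k]])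
      (auto simp: emp_mem_V_k)
  then show "\<exists>m. inaccessible m \<and> a \<^bold>\<in> m"
    using ordinal_mem_V[OF ordinal_inaccessible a] by blast
qed

text \<open>A counterexample anywhere above \<open>k\<close> recurs above \<open>m\<close>, so the
  box fails everywhere or nowhere on the worlds above \<open>k\<close>. The recurrence is available
  because \<open>p\<close> is equivalent there to one first-order formula.\<close>

lemma true_at_Box_constant:
  assumes e: "range e \<subseteq> {x. x \<^bold>\<in> V k}"
    and p: "\<And>m. accesses k m \<Longrightarrow> true_at m p \<longleftrightarrow> sat mem {x. x \<^bold>\<in> V m} e \<phi>"
    and m: "accesses k m"
  shows "true_at m (Box p) \<longleftrightarrow> (\<forall>l. accesses k l \<longrightarrow> true_at l p)"
proof
  show "\<forall>l. accesses k l \<longrightarrow> true_at l p \<Longrightarrow> true_at m (Box p)"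
    using accesses_trans[OF m] by simp
next
  assume box: "true_at m (Box p)"
  show "\<forall>l. accesses k l \<longrightarrow> true_at l p"
  proof (rule ccontr)
    assume "\<not> (\<forall>l. accesses k l \<longrightarrow> true_at l p)"
    then obtain l where l: "accesses k l" "\<not> true_at l p" by blast
    then have "sat mem {x. x \<^bold>\<in> V l} e (Neg \<phi>)" using p by simp
    then obtain m' where "accesses m m'" "sat mem {x. x \<^bold>\<in> V m'} e (Neg \<phi>)"
      using unboundedly_many_successors[OF e l(1) _ m] by blast
    then have "\<not> true_at m' p" using p[OF accesses_trans[OF m]] by simp
    with box \<open>accesses m m'\<close> show False by simp
  qed
qed

text \<open>Eliminates nested modalities from the inside out: once \<open>p\<close> is first-order
  above \<open>k\<close>, its box is constant there and can be replaced by \<open>Top\<close> or its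
  negation. For an implication the two parameter sequences are merged.\<close>

lemma modal_assertion_first_order:
  assumes "set_modal p \<subseteq> assertions (Vset k)"
  shows "\<exists>\<phi> e. range e \<subseteq> {x. x \<^bold>\<in> V k} \<and>
    (\<forall>m. accesses k m \<longrightarrow> (true_at m p \<longleftrightarrow> sat mem {x. x \<^bold>\<in> V m} e \<phi>))"
  using assms
proof (induction p)
  case (Atom a)
  obtain \<phi> e where a: "a = (\<phi>, e)" by (cases a)
  have "true_at m (Atom a) \<longleftrightarrow> sat mem {x. x \<^bold>\<in> V m} e \<phi>" if "accesses k m" for m
    using that Vset_inaccessible by (simp add: a accesses_def)
  moreover have "range e \<subseteq> {x. x \<^bold>\<in> V k}"
    using Atom Vset_inaccessible[OF inaccessible_k] by (simp add: a assertions_def)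
  ultimately show ?case by blast
next
  case Falsum
  show ?case by (intro exI[of _ "Neg Top"] exI[of _ "\<lambda>_. emp"]) (auto simp: emp_mem_V_k)
next
  case (Imp p q)
  obtain \<phi> e where 1: "range e \<subseteq> {x. x \<^bold>\<in> V k}"
    "\<And>m. accesses k m \<Longrightarrow> true_at m p \<longleftrightarrow> sat mem {x. x \<^bold>\<in> V m} e \<phi>"
    using Imp by auto
  obtain \<psi> d where 2: "range d \<subseteq> {x. x \<^bold>\<in> V k}"
    "\<And>m. accesses k m \<Longrightarrow> true_at m q \<longleftrightarrow> sat mem {x. x \<^bold>\<in> V m} d \<psi>"
    using Imp by auto
  have "range (merge e d) \<subseteq> {x. x \<^bold>\<in> V k}" using 1(1) 2(1) by (auto simp: merge_def)
  then show ?case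
    using 1(2) 2(2)
    by (intro exI[of _ "Neg (Conj (rename (\<lambda>n. 2 * n) \<phi>) (Neg (rename (\<lambda>n. Suc (2 * n)) \<psi>)))"]
        exI[of _ "merge e d"]) (simp add: sat_rename)
next
  case (Box p)
  obtain \<phi> e where p: "range e \<subseteq> {x. x \<^bold>\<in> V k}"
    "\<And>m. accesses k m \<Longrightarrow> true_at m p \<longleftrightarrow> sat mem {x. x \<^bold>\<in> V m} e \<phi>"
    using Box by auto
  have "true_at m (Box p) \<longleftrightarrow> (\<forall>l. accesses k l \<longrightarrow> true_at l p)" if "accesses k m" for m
    using true_at_Box_constant[OF p that] .
  then have "\<forall>m. accesses k m \<longrightarrow> (true_at m (Box p) \<longleftrightarrow>
      sat mem {x. x \<^bold>\<in> V m} (\<lambda>_. emp) (if \<forall>l. accesses k l \<longrightarrow> true_at l p then Top else Neg Top))"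
    by simp
  moreover have "range (\<lambda>_::nat. emp) \<subseteq> {x. x \<^bold>\<in> V k}" using emp_mem_V_k by auto
  ultimately show ?case by blast
qed

lemma true_at_Box_iff:
  assumes p: "set_modal p \<subseteq> assertions (Vset k)" and m: "accesses k m"
  shows "true_at m (Box p) \<longleftrightarrow> (\<forall>l. accesses k l \<longrightarrow> true_at l p)"
proof -
  obtain \<phi> e where "range e \<subseteq> {x. x \<^bold>\<in> V k}"
    "\<And>m. accesses k m \<Longrightarrow> true_at m p \<longleftrightarrow> sat mem {x. x \<^bold>\<in> V m} e \<phi>"
    using modal_assertion_first_order[OF p] by blast
  then show ?thesis using m by (rule true_at_Box_constant)
qed

lemma true_at_bool_eval:
  "true_at m (map_modal \<sigma> p) \<longleftrightarrow> bool_eval (\<lambda>q. true_at m (map_modal \<sigma> q)) p"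
  by (induction p) auto

text \<open>The induction covers all worlds above \<open>k\<close>, as necessitation requires. T and
  four hold because access is reflexive and transitive; five is where constancy of boxes
  enters.\<close>

lemma S5_subset_Val: "S5 \<subseteq> Val k (assertions (Vset k))"
proof
  fix p :: "nat modal" assume p: "p \<in> S5"
  have "true_at m (map_modal \<sigma> p)"
    if \<sigma>: "range \<sigma> \<subseteq> assertions (Vset k)" and m: "accesses k m" for \<sigma> :: "nat \<Rightarrow> _" and m
  proof -
    have sub: "set_modal (map_modal \<sigma> q) \<subseteq> assertions (Vset k)" for q
      using \<sigma> by (auto simp: modal.set_map)
    have box: "(\<forall>n. accesses m n \<longrightarrow> true_at n (map_modal \<sigma> q)) \<longleftrightarrow>
        (\<forall>l. accesses k l \<longrightarrow> true_at l (map_modal \<sigma> q))" if "accesses k m" for m q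
      using true_at_Box_iff[OF sub that, of q] by simp
    show ?thesis
      using p m
    proof (induction arbitrary: m rule: S5.induct)
      case (tautology p)
      then show ?case using true_at_bool_eval by blast
    next
      case (T p)
      have "accesses m m" using T by (auto simp: accesses_def)
      then show ?case by simp
    next
      case (four p)
      then show ?case using accesses_trans by auto
    next
      case (five p)
      have "accesses m n \<Longrightarrow> accesses k n" for n using five accesses_trans by blast
      then show ?case
        using box[OF five, of "Imp p Falsum"] box[of _ "Imp p Falsum"] by simp
    next
      case (necessitation p)
      then show ?case using accesses_trans by auto
    qed auto
  qed
  then show "p \<in> Val k (assertions (Vset k))"
    unfolding Val_def using accesses_refl[OF inaccessible_k] by blast
qed

text \<open>For \<open>x\<close> in \<open>V k\<close> the universe has a world containing
  \<open>x\<close>, namely \<open>V k\<close> itself; reflection yields one inside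
  \<open>V k\<close>.\<close>

lemma nth_above_limit_0: "nth_above_limit 0 k"
proof -
  have "\<exists>l. inaccessible l \<and> l \<^bold>\<in> k \<and> x \<^bold>\<in> V l" if x: "x \<^bold>\<in> V k" for x
  proof -
    have "sat mem UNIV (case_nat x (\<lambda>_. emp)) (some_world Top)"
      unfolding sat_some_world using inaccessible_k x by auto
    then have "sat mem {x. x \<^bold>\<in> V k} (case_nat x (\<lambda>_. emp)) (some_world Top)"
      using Sigma2_elementary_k[OF is_Sigma_some_world] x emp_mem_V_k by simp
    then show ?thesis by (rule sat_some_world_V[OF inaccessible_k x])
  qed
  then show ?thesis by simp
qed

text \<open>Each step passes to the least inaccessible above the current world, which exists by the
  universe axiom.\<close>

lemma nth_above_limit_exists: "\<exists>m. accesses k m \<and> nth_above_limit j m"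
proof (induction j)
  case 0
  show ?case using accesses_refl[OF inaccessible_k] nth_above_limit_0 by blast
next
  case (Suc j)
  then obtain m where m: "accesses k m" "nth_above_limit j m" by blast
  then have im: "inaccessible m" by (simp add: accesses_def)
  obtain a where a: "inaccessible a" "m \<^bold>\<in> a"
    using universe_axiom_k ordinal_inaccessible[OF im] unfolding universe_axiom_def by blast
  let ?P = "\<lambda>a. inaccessible a \<and> m \<^bold>\<in> a"
  have dP: "definable (\<lambda>e. ?P (e 0))" by (intro definability)
  obtain b where b: "inaccessible b" "m \<^bold>\<in> b" "\<And>c. c \<^bold>\<in> b \<Longrightarrow> \<not> ?P c"
    using least_ordinal[of ?P, OF dP ordinal_inaccessible[OF a(1)]] a by blast
  have "nth_above_limit (Suc j) b"
    using im b m(2) V_mem_V_iff[OF im] by auto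
  moreover have "accesses k b"
    using accesses_trans[OF m(1)] im b unfolding accesses_def by blast
  ultimately show ?case by blast
qed

text \<open>Since \<^term>\<open>k\<close> itself is a limit of inaccessibles, it receives the label 0; the last label
  collects all remaining worlds.\<close>

lemma Val_subset_S5: "Val k (assertions (Vset k)) \<subseteq> S5"
proof (rule Set.subsetI, rule ccontr)
  fix p assume p: "p \<in> Val k (assertions (Vset k))" "p \<notin> S5"
  obtain N W where N: "0 < N" "\<not> cluster_eval {..<N} W (0::nat) p"
    using S5_cluster_complete[OF p(2)] by blast
  \<comment> \<open>The alternative \<open>j = N - 1\<close> ensures that the minimum exists and
    stays below \<open>N\<close>.\<close>
  define label where "label m = (LEAST j. j = N - 1 \<or> nth_above_limit j m)" for m
  have label_less: "label m < N" for m
    using Least_le[of "\<lambda>j. j = N - 1 \<or> nth_above_limit j m" "N - 1"] N(1)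
    unfolding label_def by simp
  have label_eq: "label m = j" if "inaccessible m" "nth_above_limit j m" "j < N" for m j
    unfolding label_def
  proof (rule Least_equality)
    fix i assume "i = N - 1 \<or> nth_above_limit i m"
    then show "j \<le> i" using nth_above_limit_unique[OF that(1,2)] that(3) by auto
  qed (use that in blast)
  \<comment> \<open>Rewrites the minimum as a Boolean combination of finitely many conditions, which
    makes the label expressible.\<close>
  have label_iff: "label m = j \<longleftrightarrow> (j = N - 1 \<or> nth_above_limit j m) \<and>
      \<not> (\<exists>i<j. i = N - 1 \<or> nth_above_limit i m)" for m j
  proof
    assume "label m = j"
    then show "(j = N - 1 \<or> nth_above_limit j m) \<and> \<not> (\<exists>i<j. i = N - 1 \<or> nth_above_limit i m)"
      unfolding label_def
      using LeastI[of "\<lambda>j. j = N - 1 \<or> nth_above_limit j m" "N - 1"] not_less_Least by blast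
  next
    assume j: "(j = N - 1 \<or> nth_above_limit j m) \<and> \<not> (\<exists>i<j. i = N - 1 \<or> nth_above_limit i m)"
    show "label m = j"
      unfolding label_def by (rule Least_equality) (use j not_less in blast)+
  qed
  have ex_label: "expressible (\<lambda>m. label m = j)" for j
    unfolding label_iff
    by (intro expressible_conj expressible_not expressible_disj expressible_const
        expressible_ex_less expressible_nth_above_limit)
  have "expressible (\<lambda>m. \<exists>j<N. label m = j \<and> W j i)" for i
    by (intro expressible_ex_less expressible_conj expressible_const ex_label)
  moreover have "(\<exists>j<N. label m = j \<and> W j i) \<longleftrightarrow> W (label m) i" for m i
    using label_less by auto
  ultimately have "expressible (\<lambda>m. W (label m) i)" for i by simp
  then have "\<forall>i. \<exists>\<phi>. \<forall>m e. inaccessible m \<longrightarrow> (sat mem {x. x \<^bold>\<in> V m} e \<phi> \<longleftrightarrow> W (label m) i)"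
    unfolding expressible_def by blast
  then obtain \<phi> where \<phi>:
    "\<And>i m e. inaccessible m \<Longrightarrow> sat mem {x. x \<^bold>\<in> V m} e (\<phi> i) \<longleftrightarrow> W (label m) i"
    by metis
  define \<sigma> where "\<sigma> i = (\<phi> i, \<lambda>_::nat. emp)" for i
  have \<sigma>: "range \<sigma> \<subseteq> assertions (Vset k)"
    using emp_mem_V_k Vset_inaccessible[OF inaccessible_k]
    by (auto simp: \<sigma>_def assertions_def)
  have e: "range (\<lambda>_::nat. emp) \<subseteq> {x. x \<^bold>\<in> V k}" using emp_mem_V_k by auto
  \<comment> \<open>Every label occurs above \<open>k\<close> and is expressible, so by reflection
    it recurs above each world; each world therefore sees the entire cluster.\<close>
  have unbounded: "\<exists>m'. accesses m m' \<and> label m' = j" if m: "accesses k m" and j: "j < N" for m j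
  proof -
    obtain \<psi> where \<psi>: "\<And>m e. inaccessible m \<Longrightarrow> sat mem {x. x \<^bold>\<in> V m} e \<psi> \<longleftrightarrow> label m = j"
      using ex_label[of j] unfolding expressible_def by blast
    obtain l where l: "accesses k l" "nth_above_limit j l" using nth_above_limit_exists by blast
    then have "inaccessible l" by (simp add: accesses_def)
    then have "sat mem {x. x \<^bold>\<in> V l} (\<lambda>_. emp) \<psi>" using \<psi> label_eq l(2) j by blast
    then obtain m' where "accesses m m'" "sat mem {x. x \<^bold>\<in> V m'} (\<lambda>_. emp) \<psi>"
      using unboundedly_many_successors[OF e l(1) _ m] by blast
    then show ?thesis using \<psi> unfolding accesses_def by blast
  qed
  \<comment> \<open>\<open>label\<close> is a bounded morphism from the worlds above
    \<open>k\<close> onto the cluster.\<close>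
  have truth: "true_at m (map_modal \<sigma> q) \<longleftrightarrow> cluster_eval {..<N} W (label m) q"
    if "accesses k m" for m q
    using that
  proof (induction q arbitrary: m)
    case (Atom i)
    then have "inaccessible m" by (simp add: accesses_def)
    then show ?case using \<phi> Vset_inaccessible by (simp add: \<sigma>_def)
  next
    case (Box q)
    have IH: "true_at m' (map_modal \<sigma> q) \<longleftrightarrow> cluster_eval {..<N} W (label m') q"
      if "accesses m m'" for m'
      using Box.IH[OF accesses_trans[OF Box.prems that]] .
    have "(\<forall>m'. accesses m m' \<longrightarrow> cluster_eval {..<N} W (label m') q) \<longleftrightarrow>
        (\<forall>j<N. cluster_eval {..<N} W j q)"
      using unbounded[OF Box.prems] label_less by metis
    then show ?case using IH by (simp add: Ball_def)
  qed simp_all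
  have "label k = 0" using label_eq[OF inaccessible_k nth_above_limit_0 N(1)] .
  moreover have "true_at k (map_modal \<sigma> p)" using p(1) \<sigma> unfolding Val_def by blast
  ultimately show False using truth[OF accesses_refl[OF inaccessible_k]] N(2) by simp
qed

end

end

theorem theorem22:
  fixes mem :: "'v \<Rightarrow> 'v \<Rightarrow> bool" and \<kappa> :: 'v
  assumes "ZFC_model mem"
    and "set_structure.inaccessible mem \<kappa>"
  shows "(set_structure.universe_axiom mem \<and>
          set_structure.Val mem \<kappa>
            (set_structure.assertions (set_structure.Vset mem \<kappa>)) = S5)
         \<longleftrightarrow> set_structure.Sigma_reflecting mem 3 \<kappa>"
proof -
  interpret ZFC_model mem by fact
  show ?thesis
    using maximality_reflecting[OF assms(2)] universe_axiom_k S5_subset_Val Val_subset_S5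
    by blast
qed

end
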